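(* Let $p$ be a prime and let $K_1,K_2$ be two totally ramified (finite) extensions of $\mathbb{Q}_p(\zeta_p)$. Then $\mathcal{J}_{K_1}=\mathcal{J}_{K_2}$ if and only if $U_\bullet(K_1)\simeq U_\bullet(K_2)$ as filtered $\mathbb{Z}_p$-modules.
   Context: For a local field $K$ of residue characteristic $p$, with maximal ideal $m$ of its ring of integers, $U_i(K)=1+m^i$ and $U_\bullet(K)$ denotes the $\mathbb{Z}_p$-module $U_1(K)$ equipped with the filtration $(U_i(K))_{i\ge1}$. An isomorphism of filtered $\mathbb{Z}_p$-modules $U_\bullet(K_1)\to U_\bullet(K_2)$ is a $\mathbb{Z}_p$-module isomorphism $\phi:U_1(K_1)\to U_1(K_2)$ with $\phi(U_i(K_1))=U_i(K_2)$ for all $i\ge1$. A character of $U_1(K)$ is a continuous group homomorphism $\chi:U_1(K)\to\mathbb{Q}_p/\mathbb{Z}_p$; its set of jumps is $J_\chi=\{i\in\mathbb{Z}_{\ge1}:\chi(U_i(K))\ne\chi(U_{i+1}(K))\}$. $\mathcal{J}_K$ is the set of all $J_\chi$, as $\chi$ runs over the characters of $U_1(K)$. $\zeta_p$ is a primitive $p$-th root of unity. *)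

theory Defs
  imports
    "HOL-Computational_Algebra.Primes"
    "HOL-Analysis.Abstract_Topology"
    "HOL-Algebra.Algebra"
begin

section \<open>Valued fields\<close>

text \<open>The valuation is written additively with integer values. Its value at zero (which should
  be infinity) is irrelevant: zero is always treated separately.\<close>

record 'a valued_field = "'a ring" +
  val :: "'a \<Rightarrow> int"

definition vball :: "('a, 'm) valued_field_scheme \<Rightarrow> int \<Rightarrow> 'a set" where
  "vball K k = {x \<in> carrier K. x = \<zero>\<^bsub>K\<^esub> \<or> k \<le> val K x}"

definition valuation_ring ::
    "('a, 'm) valued_field_scheme \<Rightarrow> ('a, 'm) valued_field_scheme" where
  "valuation_ring K = K\<lparr>carrier := vball K 0\<rparr>"

definition max_ideal :: "('a, 'm) valued_field_scheme \<Rightarrow> 'a set" where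
  "max_ideal K = vball K 1"

definition vlim :: "('a, 'm) valued_field_scheme \<Rightarrow> (nat \<Rightarrow> 'a) \<Rightarrow> 'a \<Rightarrow> bool" where
  "vlim K s x \<longleftrightarrow> (\<forall>k. \<exists>N. \<forall>n\<ge>N. s n \<ominus>\<^bsub>K\<^esub> x \<in> vball K k)"

definition vcauchy :: "('a, 'm) valued_field_scheme \<Rightarrow> (nat \<Rightarrow> 'a) \<Rightarrow> bool" where
  "vcauchy K s \<longleftrightarrow> range s \<subseteq> carrier K \<and>
     (\<forall>k. \<exists>N. \<forall>m\<ge>N. \<forall>n\<ge>N. s m \<ominus>\<^bsub>K\<^esub> s n \<in> vball K k)"

definition vtopology :: "('a, 'm) valued_field_scheme \<Rightarrow> 'a topology" where
  "vtopology K = topology (\<lambda>S. S \<subseteq> carrier K \<and>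
     (\<forall>x\<in>S. \<exists>k. \<forall>y\<in>carrier K. y \<ominus>\<^bsub>K\<^esub> x \<in> vball K k \<longrightarrow> y \<in> S))"

lemma openin_vtopology:
  "openin (vtopology K) S \<longleftrightarrow> S \<subseteq> carrier K \<and>
     (\<forall>x\<in>S. \<exists>k. \<forall>y\<in>carrier K. y \<ominus>\<^bsub>K\<^esub> x \<in> vball K k \<longrightarrow> y \<in> S)"
proof -
  have mono: "vball K l \<subseteq> vball K k" if "k \<le> l" for k l
    using that by (auto simp: vball_def)
  have "istopology (\<lambda>S. S \<subseteq> carrier K \<and>
     (\<forall>x\<in>S. \<exists>k. \<forall>y\<in>carrier K. y \<ominus>\<^bsub>K\<^esub> x \<in> vball K k \<longrightarrow> y \<in> S))" (is "istopology ?P")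
    unfolding istopology_def
  proof (intro conjI allI impI)
    fix S T assume ST: "?P S" "?P T"
    have "\<exists>k. \<forall>y\<in>carrier K. y \<ominus>\<^bsub>K\<^esub> x \<in> vball K k \<longrightarrow> y \<in> S \<inter> T" if x: "x \<in> S \<inter> T" for x
    proof -
      obtain k l where "\<forall>y\<in>carrier K. y \<ominus>\<^bsub>K\<^esub> x \<in> vball K k \<longrightarrow> y \<in> S"
          "\<forall>y\<in>carrier K. y \<ominus>\<^bsub>K\<^esub> x \<in> vball K l \<longrightarrow> y \<in> T"
        using x ST by blast
      then have "\<forall>y\<in>carrier K. y \<ominus>\<^bsub>K\<^esub> x \<in> vball K (max k l) \<longrightarrow> y \<in> S \<inter> T"
        using mono[of k "max k l"] mono[of l "max k l"] by auto
      then show ?thesis ..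
    qed
    then show "S \<inter> T \<subseteq> carrier K"
      and "\<forall>x\<in>S \<inter> T. \<exists>k. \<forall>y\<in>carrier K. y \<ominus>\<^bsub>K\<^esub> x \<in> vball K k \<longrightarrow> y \<in> S \<inter> T"
      using ST by auto
  next
    fix \<K> assume "\<forall>S\<in>\<K>. ?P S"
    then show "\<Union>\<K> \<subseteq> carrier K"
      and "\<forall>x\<in>\<Union>\<K>. \<exists>k. \<forall>y\<in>carrier K. y \<ominus>\<^bsub>K\<^esub> x \<in> vball K k \<longrightarrow> y \<in> \<Union>\<K>"
      by (blast, meson UnionE UnionI)
  qed
  then show ?thesis
    by (simp add: vtopology_def)
qed

text \<open>A non-archimedean local field, with its normalized valuation.\<close>

locale local_field = Ring.field K for K :: "('a, 'm) valued_field_scheme" (structure) +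
  assumes val_mult: "\<lbrakk>x \<in> carrier K - {\<zero>}; y \<in> carrier K - {\<zero>}\<rbrakk>
      \<Longrightarrow> val K (x \<otimes> y) = val K x + val K y"
    and val_add: "\<lbrakk>x \<in> carrier K - {\<zero>}; y \<in> carrier K - {\<zero>}; x \<oplus> y \<noteq> \<zero>\<rbrakk>
      \<Longrightarrow> min (val K x) (val K y) \<le> val K (x \<oplus> y)"
    and val_surj: "val K ` (carrier K - {\<zero>}) = UNIV"
    and complete: "vcauchy K s \<Longrightarrow> \<exists>x\<in>carrier K. vlim K s x"
    and finite_residue_field: "finite (carrier (valuation_ring K Quot max_ideal K))"


section \<open>The p-adic numbers\<close>

definition cauchy_ring :: "('a, 'm) valued_field_scheme \<Rightarrow> (nat \<Rightarrow> 'a) ring" where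
  "cauchy_ring K = \<lparr>carrier = {s. vcauchy K s},
     monoid.mult = (\<lambda>s t n. s n \<otimes>\<^bsub>K\<^esub> t n), monoid.one = (\<lambda>n. \<one>\<^bsub>K\<^esub>),
     ring.zero = (\<lambda>n. \<zero>\<^bsub>K\<^esub>), ring.add = (\<lambda>s t n. s n \<oplus>\<^bsub>K\<^esub> t n)\<rparr>"

definition null_seqs :: "('a, 'm) valued_field_scheme \<Rightarrow> (nat \<Rightarrow> 'a) set" where
  "null_seqs K = {s. vcauchy K s \<and> vlim K s \<zero>\<^bsub>K\<^esub>}"

text \<open>The valuation of a Cauchy sequence that does not tend to zero is eventually constant.\<close>

definition completion :: "('a, 'm) valued_field_scheme \<Rightarrow> (nat \<Rightarrow> 'a) set valued_field" where
  "completion K = ring.extend (cauchy_ring K Quot null_seqs K)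
     (valued_field.fields (\<lambda>C. THE k. \<forall>s\<in>C. \<exists>N. \<forall>n\<ge>N. val K (s n) = k))"

definition padic_val :: "nat \<Rightarrow> rat \<Rightarrow> int" where
  "padic_val p x = int (multiplicity (int p) (fst (quotient_of x)))
                 - int (multiplicity (int p) (snd (quotient_of x)))"

definition rat_padic :: "nat \<Rightarrow> rat valued_field" where
  "rat_padic p = \<lparr>carrier = UNIV, monoid.mult = (*), monoid.one = 1, ring.zero = 0,
     ring.add = (+), val = padic_val p\<rparr>"

type_synonym padic = "(nat \<Rightarrow> rat) set"

definition Qp :: "nat \<Rightarrow> padic valued_field" where
  "Qp p = completion (rat_padic p)"

definition Zp :: "nat \<Rightarrow> padic valued_field" where
  "Zp p = valuation_ring (Qp p)"

definition Qp_mod_Zp :: "nat \<Rightarrow> padic set monoid" where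
  "Qp_mod_Zp p = add_monoid (Qp p) Mod carrier (Zp p)"


section \<open>Totally ramified extensions\<close>

text \<open>An embedding of valued fields; the valuation of the larger field restricts to a positive
  multiple of that of the smaller one, as both are normalized.\<close>

definition valued_extension ::
    "('a, 'm) valued_field_scheme \<Rightarrow> ('b, 'n) valued_field_scheme \<Rightarrow> ('a \<Rightarrow> 'b) \<Rightarrow> bool" where
  "valued_extension F K \<iota> \<longleftrightarrow> \<iota> \<in> ring_hom F K \<and>
     (\<exists>e::nat. 0 < e \<and> (\<forall>x\<in>carrier F - {\<zero>\<^bsub>F\<^esub>}. val K (\<iota> x) = int e * val F x))"

text \<open>The index of the value group of the subfield \<open>L\<close> in the value group of \<open>K\<close>, which is the
  group of all integers.\<close>

definition ramification_index :: "('a, 'm) valued_field_scheme \<Rightarrow> 'a set \<Rightarrow> nat" where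
  "ramification_index K L = card (rcosets\<^bsub>integer_group\<^esub> (val K ` (L - {\<zero>\<^bsub>K\<^esub>})))"

definition totally_ramified :: "('a, 'm) valued_field_scheme \<Rightarrow> 'a set \<Rightarrow> bool" where
  "totally_ramified K L \<longleftrightarrow> subfield L K \<and>
     (\<exists>n. ring.dimension K n L (carrier K) \<and> ramification_index K L = n)"

definition primitive_root_of_unity :: "('a, 'm) ring_scheme \<Rightarrow> nat \<Rightarrow> 'a \<Rightarrow> bool" where
  "primitive_root_of_unity K n \<zeta> \<longleftrightarrow> \<zeta> \<in> carrier K \<and> \<zeta> [^]\<^bsub>K\<^esub> n = \<one>\<^bsub>K\<^esub> \<and>
     (\<forall>k. 0 < k \<and> k < n \<longrightarrow> \<zeta> [^]\<^bsub>K\<^esub> k \<noteq> \<one>\<^bsub>K\<^esub>)"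

text \<open>The subfield generated below does not depend on the choice of the root of unity. A finite
  extension of the p-adic numbers carries exactly one structure of a normalized local field
  extending the p-adic valuation, so requiring it here fixes the valuation and is no restriction.\<close>

definition totally_ramified_over_Qp_zeta ::
    "nat \<Rightarrow> ('a, 'm) valued_field_scheme \<Rightarrow> bool" where
  "totally_ramified_over_Qp_zeta p K \<longleftrightarrow> local_field K \<and>
     (\<exists>\<iota> \<zeta>. valued_extension (Qp p) K \<iota> \<and> primitive_root_of_unity K p \<zeta> \<and>
       totally_ramified K (generate_field K (insert \<zeta> (\<iota> ` carrier (Qp p)))))"


section \<open>The filtered module of principal units\<close>

definition principal_units :: "('a, 'm) valued_field_scheme \<Rightarrow> nat \<Rightarrow> 'a set" where
  "principal_units K i =
     {\<one>\<^bsub>K\<^esub> \<oplus>\<^bsub>K\<^esub> x | x. x \<in> max_ideal K [^]\<^bsub>ideals_set (valuation_ring K)\<^esub> i}"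

text \<open>\<open>u\<^sup>a\<close> for a p-adic integer \<open>a\<close> is the limit of \<open>u\<^sup>n\<close> as the natural number \<open>n\<close> tends to \<open>a\<close>
  p-adically.\<close>

definition zp_power :: "nat \<Rightarrow> ('a, 'm) valued_field_scheme \<Rightarrow> padic \<Rightarrow> 'a \<Rightarrow> 'a" where
  "zp_power p K a u = (THE y. y \<in> carrier K \<and>
     (\<forall>s :: nat \<Rightarrow> nat. vlim (Qp p) (\<lambda>n. [s n] \<cdot>\<^bsub>Qp p\<^esub> \<one>\<^bsub>Qp p\<^esub>) a
        \<longrightarrow> vlim K (\<lambda>n. u [^]\<^bsub>K\<^esub> s n) y))"

text \<open>The group law of the module is the multiplication of \<open>K\<close>. The module record also has
  \<open>mult\<close> and \<open>one\<close> components, which play no role for modules; they are filled in so that the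
  record is at the same time the multiplicative group of principal units.\<close>

definition units_module :: "nat \<Rightarrow> ('a, 'm) valued_field_scheme \<Rightarrow> (padic, 'a) module" where
  "units_module p K = \<lparr>carrier = principal_units K 1,
     monoid.mult = monoid.mult K, monoid.one = monoid.one K,
     ring.zero = monoid.one K, ring.add = monoid.mult K, smult = zp_power p K\<rparr>"

definition filtered_module_iso ::
    "('r, 'm) ring_scheme \<Rightarrow> ('r, 'a, 'n) module_scheme \<Rightarrow> (nat \<Rightarrow> 'a set)
      \<Rightarrow> ('r, 'b, 'k) module_scheme \<Rightarrow> (nat \<Rightarrow> 'b set) \<Rightarrow> ('a \<Rightarrow> 'b) \<Rightarrow> bool" where
  "filtered_module_iso R M F N G \<phi> \<longleftrightarrow> \<phi> \<in> iso (add_monoid M) (add_monoid N) \<and>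
     (\<forall>a\<in>carrier R. \<forall>x\<in>carrier M. \<phi> (a \<odot>\<^bsub>M\<^esub> x) = a \<odot>\<^bsub>N\<^esub> \<phi> x) \<and>
     (\<forall>i\<ge>1. \<phi> ` F i = G i)"


section \<open>Characters and jump sets\<close>

text \<open>The quotient topology on \<open>Qp_mod_Zp p\<close> is discrete, as the p-adic integers are open.\<close>

definition character :: "nat \<Rightarrow> ('a, 'm) valued_field_scheme \<Rightarrow> ('a \<Rightarrow> padic set) \<Rightarrow> bool" where
  "character p K \<chi> \<longleftrightarrow> \<chi> \<in> hom (units_module p K) (Qp_mod_Zp p) \<and>
     continuous_map (subtopology (vtopology K) (principal_units K 1))
       (discrete_topology (carrier (Qp_mod_Zp p))) \<chi>"

definition jumps :: "('a, 'm) valued_field_scheme \<Rightarrow> ('a \<Rightarrow> padic set) \<Rightarrow> nat set" where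
  "jumps K \<chi> = {i. 1 \<le> i \<and> \<chi> ` principal_units K i \<noteq> \<chi> ` principal_units K (i + 1)}"

definition jump_sets :: "nat \<Rightarrow> ('a, 'm) valued_field_scheme \<Rightarrow> nat set set" where
  "jump_sets p K = {jumps K \<chi> | \<chi>. character p K \<chi>}"

end

theory Submission
  imports Defs "HOL-Computational_Algebra.Polynomial"
begin

text \<open>Raising a principal unit to the power \<open>p\<close> moves it from level \<open>i\<close> exactly to level \<open>\<rho> i\<close>,
  except at the level \<open>a = e / (p - 1)\<close> of \<open>\<zeta> - 1\<close>, where the image drops deeper because the residue
  field has \<open>p\<close> elements and the \<open>p\<close>-th roots of unity lie in the field. Units \<open>\<eta> i\<close> of level \<open>i\<close>, one
  for each \<open>i\<close> in the finite set \<open>T\<close>, therefore generate the group modulo every level \<open>m\<close>, and up to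
  powers that are trivial there they satisfy a single relation, with exponents \<open>p ^ b i * u i\<close> where
  \<open>p\<close> does not divide \<open>u i\<close>. A term \<open>j\<close> with \<open>b i \<le> b j\<close> and \<open>\<rho>\<close>-shifted level no smaller than that of
  another term \<open>i\<close> can be absorbed into \<open>\<eta> i\<close>, so the relation has a normal form that depends only on
  the undominated pairs \<open>(i, b i)\<close>.

  These pairs are visible in the jump sets: \<open>(i, n)\<close> is an undominated pair if and only if \<open>n\<close> is the
  least number for which \<open>{i, \<rho> i, \<dots>, \<rho>\<^sup>n i}\<close> is not the jump set of a character. For an undominated
  pair all other terms of the relation vanish under a character with this jump set, which is a
  contradiction; otherwise the value on one more generator can be used to satisfy the relation. So
  equal families of jump sets give isomorphisms modulo every level, and a compactness argument
  produces a filtered isomorphism, which is \<open>p\<close>-adically linear by continuity.\<close>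

section \<open>The shift of the filtration under raising to the power p\<close>

text \<open>All field theory is condensed into the axioms of \<open>filtered_group\<close>, and two
  facts feed them. With \<pi> = \<zeta> - 1 of valuation a, the equation (1 + \<pi>)^p = 1 forces
  val(p) = (p - 1) * a. And the residue field of K is the prime field: Qp(\<zeta>) lies in the
  closure of Z[\<pi>, 1/\<pi>], whose elements have integers times powers of \<pi> as leading terms,
  while total ramification leaves no room for further residues in K. The relation arises because the
  chain of iterates of \<open>\<rho>\<close> through \<open>a\<close> breaks there. The next level p
  * a is not reached by p-th powers and needs a generator of its own, while the power of
  \<open>\<eta> t\<close> that should have reached it lands deeper and becomes a product of terms
  beyond p * a. Working modulo a level m allows integer exponents and finitely many generators. The
  price is that the normal form and the generators adapted to it depend on m, so the isomorphisms
  for different m need not be compatible. They become comparable by recording, for each m, the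
  images of one fixed finite family of generators.\<close>

locale jump_shift =
  fixes p a :: nat
  assumes prime_p: "Factorial_Ring.prime p" and a_pos: "0 < a"
begin

text \<open>The minimum of p * i and i + e with e = (p - 1) * a: these are the valuations of x^p and
  p * x, the two leading terms of (1 + x)^p - 1 for x of valuation i. For positive i they agree
  exactly at i = a.\<close>

definition \<rho> :: "nat \<Rightarrow> nat" where
  "\<rho> i = (if i \<le> a then p * i else i + (p - 1) * a)"

text \<open>The positive levels that are not \<open>\<rho> j\<close> for a positive j other than
  \<open>a\<close>, so each of them needs a generator of its own. The value p * a =
  \<open>\<rho> a\<close> is included because p-th powers from level \<open>a\<close> land
  deeper.\<close>

definition T :: "nat set" where
  "T = insert (p * a) {i. 1 \<le> i \<and> i \<le> p * a \<and> \<not> p dvd i}"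

text \<open>Only the starting points of the l steps are tested; the end of the chain may be
  \<open>a\<close>. Along such a chain each p-th power moves a unit by exactly one application of
  \<open>\<rho>\<close>.\<close>

definition unramified_path :: "nat \<Rightarrow> nat \<Rightarrow> bool" where
  "unramified_path l i \<longleftrightarrow> (\<forall>l'<l. (\<rho> ^^ l') i \<noteq> a)"

text \<open>The exponent of p that suffices to carry level i to level k or deeper;
  p^(\<open>L i k\<close>) serves as the modulus for exponents of a generator of level i.\<close>

definition L :: "nat \<Rightarrow> nat \<Rightarrow> nat" where
  "L i k = (LEAST l. k \<le> (\<rho> ^^ l) i)"

lemma p_ge_2: "2 \<le> p"
  using prime_p prime_ge_2_nat by blast

lemma rho_a [simp]: "\<rho> a = p * a"
  by (simp add: \<rho>_def)

lemma pa_eq: "p * a = a + (p - 1) * a"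
  using p_ge_2 by (cases p) auto

lemma rho_strict_mono: "strict_mono \<rho>"
proof (rule strict_monoI)
  fix i j :: nat assume "i < j"
  consider "j \<le> a" | "i \<le> a" "a < j" | "a < i" using \<open>i < j\<close> by linarith
  then show "\<rho> i < \<rho> j"
  proof cases
    case 2
    then have "p * i \<le> p * a" by simp
    then show ?thesis using 2 pa_eq by (simp add: \<rho>_def)
  qed (use \<open>i < j\<close> p_ge_2 in \<open>auto simp: \<rho>_def\<close>)
qed

lemma rho_pow_strict_mono: "strict_mono (\<rho> ^^ l)"
  by (induction l) (auto simp: strict_mono_def dest: strict_monoD[OF rho_strict_mono])

lemma rho_pow_less_iff [simp]: "(\<rho> ^^ l) i < (\<rho> ^^ l) j \<longleftrightarrow> i < j"
  using rho_pow_strict_mono strict_mono_less by blast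

lemma rho_pow_le_iff [simp]: "(\<rho> ^^ l) i \<le> (\<rho> ^^ l) j \<longleftrightarrow> i \<le> j"
  using rho_pow_strict_mono strict_mono_less_eq by blast

lemma rho_pow_eq_iff [simp]: "(\<rho> ^^ l) i = (\<rho> ^^ l) j \<longleftrightarrow> i = j"
  using rho_pow_strict_mono strict_mono_eq by blast

lemma rho_le_iff [simp]: "\<rho> i \<le> \<rho> j \<longleftrightarrow> i \<le> j"
  using rho_strict_mono strict_mono_less_eq by blast

lemma rho_gt: "i < \<rho> i" if "1 \<le> i"
  using that p_ge_2 a_pos by (auto simp: \<rho>_def)

lemma rho_pow_ge: "i + l \<le> (\<rho> ^^ l) i" if "1 \<le> i"
proof (induction l)
  case (Suc l)
  then have "1 \<le> (\<rho> ^^ l) i" using that by linarith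
  then show ?case using rho_gt[of "(\<rho> ^^ l) i"] Suc by simp
qed simp

lemma rho_pow_pos: "1 \<le> (\<rho> ^^ l) i" if "1 \<le> i"
  using rho_pow_ge[OF that, of l] that by linarith

lemma rho_pow_add: "(\<rho> ^^ (l + l')) i = (\<rho> ^^ l) ((\<rho> ^^ l') i)"
  by (simp add: funpow_add)

lemma rho_pow_strict_left: "(\<rho> ^^ l) i < (\<rho> ^^ l') i" if "1 \<le> i" "l < l'"
proof -
  have "(\<rho> ^^ l') i = (\<rho> ^^ l) ((\<rho> ^^ (l' - l)) i)"
    using that(2) by (simp flip: rho_pow_add)
  moreover have "i < (\<rho> ^^ (l' - l)) i"
    using rho_pow_ge[OF that(1), of "l' - l"] that(2) by linarith
  ultimately show ?thesis by simp
qed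

lemma rho_pow_left_le_iff: "(\<rho> ^^ l) i \<le> (\<rho> ^^ l') i \<longleftrightarrow> l \<le> l'" if "1 \<le> i"
  using rho_pow_strict_left[OF that, of l l'] rho_pow_strict_left[OF that, of l' l]
  by (metis le_less linorder_not_le)

lemma finite_T [simp]: "finite T"
  by (simp add: T_def)

lemma T_pos: "i \<in> T \<Longrightarrow> 1 \<le> i"
  using a_pos p_ge_2 by (auto simp: T_def)

lemma T_le: "i \<in> T \<Longrightarrow> i \<le> p * a"
  by (auto simp: T_def)

lemma pa_in_T [simp]: "p * a \<in> T"
  by (simp add: T_def)

lemma rho_in_T: "\<rho> j \<in> T \<Longrightarrow> j = a"
proof -
  assume j: "\<rho> j \<in> T"
  then have "\<rho> j \<le> \<rho> a" using T_le by simp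
  then have "j \<le> a" by (simp only: rho_le_iff)
  then have "\<rho> j = p * j" by (simp add: \<rho>_def)
  then show ?thesis using j prime_p by (auto simp: T_def)
qed

lemma not_in_T: "\<exists>j\<ge>1. j \<noteq> a \<and> \<rho> j = k" if "1 \<le> k" "k \<notin> T"
proof (cases "k \<le> p * a")
  case True
  then have "p dvd k" using that by (auto simp: T_def)
  then obtain j where j: "k = p * j" by blast
  then have "j \<le> a" "1 \<le> j" "j \<noteq> a" using True that p_ge_2 by (auto simp: Suc_le_eq T_def)
  then show ?thesis using j by (auto simp: \<rho>_def)
next
  case False
  then have *: "a < k - (p - 1) * a" using pa_eq by linarith
  then have "\<rho> (k - (p - 1) * a) = k" by (simp add: \<rho>_def)
  with * show ?thesis using a_pos by (intro exI[of _ "k - (p - 1) * a"]) auto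
qed

section \<open>Chains of iterates of \<open>\<rho>\<close> that start in \<open>T\<close>\<close>

lemma path_exists: "\<exists>i\<in>T. \<exists>l. (\<rho> ^^ l) i = k \<and> unramified_path l i" if "1 \<le> k"
  using that
proof (induction k rule: less_induct)
  case (less k)
  show ?case
  proof (cases "k \<in> T")
    case True
    then show ?thesis by (intro bexI[of _ k] exI[of _ 0]) (auto simp: unramified_path_def)
  next
    case False
    then obtain j where j: "1 \<le> j" "j \<noteq> a" "\<rho> j = k" using not_in_T less.prems by blast
    then have "j < k" using rho_gt by blast
    then obtain i l where il: "i \<in> T" "(\<rho> ^^ l) i = j" "unramified_path l i"
      using less.IH j by blast
    then have "(\<rho> ^^ Suc l) i = k" "unramified_path (Suc l) i"
      using j by (auto simp: unramified_path_def less_Suc_eq)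
    then show ?thesis using il by blast
  qed
qed

text \<open>After cancelling the common iterations, a nonempty remaining piece would end in the
  element i of \<open>T\<close>; its last step would then start at \<open>a\<close>, which an
  unramified chain forbids.\<close>

lemma path_unique_aux:
  assumes "i \<in> T" "j \<in> T" "unramified_path l' j" "(\<rho> ^^ l) i = (\<rho> ^^ l') j" "l \<le> l'"
  shows "i = j \<and> l = l'"
proof -
  have "(\<rho> ^^ l) i = (\<rho> ^^ l) ((\<rho> ^^ (l' - l)) j)"
    using assms(4,5) by (simp flip: rho_pow_add)
  then have i: "i = (\<rho> ^^ (l' - l)) j" by simp
  show ?thesis
  proof (cases "l' - l")
    case (Suc d)
    then have "\<rho> ((\<rho> ^^ d) j) \<in> T" using i assms(1) by simp
    then have "(\<rho> ^^ d) j = a" by (rule rho_in_T)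
    then show ?thesis using assms(3) Suc by (auto simp: unramified_path_def)
  qed (use i assms in auto)
qed

lemma path_unique:
  assumes "i \<in> T" "j \<in> T" "unramified_path l i" "unramified_path l' j" "(\<rho> ^^ l) i = (\<rho> ^^ l') j"
  shows "i = j \<and> l = l'"
  using path_unique_aux[of i j l' l] path_unique_aux[of j i l l'] assms
  by (metis nat_le_linear)

lemma unramified_path_if: "unramified_path l i" if "(\<rho> ^^ l) i = a" "1 \<le> i"
  using that rho_pow_strict_left by (fastforce simp: unramified_path_def)

text \<open>By \<open>path_unique\<close> just one chain from \<open>T\<close> meets
  \<open>a\<close>; it starts at \<open>t\<close> and meets \<open>a\<close> after \<open>s\<close>
  steps. Its next point p * a lies in \<open>T\<close> again, so from there on the chains of
  \<open>t\<close> and of p * a coincide.\<close>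

definition t :: nat where "t = (SOME i. i \<in> T \<and> (\<exists>l. (\<rho> ^^ l) i = a))"
definition s :: nat where "s = (SOME l. (\<rho> ^^ l) t = a)"

lemma t_in_T [simp]: "t \<in> T" and rho_s_t: "(\<rho> ^^ s) t = a"
proof -
  have "\<exists>i. i \<in> T \<and> (\<exists>l. (\<rho> ^^ l) i = a)"
    using path_exists[of a] a_pos by (auto simp: Suc_le_eq)
  from someI_ex[OF this] have *: "t \<in> T" "\<exists>l. (\<rho> ^^ l) t = a" by (auto simp: t_def)
  from *(1) show "t \<in> T" .
  from someI_ex[OF *(2)] show "(\<rho> ^^ s) t = a" by (simp add: s_def)
qed

lemma rho_Suc_s_t: "(\<rho> ^^ Suc s) t = p * a"
  by (simp add: rho_s_t)

lemma ramified_path: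
  assumes "i \<in> T" "\<not> unramified_path l i"
  shows "i = t \<and> s < l"
proof -
  obtain l' where l': "l' < l" "(\<rho> ^^ l') i = a" using assms(2) by (auto simp: unramified_path_def)
  have "i = t \<and> l' = s"
    using assms(1) l' rho_s_t T_pos
    by (intro path_unique) (auto intro!: unramified_path_if)
  then show ?thesis using l' by blast
qed

lemma L_le_iff: "L i k \<le> l \<longleftrightarrow> k \<le> (\<rho> ^^ l) i" if "1 \<le> i"
proof
  have "k \<le> (\<rho> ^^ k) i" using rho_pow_ge[OF that, of k] by linarith
  then have *: "k \<le> (\<rho> ^^ L i k) i" unfolding L_def by (rule LeastI)
  assume "L i k \<le> l"
  with * show "k \<le> (\<rho> ^^ l) i" using rho_pow_left_le_iff[OF that] le_trans by blast
next
  assume "k \<le> (\<rho> ^^ l) i"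
  then show "L i k \<le> l" unfolding L_def by (rule Least_le)
qed

lemma L_rho_pow [simp]: "L i ((\<rho> ^^ l) i) = l" if "1 \<le> i"
  using L_le_iff[OF that] rho_pow_left_le_iff[OF that] by (metis order.refl order_antisym)

lemma L_mono: "k \<le> k' \<Longrightarrow> L i k \<le> L i k'" if "1 \<le> i"
  using L_le_iff[OF that] by (meson le_trans order_refl)

text \<open>Moving the bound from k to k + 1 costs another factor p exactly when k is a point of the
  chain of i. Jumps and relations at level k are both detected this way.\<close>

lemma L_Suc: "L i (Suc k) = (if (\<rho> ^^ L i k) i = k then Suc (L i k) else L i k)" if "1 \<le> i"
proof -
  have k: "k \<le> (\<rho> ^^ L i k) i" using L_le_iff[OF that] by blast
  show ?thesis
  proof (cases "(\<rho> ^^ L i k) i = k")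
    case True
    have "Suc k \<le> (\<rho> ^^ Suc (L i k)) i"
      using True rho_pow_strict_left[OF that, of "L i k" "Suc (L i k)"] by simp
    moreover have "\<not> Suc k \<le> (\<rho> ^^ L i k) i" using True by simp
    ultimately show ?thesis using True L_le_iff[OF that] by (metis le_SucE le_antisym)
  next
    case False
    then have "L i (Suc k) \<le> L i k" using k L_le_iff[OF that] by simp
    then show ?thesis using False L_mono[OF that, of k "Suc k"] by simp
  qed
qed

lemma L_1 [simp]: "L i (Suc 0) = 0" if "1 \<le> i"
  using L_le_iff[OF that, of "Suc 0" 0] that by simp

lemma L_le_self: "L i k \<le> k" if "1 \<le> i"
  using L_le_iff[OF that, of k k] rho_pow_ge[OF that, of k] by simp

lemma L_t_Suc_pa: "L t (Suc (p * a)) = Suc (Suc s)"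
proof -
  have "1 \<le> t" using T_pos by simp
  with L_rho_pow[OF this, of "Suc s"] have "L t (p * a) = Suc s" by (simp only: rho_Suc_s_t)
  then show ?thesis using L_Suc[OF \<open>1 \<le> t\<close>, of "p * a"] rho_Suc_s_t by simp
qed

end

section \<open>Filtered groups of principal-unit type\<close>

text \<open>Index 0 is padding, with \<open>U 0\<close> the whole group. From level 1 on,
  \<open>U_strict\<close>, \<open>U_cyclic\<close> and \<open>U_pow\<close> make every graded piece
  cyclic of order p, which reflects a residue field of p elements; \<open>U_pow_a\<close> reflects
  the root of unity. In \<open>U_complete\<close>, consecutive quotients in \<open>U n\<close> give
  a limit that agrees with \<open>f n\<close> modulo the same \<open>U n\<close>.\<close>

locale filtered_group = comm_group G + jump_shift p a
  for G :: "('g, 'm) monoid_scheme" (structure) and U :: "nat \<Rightarrow> 'g set" and p a :: nat +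
  assumes U_0: "U 0 = carrier G" and U_1: "U (Suc 0) = carrier G"
    and U_subgroup: "subgroup (U i) G"
    and U_Suc_subset: "U (Suc i) \<subseteq> U i"
    and U_strict: "1 \<le> i \<Longrightarrow> \<exists>x. x \<in> U i - U (Suc i)"
    and U_cyclic: "\<lbrakk>1 \<le> i; x \<in> U i - U (Suc i); y \<in> U i\<rbrakk> \<Longrightarrow> \<exists>n::int. y \<otimes> inv (x [^] n) \<in> U (Suc i)"
    and U_pow: "\<lbrakk>1 \<le> i; x \<in> U i\<rbrakk> \<Longrightarrow> x [^] p \<in> U (\<rho> i)"
    and U_pow_exact: "\<lbrakk>1 \<le> i; i \<noteq> a; x \<in> U i - U (Suc i)\<rbrakk> \<Longrightarrow> x [^] p \<notin> U (Suc (\<rho> i))"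
    and U_pow_a: "x \<in> U a \<Longrightarrow> x [^] p \<in> U (Suc (\<rho> a))"
    and U_separated: "(\<And>i. x \<in> U i) \<Longrightarrow> x = \<one>"
    and U_complete: "\<lbrakk>\<And>n. f n \<in> carrier G; \<And>n. f (Suc n) \<otimes> inv (f n) \<in> U n\<rbrakk>
      \<Longrightarrow> \<exists>y\<in>carrier G. \<forall>n. y \<otimes> inv (f n) \<in> U n"
begin

section \<open>Congruences modulo a level of the filtration\<close>

lemma U_antimono: "i \<le> j \<Longrightarrow> U j \<subseteq> U i"
  by (rule lift_Suc_antimono_le[of U]) (rule U_Suc_subset)

lemma U_carrier: "x \<in> U i \<Longrightarrow> x \<in> carrier G"
  using subgroup.subset[OF U_subgroup] by blast

lemma U_one [simp]: "\<one> \<in> U i"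
  by (rule subgroup.one_closed[OF U_subgroup])

lemma U_mult: "x \<in> U i \<Longrightarrow> y \<in> U i \<Longrightarrow> x \<otimes> y \<in> U i"
  by (rule subgroup.m_closed[OF U_subgroup])

lemma U_inv: "x \<in> U i \<Longrightarrow> inv x \<in> U i"
  by (rule subgroup.m_inv_closed[OF U_subgroup])

lemma U_nat_pow: "x \<in> U i \<Longrightarrow> x [^] (n::nat) \<in> U i"
  by (induction n) (simp_all add: U_mult)

lemma U_int_pow: "x \<in> U i \<Longrightarrow> x [^] (n::int) \<in> U i"
  using U_nat_pow[of x i] U_inv[of _ i] unfolding int_pow_def2 by presburger

lemma U_finprod: "(\<And>i. i \<in> A \<Longrightarrow> f i \<in> U k) \<Longrightarrow> finprod G f A \<in> U k"
proof (induction A rule: infinite_finite_induct)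
  case (insert i A)
  have "f j \<in> carrier G" if "j \<in> insert i A" for j
    using insert.prems[OF that] by (rule U_carrier)
  then have "finprod G f (insert i A) = f i \<otimes> finprod G f A"
    using insert.hyps by (intro finprod_insert) (simp_all add: Pi_iff)
  moreover have "f i \<in> U k" "finprod G f A \<in> U k" using insert by simp_all
  ultimately show ?case by (simp add: U_mult)
qed auto

lemma U_mult_left_iff: "x \<in> U k \<Longrightarrow> y \<in> carrier G \<Longrightarrow> x \<otimes> y \<in> U k \<longleftrightarrow> y \<in> U k"
proof
  assume *: "x \<in> U k" "y \<in> carrier G" "x \<otimes> y \<in> U k"
  then have "inv x \<otimes> (x \<otimes> y) \<in> U k" using U_mult[OF U_inv] by blast
  then show "y \<in> U k" using *(2) U_carrier[OF *(1)] by (simp add: m_assoc[symmetric])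
qed (rule U_mult)

definition cong_mod :: "nat \<Rightarrow> 'g \<Rightarrow> 'g \<Rightarrow> bool" where
  "cong_mod k x y \<longleftrightarrow> x \<in> carrier G \<and> y \<in> carrier G \<and> x \<otimes> inv y \<in> U k"

lemma cong_refl: "x \<in> carrier G \<Longrightarrow> cong_mod k x x"
  by (simp add: cong_mod_def)

lemma cong_sym: "cong_mod k x y \<Longrightarrow> cong_mod k y x"
proof -
  assume *: "cong_mod k x y"
  then have "y \<otimes> inv x = inv (x \<otimes> inv y)" by (simp add: cong_mod_def inv_mult_group)
  then show ?thesis using * by (auto simp: cong_mod_def intro: U_inv)
qed

lemma cong_trans: "cong_mod k x y \<Longrightarrow> cong_mod k y z \<Longrightarrow> cong_mod k x z"
proof -
  assume *: "cong_mod k x y" "cong_mod k y z"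
  then have "x \<otimes> inv z = (x \<otimes> inv y) \<otimes> (y \<otimes> inv z)"
    by (simp add: cong_mod_def m_assoc) (simp flip: m_assoc)
  then show ?thesis using * by (auto simp: cong_mod_def intro: U_mult)
qed

lemma cong_mult: "cong_mod k x y \<Longrightarrow> cong_mod k x' y' \<Longrightarrow> cong_mod k (x \<otimes> x') (y \<otimes> y')"
proof -
  assume *: "cong_mod k x y" "cong_mod k x' y'"
  then have "x \<otimes> x' \<otimes> inv (y \<otimes> y') = (x \<otimes> inv y) \<otimes> (x' \<otimes> inv y')"
    by (simp add: cong_mod_def inv_mult m_ac)
  then show ?thesis using * by (auto simp: cong_mod_def intro: U_mult)
qed

lemma cong_inv: "cong_mod k x y \<Longrightarrow> cong_mod k (inv x) (inv y)"
proof -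
  assume *: "cong_mod k x y"
  then have "inv x \<otimes> inv (inv y) = inv (x \<otimes> inv y)"
    by (simp add: cong_mod_def inv_mult)
  then show ?thesis using * by (auto simp: cong_mod_def intro: U_inv)
qed

lemma cong_nat_pow: "cong_mod k x y \<Longrightarrow> cong_mod k (x [^] (n::nat)) (y [^] n)"
  by (induction n) (simp_all add: cong_mult cong_refl)

lemma cong_int_pow: "cong_mod k x y \<Longrightarrow> cong_mod k (x [^] (n::int)) (y [^] n)"
  using cong_nat_pow[of k x y] cong_inv[of k] unfolding int_pow_def2 by presburger

lemma cong_mono: "cong_mod k x y \<Longrightarrow> k' \<le> k \<Longrightarrow> cong_mod k' x y"
  using U_antimono by (auto simp: cong_mod_def)

lemma cong_one_iff: "cong_mod k x \<one> \<longleftrightarrow> x \<in> U k"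
  using U_carrier[of x k] by (auto simp: cong_mod_def)

lemma cong_mem_iff: "cong_mod m x y \<Longrightarrow> k \<le> m \<Longrightarrow> x \<in> U k \<longleftrightarrow> y \<in> U k"
  using cong_mono[of m x y k] cong_mono[OF cong_sym, of m x y k] cong_trans[of k y x \<one>] cong_trans[of k x y \<one>]
  by (auto simp: cong_one_iff)

lemma cong_finprod:
  "(\<And>i. i \<in> A \<Longrightarrow> cong_mod k (f i) (g i)) \<Longrightarrow> cong_mod k (finprod G f A) (finprod G g A)"
proof (induction A rule: infinite_finite_induct)
  case (insert i A)
  have c: "cong_mod k (f j) (g j)" if "j \<in> insert i A" for j
    using insert.prems[OF that] .
  have "cong_mod k (finprod G f A) (finprod G g A)" using insert.IH c by simp
  then have "cong_mod k (f i \<otimes> finprod G f A) (g i \<otimes> finprod G g A)"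
    using c by (intro cong_mult) auto
  moreover have "f j \<in> carrier G" "g j \<in> carrier G" if "j \<in> insert i A" for j
    using c[OF that] by (simp_all add: cong_mod_def)
  ultimately show ?case using insert.hyps by (simp add: Pi_iff)
qed (auto intro: cong_refl)

section \<open>Iterated p-th powers along a chain\<close>

lemma U_pow_Suc: "1 \<le> i \<Longrightarrow> x \<in> U i \<Longrightarrow> x [^] p \<in> U (Suc i)"
  using U_pow[of i x] rho_gt[of i] U_antimono[of "Suc i" "\<rho> i"] by auto

lemma U_pow_pow: "1 \<le> i \<Longrightarrow> x \<in> U i \<Longrightarrow> x [^] (p ^ l) \<in> U ((\<rho> ^^ l) i)"
proof (induction l)
  case (Suc l)
  then have "(x [^] (p ^ l)) [^] p \<in> U (\<rho> ((\<rho> ^^ l) i))"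
    using U_pow[OF rho_pow_pos] by blast
  then show ?case using U_carrier[OF Suc.prems(2)] by (simp add: nat_pow_pow mult.commute)
qed (simp add: U_carrier)

lemma U_pow_pow_exact:
  "\<lbrakk>1 \<le> i; x \<in> U i - U (Suc i); unramified_path l i\<rbrakk> \<Longrightarrow> x [^] (p ^ l) \<notin> U (Suc ((\<rho> ^^ l) i))"
proof (induction l)
  case (Suc l)
  have path: "unramified_path l i" "(\<rho> ^^ l) i \<noteq> a"
    using Suc.prems(3) by (simp_all add: unramified_path_def)
  have "x [^] (p ^ l) \<in> U ((\<rho> ^^ l) i)" using U_pow_pow Suc.prems by blast
  then have "x [^] (p ^ l) \<in> U ((\<rho> ^^ l) i) - U (Suc ((\<rho> ^^ l) i))"
    using Suc.IH[OF Suc.prems(1,2) path(1)] by blast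
  then have "(x [^] (p ^ l)) [^] p \<notin> U (Suc (\<rho> ((\<rho> ^^ l) i)))"
    by (rule U_pow_exact[OF rho_pow_pos[OF Suc.prems(1)] path(2)])
  moreover have "x \<in> carrier G" using Suc.prems(2) U_carrier by blast
  ultimately show ?case by (simp add: nat_pow_pow mult.commute)
next
  case 0
  then have "x \<in> carrier G" using U_carrier by blast
  then show ?case using 0 by simp
qed

text \<open>The step out of \<open>a\<close>, which is step number \<open>s\<close> + 1, gains at
  least one level over \<open>\<rho>\<close>; strict monotonicity of \<open>\<rho>\<close> preserves
  the gain in all later steps.\<close>

lemma U_pow_pow_t: "x \<in> U t \<Longrightarrow> s < l \<Longrightarrow> x [^] (p ^ l) \<in> U (Suc ((\<rho> ^^ l) t))"
proof (induction l)
  case (Suc l)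
  have t: "1 \<le> t" using T_pos by simp
  have eq: "x [^] (p ^ Suc l) = (x [^] (p ^ l)) [^] p"
    using U_carrier[OF Suc.prems(1)] by (simp add: nat_pow_pow mult.commute)
  show ?case
  proof (cases "l = s")
    case True
    have "x [^] (p ^ l) \<in> U a" using U_pow_pow[OF t Suc.prems(1), of s] True rho_s_t by simp
    then have "x [^] (p ^ Suc l) \<in> U (Suc (\<rho> a))" unfolding eq by (rule U_pow_a)
    then show ?thesis using True rho_s_t by simp
  next
    case False
    then have "x [^] (p ^ l) \<in> U (Suc ((\<rho> ^^ l) t))" using Suc by simp
    then have "x [^] (p ^ Suc l) \<in> U (\<rho> (Suc ((\<rho> ^^ l) t)))"
      unfolding eq by (intro U_pow) simp_all
    moreover have "Suc ((\<rho> ^^ Suc l) t) \<le> \<rho> (Suc ((\<rho> ^^ l) t))"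
      using strict_monoD[OF rho_strict_mono, of "(\<rho> ^^ l) t" "Suc ((\<rho> ^^ l) t)"] by simp
    ultimately show ?thesis using U_antimono by blast
  qed
qed simp

text \<open>Otherwise a Bezout combination writes x as a product of powers of x^p and x^n, both of
  which lie one level deeper.\<close>

lemma p_dvd_exponent:
  assumes "1 \<le> k" "x \<in> U k - U (Suc k)" "x [^] (n::int) \<in> U (Suc k)"
  shows "int p dvd n"
proof (rule ccontr)
  assume "\<not> int p dvd n"
  then have "coprime (int p) n" using prime_p by (simp add: prime_imp_coprime)
  then obtain u v where uv: "u * int p + v * n = 1" using bezout_int[of "int p" n] by auto
  have x: "x \<in> carrier G" using assms U_carrier by blast
  have "x [^] int p \<in> U (Suc k)" using U_pow_Suc assms by (simp add: int_pow_int)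
  then have "(x [^] int p) [^] u \<otimes> (x [^] n) [^] v \<in> U (Suc k)"
    using assms U_int_pow U_mult by blast
  moreover have "(x [^] int p) [^] u \<otimes> (x [^] n) [^] v = x"
    using x uv by (simp add: int_pow_pow mult.commute flip: int_pow_mult)
  ultimately show False using assms by simp
qed

section \<open>Products of powers of the generators\<close>

definition E :: "(nat \<Rightarrow> 'g) \<Rightarrow> (nat \<Rightarrow> int) \<Rightarrow> 'g" where
  "E \<eta> c = (\<Otimes>i\<in>T. \<eta> i [^] c i)"

text \<open>Exponents for which every single factor lies in \<open>U k\<close> by itself. A product
  can lie in \<open>U k\<close> for other exponents too, since factors from different chains can
  cancel.\<close>

definition W :: "nat \<Rightarrow> (nat \<Rightarrow> int) set" where
  "W k = {c. \<forall>j\<in>T. int p ^ L j k dvd c j}"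

definition generators :: "(nat \<Rightarrow> 'g) \<Rightarrow> bool" where
  "generators \<eta> \<longleftrightarrow> (\<forall>i\<in>T. \<eta> i \<in> U i - U (Suc i))"

lemma generators_exist: "\<exists>\<eta>. generators \<eta>"
  unfolding generators_def using U_strict T_pos by (intro bchoice) blast

lemma E_closed [simp]: "(\<And>i. i \<in> T \<Longrightarrow> \<eta> i \<in> carrier G) \<Longrightarrow> E \<eta> c \<in> carrier G"
  unfolding E_def by (intro finprod_closed) auto

lemma generators_carrier: "generators \<eta> \<Longrightarrow> i \<in> T \<Longrightarrow> \<eta> i \<in> carrier G"
  using U_carrier by (auto simp: generators_def)

lemma E_cong: "(\<And>i. i \<in> T \<Longrightarrow> \<eta> i \<in> carrier G) \<Longrightarrow> (\<And>i. i \<in> T \<Longrightarrow> c i = d i) \<Longrightarrow> E \<eta> c = E \<eta> d"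
  unfolding E_def by (intro finprod_cong') auto

lemma E_add: "(\<And>i. i \<in> T \<Longrightarrow> \<eta> i \<in> carrier G) \<Longrightarrow> E \<eta> (\<lambda>i. c i + d i) = E \<eta> c \<otimes> E \<eta> d"
proof -
  assume \<eta>: "\<And>i. i \<in> T \<Longrightarrow> \<eta> i \<in> carrier G"
  then have "E \<eta> (\<lambda>i. c i + d i) = (\<Otimes>i\<in>T. \<eta> i [^] c i \<otimes> \<eta> i [^] d i)"
    unfolding E_def by (intro finprod_cong') (auto simp: int_pow_mult)
  also have "\<dots> = E \<eta> c \<otimes> E \<eta> d"
    unfolding E_def using \<eta> by (intro finprod_multf) auto
  finally show ?thesis .
qed

lemma E_uminus: "(\<And>i. i \<in> T \<Longrightarrow> \<eta> i \<in> carrier G) \<Longrightarrow> E \<eta> (\<lambda>i. - c i) = inv (E \<eta> c)"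
proof -
  assume \<eta>: "\<And>i. i \<in> T \<Longrightarrow> \<eta> i \<in> carrier G"
  have "E \<eta> (\<lambda>i. - c i) \<otimes> E \<eta> c = E \<eta> (\<lambda>i. - c i + c i)" by (rule E_add[symmetric]) (rule \<eta>)
  also have "\<dots> = \<one>" by (simp add: E_def)
  finally show ?thesis using \<eta> by (intro inv_equality[symmetric]) simp_all
qed

lemma E_diff: "(\<And>i. i \<in> T \<Longrightarrow> \<eta> i \<in> carrier G) \<Longrightarrow> E \<eta> (\<lambda>i. c i - d i) = E \<eta> c \<otimes> inv (E \<eta> d)"
  using E_add[of \<eta> c "\<lambda>i. - d i"] E_uminus[of \<eta> d] by simp

lemma E_single: "j \<in> T \<Longrightarrow> (\<And>i. i \<in> T \<Longrightarrow> \<eta> i \<in> carrier G) \<Longrightarrow> E \<eta> (\<lambda>i. if i = j then n else 0) = \<eta> j [^] n"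
proof -
  assume j: "j \<in> T" and \<eta>: "\<And>i. i \<in> T \<Longrightarrow> \<eta> i \<in> carrier G"
  have "E \<eta> (\<lambda>i. if i = j then n else 0) = (\<Otimes>i\<in>T. if i = j then \<eta> i [^] n else \<one>)"
    unfolding E_def using \<eta> by (intro finprod_cong') auto
  also have "\<dots> = \<eta> j [^] n" using j \<eta> by (intro finprod_singleton_swap) auto
  finally show ?thesis .
qed

lemma E_remove: "j \<in> T \<Longrightarrow> (\<And>i. i \<in> T \<Longrightarrow> \<eta> i \<in> carrier G) \<Longrightarrow>
    E \<eta> c = \<eta> j [^] c j \<otimes> (\<Otimes>i\<in>T - {j}. \<eta> i [^] c i)"
  unfolding E_def
  using finprod_insert[of "T - {j}" j "\<lambda>i. \<eta> i [^] c i"] by (auto simp: insert_absorb Pi_iff)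

lemma finprod_int_pow:
  "(\<And>i. i \<in> A \<Longrightarrow> f i \<in> carrier G) \<Longrightarrow> (\<Otimes>i\<in>A. f i) [^] (n::int) = (\<Otimes>i\<in>A. f i [^] n)"
proof (induction A rule: infinite_finite_induct)
  case (insert x F)
  then have "f \<in> insert x F \<rightarrow> carrier G" by auto
  then show ?case using insert by (simp add: int_pow_distrib Pi_iff)
qed auto

lemma E_scale: "(\<And>i. i \<in> T \<Longrightarrow> \<eta> i \<in> carrier G) \<Longrightarrow> E \<eta> (\<lambda>i. n * c i) = E \<eta> c [^] n"
proof -
  assume \<eta>: "\<And>i. i \<in> T \<Longrightarrow> \<eta> i \<in> carrier G"
  then have "E \<eta> (\<lambda>i. n * c i) = (\<Otimes>i\<in>T. (\<eta> i [^] c i) [^] n)"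
    unfolding E_def by (intro finprod_cong') (auto simp: int_pow_pow mult.commute)
  also have "\<dots> = E \<eta> c [^] n"
    unfolding E_def using \<eta> by (intro finprod_int_pow[symmetric]) auto
  finally show ?thesis .
qed

text \<open>A change of generators acts on exponent vectors as a matrix. This serves both to build
  adapted generators and to rewrite a fixed family in terms of them.\<close>

lemma E_E:
  assumes "\<And>i. i \<in> T \<Longrightarrow> \<eta> i \<in> carrier G"
  shows "E (\<lambda>i. E \<eta> (M i)) c = E \<eta> (\<lambda>j. \<Sum>i\<in>T. c i * M i j)"
proof -
  have "finite A \<Longrightarrow> (\<Otimes>i\<in>A. E \<eta> (M i) [^] c i) = E \<eta> (\<lambda>j. \<Sum>i\<in>A. c i * M i j)" for A
  proof (induction A rule: finite_induct)
    case empty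
    then show ?case by (simp add: E_def)
  next
    case (insert x F)
    then show ?case using assms by (simp add: Pi_iff E_add E_scale)
  qed
  then show ?thesis by (simp add: E_def[of "\<lambda>i. E \<eta> (M i)"])
qed

lemma cong_E: "(\<And>i. i \<in> T \<Longrightarrow> cong_mod k (\<eta> i) (\<eta>' i)) \<Longrightarrow> cong_mod k (E \<eta> c) (E \<eta>' c)"
  unfolding E_def by (intro cong_finprod cong_int_pow)

lemma generator_pow_mem:
  assumes "generators \<eta>" "j \<in> T" "int p ^ L j k dvd c"
  shows "\<eta> j [^] c \<in> U k"
proof -
  obtain d where d: "c = int p ^ L j k * d" using assms(3) by blast
  have j: "1 \<le> j" "\<eta> j \<in> U j" "\<eta> j \<in> carrier G"
    using assms T_pos generators_carrier by (auto simp: generators_def)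
  have "\<eta> j [^] (p ^ L j k) \<in> U ((\<rho> ^^ L j k) j)" using U_pow_pow j by blast
  then have "\<eta> j [^] (int p ^ L j k) \<in> U k"
    using L_le_iff[OF j(1), of k "L j k"] U_antimono by (auto simp flip: int_pow_int)
  then have "(\<eta> j [^] (int p ^ L j k)) [^] d \<in> U k" by (rule U_int_pow)
  then show ?thesis using d j by (simp add: int_pow_pow)
qed

lemma E_mem: "generators \<eta> \<Longrightarrow> c \<in> W k \<Longrightarrow> E \<eta> c \<in> U k"
  unfolding E_def W_def by (intro U_finprod generator_pow_mem) auto

lemma W_antimono: "k \<le> k' \<Longrightarrow> W k' \<subseteq> W k"
  unfolding W_def by (blast intro: dvd_trans[OF le_imp_power_dvd[OF L_mono[OF T_pos]]])

lemma W_add: "c \<in> W k \<Longrightarrow> d \<in> W k \<Longrightarrow> (\<lambda>i. c i + d i) \<in> W k"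
  by (auto simp: W_def)

text \<open>Successive approximation, with the induction running from \<open>m\<close> down to k: an
  unramified chain from \<open>T\<close> ends at k, the p^l-th power of its generator has exact
  level k, and a power of that corrects the element into \<open>U (Suc k)\<close>.\<close>

lemma E_surj:
  assumes "generators \<eta>" "1 \<le> k" "k \<le> m" "x \<in> U k"
  shows "\<exists>c\<in>W k. cong_mod m x (E \<eta> c)"
  using assms(3,2,4)
proof (induction k arbitrary: x rule: inc_induct)
  case base
  then have "cong_mod m x (E \<eta> (\<lambda>_. 0))" by (simp add: E_def cong_one_iff)
  then show ?case by (intro bexI[of _ "\<lambda>_. 0"]) (auto simp: W_def)
next
  case (step k)
  note \<eta> = generators_carrier[OF assms(1)]
  obtain i l where il: "i \<in> T" "(\<rho> ^^ l) i = k" "unramified_path l i"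
    using path_exists step.prems by blast
  have i: "1 \<le> i" "\<eta> i \<in> U i - U (Suc i)" using il T_pos assms(1) by (auto simp: generators_def)
  have "\<eta> i [^] (p ^ l) \<in> U k - U (Suc k)"
    using U_pow_pow[OF i(1)] U_pow_pow_exact[OF i] i il by auto
  then obtain n :: int where n: "x \<otimes> inv ((\<eta> i [^] (p ^ l)) [^] n) \<in> U (Suc k)"
    using U_cyclic step.prems by blast
  then obtain c where c: "c \<in> W (Suc k)" "cong_mod m (x \<otimes> inv ((\<eta> i [^] (p ^ l)) [^] n)) (E \<eta> c)"
    using step.IH by auto
  \<comment> \<open>The correction as an exponent vector; it lies in \<open>W k\<close> because l =
    \<open>L i k\<close>.\<close>
  define d where "d = (\<lambda>j. if j = i then int (p ^ l) * n else 0)"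
  have Ed: "E \<eta> d = (\<eta> i [^] (p ^ l)) [^] n"
    using E_single[OF il(1) \<eta>, where n="int (p ^ l) * n"] il \<eta>
    by (simp add: d_def int_pow_pow flip: int_pow_int)
  have "cong_mod m (x \<otimes> inv (E \<eta> d) \<otimes> E \<eta> d) (E \<eta> c \<otimes> E \<eta> d)"
    using c(2) \<eta> unfolding Ed[symmetric] by (intro cong_mult cong_refl E_closed)
  then have "cong_mod m x (E \<eta> (\<lambda>j. c j + d j))"
    using \<eta> step.prems U_carrier by (simp add: E_add m_assoc)
  moreover have "d \<in> W k" using i il by (auto simp: W_def d_def)
  then have "(\<lambda>j. c j + d j) \<in> W k" using c(1) W_antimono[of k "Suc k"] by (auto intro: W_add)
  ultimately show ?case by blast
qed

text \<open>Modulo \<open>U (Suc k)\<close> all factors off the unramified chain through k vanish,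
  so the factor of that chain vanishes too and its exponent gains a factor p. The only exponent that
  can miss its new divisibility is the one at \<open>t\<close>, when the chain of \<open>t\<close>
  meets k after having passed \<open>a\<close>; a multiple of v repairs it.\<close>

lemma E_relation_step:
  assumes \<eta>: "generators \<eta>" and k: "1 \<le> k" "k < m" and c: "c \<in> W k" and Ec: "E \<eta> c \<in> U m"
    and v: "\<not> int p dvd u" "v t = int p ^ Suc s * u" "\<And>j. j \<in> T \<Longrightarrow> j \<noteq> t \<Longrightarrow> int p ^ L j (Suc (p * a)) dvd v j"
  shows "\<exists>z::int. (\<lambda>j. c j - z * v j) \<in> W (Suc k)"
proof -
  note car = generators_carrier[OF \<eta>]
  obtain i l where il: "i \<in> T" "(\<rho> ^^ l) i = k" "unramified_path l i"
    using path_exists k by blast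
  have i: "1 \<le> i" "\<eta> i \<in> U i - U (Suc i)" using il T_pos \<eta> by (auto simp: generators_def)
  have ci: "int p ^ L j (Suc k) dvd c j" if "j \<in> T" "(\<rho> ^^ L j k) j \<noteq> k" for j
    using that c L_Suc[OF T_pos[OF that(1)], of k] by (auto simp: W_def)
  have ram: "j = t \<and> s < L j k" if "j \<in> T" "(\<rho> ^^ L j k) j = k" "j \<noteq> i" for j
    using that il path_unique[of j i "L j k" l] ramified_path[of j "L j k"] by blast
  \<comment> \<open>Either the chain of j skips k, so that membership in \<open>W k\<close> already
    gives the next level, or j = \<open>t\<close> beyond \<open>a\<close>, where the powers drop
    deeper than the chain.\<close>
  have other: "\<eta> j [^] c j \<in> U (Suc k)" if "j \<in> T" "j \<noteq> i" for j
  proof (cases "(\<rho> ^^ L j k) j = k")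
    case False
    then show ?thesis using generator_pow_mem[OF \<eta>] ci that by blast
  next
    case True
    then have j: "j = t" "s < L j k" using ram that by auto
    have "int p ^ L j k dvd c j" using c \<open>j \<in> T\<close> by (simp add: W_def)
    then obtain d where d: "c j = int p ^ L j k * d" by blast
    have "\<eta> j [^] (p ^ L j k) \<in> U (Suc ((\<rho> ^^ L j k) t))"
      using \<eta> j U_pow_pow_t[of "\<eta> t" "L t k"] by (auto simp: generators_def)
    then have "(\<eta> j [^] (p ^ L j k)) [^] d \<in> U (Suc k)" using True j by (auto intro: U_int_pow)
    then show ?thesis using d car that(1) by (simp add: int_pow_pow flip: int_pow_int)
  qed
  have "E \<eta> c \<in> U (Suc k)" using Ec k U_antimono[of "Suc k" m] by auto
  then have "\<eta> i [^] c i \<otimes> (\<Otimes>j\<in>T - {i}. \<eta> j [^] c j) \<in> U (Suc k)"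
    using E_remove[OF il(1) car] by simp
  moreover have "(\<Otimes>j\<in>T - {i}. \<eta> j [^] c j) \<in> U (Suc k)" using other by (intro U_finprod) auto
  ultimately have ci_mem: "\<eta> i [^] c i \<in> U (Suc k)"
    using car il by (metis U_mult_left_iff U_carrier int_pow_closed m_comm)
  have Lik: "L i k = l" using il i by auto
  have "int p ^ l dvd c i" using c il(1) Lik by (auto simp: W_def)
  then obtain d where d: "c i = int p ^ l * d" by blast
  have "(\<eta> i [^] (p ^ l)) [^] d \<in> U (Suc k)"
    using ci_mem d car il by (simp add: int_pow_pow flip: int_pow_int)
  moreover have "\<eta> i [^] (p ^ l) \<in> U k - U (Suc k)"
    using U_pow_pow[OF i(1)] U_pow_pow_exact[OF i] i il by auto
  ultimately have "int p dvd d" using p_dvd_exponent k by blast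
  then have "int p ^ Suc l dvd c i" using d by (auto simp: mult.commute intro: mult_dvd_mono)
  then have i_ok: "int p ^ L i (Suc k) dvd c i" using L_Suc[OF i(1), of k] Lik il by simp
  show ?thesis
  proof (cases "(\<rho> ^^ L t k) t = k \<and> t \<noteq> i")
    case False
    then have "c \<in> W (Suc k)"
      using ci ram i_ok unfolding W_def by blast
    then show ?thesis by (intro exI[of _ 0]) auto
  next
    case True
    define l' where "l' = L t k"
    have t: "1 \<le> t" using T_pos by simp
    have l': "s < l'" "(\<rho> ^^ l') t = k" using True ram[of t] by (auto simp: l'_def)
    have "int p ^ l' dvd c t" using c t_in_T unfolding W_def l'_def by blast
    then obtain x where x: "c t = int p ^ l' * x" by blast
    \<comment> \<open>f inverts u modulo p, so that z * v t agrees with c t modulo p^(l' +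
      1).\<close>
    have "coprime (int p) u" using prime_p v(1) by (simp add: prime_imp_coprime)
    then obtain e f where ef: "e * int p + f * u = 1" using bezout_int[of "int p" u] by auto
    have "x - x * f * u = x * (1 - f * u)" by (simp add: algebra_simps)
    also have "1 - f * u = e * int p" using ef by simp
    finally have "int p dvd x - x * f * u" by simp
    define z where "z = int p ^ (l' - Suc s) * (x * f)"
    have "int p ^ (l' - Suc s) * int p ^ Suc s = int p ^ l'"
      using l' by (metis Suc_leI le_add_diff_inverse2 power_add)
    then have "z * v t = int p ^ l' * (x * f * u)"
      using v(2) unfolding z_def by (metis (no_types, lifting) mult.assoc mult.commute)
    then have "c t - z * v t = int p ^ l' * (x - x * f * u)"
      using x by (simp add: algebra_simps)
    then have "int p ^ Suc l' dvd c t - z * v t"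
      using \<open>int p dvd x - x * f * u\<close> by (simp add: mult.commute mult_dvd_mono)
    then have t_ok: "int p ^ L t (Suc k) dvd c t - z * v t"
      using L_Suc[OF t, of k] True by (simp add: l'_def)
    \<comment> \<open>Away from \<open>t\<close> the entries of v belong to levels beyond p * a. The
      factor p^(l' - Suc s) in z shifts p * a to k, hence these levels to levels beyond k.\<close>
    have other_ok: "int p ^ L j (Suc k) dvd z * v j" if j: "j \<in> T" "j \<noteq> t" for j
    proof -
      have j1: "1 \<le> j" using j T_pos by blast
      have "Suc (p * a) \<le> (\<rho> ^^ L j (Suc (p * a))) j" using L_le_iff[OF j1] by blast
      then have "(\<rho> ^^ Suc s) t < (\<rho> ^^ L j (Suc (p * a))) j" using rho_Suc_s_t by linarith
      then have "(\<rho> ^^ (l' - Suc s)) ((\<rho> ^^ Suc s) t) < (\<rho> ^^ (l' - Suc s)) ((\<rho> ^^ L j (Suc (p * a))) j)"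
        by (simp only: rho_pow_less_iff)
      then have "(\<rho> ^^ l') t < (\<rho> ^^ (l' - Suc s + L j (Suc (p * a)))) j"
        using l'(1) by (simp only: rho_pow_add[symmetric]) simp
      then have "L j (Suc k) \<le> l' - Suc s + L j (Suc (p * a))"
        using L_le_iff[OF j1] l'(2) by simp
      moreover have "int p ^ (l' - Suc s + L j (Suc (p * a))) dvd z * v j"
        unfolding z_def power_add using v(3)[OF j] by (simp add: mult.assoc mult_dvd_mono)
      ultimately show ?thesis using dvd_trans[OF le_imp_power_dvd] by blast
    qed
    have "int p ^ L j (Suc k) dvd c j - z * v j" if j: "j \<in> T" for j
    proof (cases "j = t")
      case False
      have "int p ^ L j (Suc k) dvd c j" using ci[OF j] ram[OF j] False i_ok by blast
      then show ?thesis using other_ok[OF j False] by simp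
    qed (use t_ok in simp)
    then show ?thesis by (auto simp: W_def)
  qed
qed

text \<open>The only relation between the generators comes from the drop of the \<open>p\<close>-th powers at level \<open>a\<close>.\<close>

lemma E_relation:
  assumes \<eta>: "generators \<eta>" and m: "1 \<le> m" and Ev: "E \<eta> v \<in> U m" and Ec: "E \<eta> c \<in> U m"
    and v: "\<not> int p dvd u" "v t = int p ^ Suc s * u" "\<And>j. j \<in> T \<Longrightarrow> j \<noteq> t \<Longrightarrow> int p ^ L j (Suc (p * a)) dvd v j"
  shows "\<exists>z::int. (\<lambda>j. c j - z * v j) \<in> W m"
proof -
  note car = generators_carrier[OF \<eta>]
  have "\<exists>z::int. (\<lambda>j. c j - z * v j) \<in> W k" if "1 \<le> k" "k \<le> m" for k
    using that
  proof (induction k rule: dec_induct)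
    case base
    then show ?case by (intro exI[of _ 0]) (simp add: W_def L_1[OF T_pos])
  next
    case (step k)
    then obtain z where z: "(\<lambda>j. c j - z * v j) \<in> W k" by auto
    have "E \<eta> (\<lambda>j. c j - z * v j) = E \<eta> c \<otimes> inv (E \<eta> v [^] z)"
      using car by (simp add: E_diff E_scale)
    then have Ez: "E \<eta> (\<lambda>j. c j - z * v j) \<in> U m"
      using Ev Ec by (auto intro: U_mult U_inv U_int_pow)
    have "k < m" using step by simp
    then obtain z' where "(\<lambda>j. c j - z * v j - z' * v j) \<in> W (Suc k)"
      using E_relation_step[OF \<eta> step.hyps(1) \<open>k < m\<close> z Ez v] by auto
    then have "(\<lambda>j. c j - (z + z') * v j) \<in> W (Suc k)" by (simp add: algebra_simps)
    then show ?case by blast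
  qed
  then show ?thesis using m by blast
qed

text \<open>The p-adic order and the unit part of each exponent are kept apart in b and u. The order
  at \<open>t\<close> is \<open>Suc s\<close> because the power p^(s + 1) of \<open>\<eta> t\<close>
  is the first to drop off its chain; every other term lies beyond p * a.\<close>

definition relation :: "(nat \<Rightarrow> 'g) \<Rightarrow> nat \<Rightarrow> (nat \<Rightarrow> nat) \<Rightarrow> (nat \<Rightarrow> int) \<Rightarrow> bool" where
  "relation \<eta> m b u \<longleftrightarrow> (\<forall>j\<in>T. \<not> int p dvd u j) \<and> b t = Suc s \<and>
     (\<forall>j\<in>T - {t}. p * a < (\<rho> ^^ b j) j) \<and> E \<eta> (\<lambda>j. int p ^ b j * u j) \<in> U m"

text \<open>The power p^(s + 1) of \<open>\<eta> t\<close> lies beyond p * a, so by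
  \<open>E_surj\<close> it is also a product of terms beyond p * a; the quotient of the two
  expressions is the relation.\<close>

lemma relation_exists:
  assumes \<eta>: "generators \<eta>" and m: "p * a < m"
  shows "\<exists>b u. relation \<eta> m b u"
proof -
  note car = generators_carrier[OF \<eta>]
  have "\<eta> t [^] (p ^ Suc s) \<in> U (Suc (p * a))"
    using U_pow_pow_t[of "\<eta> t" "Suc s"] \<eta> rho_Suc_s_t by (simp add: generators_def)
  then obtain c where c: "c \<in> W (Suc (p * a))" "cong_mod m (\<eta> t [^] (p ^ Suc s)) (E \<eta> c)"
    using E_surj[OF \<eta>, of "Suc (p * a)" m] m by auto
  define d where "d = (\<lambda>j. if j = t then int p ^ Suc s else 0)"
  have d: "E \<eta> d = \<eta> t [^] (p ^ Suc s)"
    using E_single[OF t_in_T car, where n="int p ^ Suc s"] by (simp add: d_def flip: int_pow_int)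
  \<comment> \<open>Zero exponents are replaced by \<open>p ^ m\<close>, which does not matter at level \<open>m\<close>.\<close>
  define v where "v = (\<lambda>j. if d j - c j = 0 then int p ^ m else d j - c j)"
  \<comment> \<open>\<open>L t (Suc (p * a))\<close> is \<open>s\<close> + 2, so subtracting c t
    changes the exponent p^(s + 1) at \<open>t\<close> only by a factor prime to p.\<close>
  have "int p ^ L t (Suc (p * a)) dvd c t" using c by (auto simp: W_def)
  then obtain y where y: "c t = int p ^ Suc s * (int p * y)"
    unfolding L_t_Suc_pa by (auto simp: dvd_def algebra_simps)
  have p1: "\<not> int p dvd 1" using p_ge_2 by auto
  have ut: "\<not> int p dvd 1 - int p * y"
  proof
    assume "int p dvd 1 - int p * y"
    then have "int p dvd (1 - int p * y) + int p * y" by (intro dvd_add) auto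
    then show False using p1 by simp
  qed
  have dt: "d t - c t = int p ^ Suc s * (1 - int p * y)" using y by (simp add: d_def algebra_simps)
  have v_nz: "v j \<noteq> 0" for j using p_ge_2 by (auto simp: v_def)
  define b where "b = (\<lambda>j. multiplicity (int p) (v j))"
  define u where "u = (\<lambda>j. v j div int p ^ b j)"
  have vbu: "v j = int p ^ b j * u j" for j
    by (simp add: b_def u_def multiplicity_dvd)
  have notunit: "\<not> is_unit (int p)" using p1 by simp
  have u: "\<not> int p dvd u j" for j
    unfolding u_def b_def using multiplicity_decompose[OF v_nz[of j] notunit] by simp
  have "1 - int p * y \<noteq> 0" using ut by auto
  then have "d t - c t \<noteq> 0" using dt p_ge_2 by simp
  then have vt: "v t = int p ^ Suc s * (1 - int p * y)" unfolding dt[symmetric] by (simp add: v_def)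
  have bt: "b t = Suc s"
    unfolding b_def vt using ut prime_p notunit by (intro multiplicity_eqI) (auto simp del: power_Suc)
  have bj: "p * a < (\<rho> ^^ b j) j" if j: "j \<in> T" "j \<noteq> t" for j
  proof -
    have j1: "1 \<le> j" using j T_pos by blast
    have "int p ^ L j (Suc (p * a)) dvd v j"
      using c j m L_le_self[OF j1, of "Suc (p * a)"]
      by (auto simp: v_def d_def W_def intro!: le_imp_power_dvd)
    then have "L j (Suc (p * a)) \<le> b j"
      unfolding b_def using v_nz notunit by (intro multiplicity_geI) auto
    then show ?thesis using L_le_iff[OF j1] by (simp add: Suc_le_eq)
  qed
  have vW: "(\<lambda>j. v j - (d j - c j)) \<in> W m"
    using L_le_self T_pos by (auto simp: W_def v_def intro!: le_imp_power_dvd)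
  have "E \<eta> (\<lambda>j. d j - c j) \<in> U m"
    using c(2) d car by (simp add: E_diff cong_mod_def)
  moreover have "E \<eta> (\<lambda>j. v j - (d j - c j)) \<in> U m" using E_mem[OF \<eta> vW] .
  ultimately have "E \<eta> (\<lambda>j. v j - (d j - c j)) \<otimes> E \<eta> (\<lambda>j. d j - c j) \<in> U m" by (intro U_mult)
  then have "E \<eta> v \<in> U m" using car by (simp flip: E_add)
  moreover have "v = (\<lambda>j. int p ^ b j * u j)" using vbu by auto
  ultimately show ?thesis using u bt bj unfolding relation_def by blast
qed

text \<open>Hence, for positive m, the exponent vectors that are trivial modulo \<open>U m\<close>
  are precisely those of \<open>W m\<close> plus integer multiples of the relation.\<close>

lemma relation_E:
  assumes \<eta>: "generators \<eta>" and m: "1 \<le> m" and r: "relation \<eta> m b u" and Ec: "E \<eta> c \<in> U m"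
  shows "\<exists>z::int. (\<lambda>j. c j - z * (int p ^ b j * u j)) \<in> W m"
proof (rule E_relation[OF \<eta> m _ Ec])
  show "\<not> int p dvd u t" "E \<eta> (\<lambda>j. int p ^ b j * u j) \<in> U m"
    and "int p ^ b t * u t = int p ^ Suc s * u t"
    using r by (auto simp: relation_def)
  fix j assume j: "j \<in> T" "j \<noteq> t"
  then have "p * a < (\<rho> ^^ b j) j" using r by (auto simp: relation_def)
  then have "L j (Suc (p * a)) \<le> b j" using L_le_iff T_pos j by (simp add: Suc_le_eq)
  then show "int p ^ L j (Suc (p * a)) dvd int p ^ b j * u j"
    by (intro dvd_mult2 le_imp_power_dvd)
qed

end

section \<open>Characters and their jump sets\<close>

text \<open>An axiomatic Qp/Zp: \<open>g k\<close> has order exactly p^k and generates the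
  p^k-torsion. A finite p-subgroup is therefore determined by its order, which makes images of
  characters readable from their jumps.\<close>

locale prufer_group = comm_group P for P :: "('x, 'n) monoid_scheme" (structure) and p :: nat +
  fixes g :: "nat \<Rightarrow> 'x"
  assumes prime: "Factorial_Ring.prime p"
    and g_closed [simp]: "g k \<in> carrier P"
    and g_pow_eq_one_iff: "g k [^] (n::int) = \<one> \<longleftrightarrow> int p ^ k dvd n"
    and g_generates: "\<lbrakk>x \<in> carrier P; x [^] (p ^ k) = \<one>\<rbrakk> \<Longrightarrow> \<exists>n::int. x = g k [^] n"
begin

lemma g_pow_eq_iff: "g k [^] (n::int) = g k [^] (n'::int) \<longleftrightarrow> int p ^ k dvd n - n'"
proof -
  have "g k [^] n = g k [^] n' \<longleftrightarrow> g k [^] n \<otimes> inv (g k [^] n') = \<one>"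
    by (metis g_closed int_pow_closed inv_closed inv_equality inv_inv r_inv)
  then show ?thesis by (simp add: int_pow_diff flip: g_pow_eq_one_iff)
qed

lemma torsion_mono: "x \<in> carrier P \<Longrightarrow> x [^] (p ^ k) = \<one> \<Longrightarrow> k \<le> l \<Longrightarrow> x [^] (p ^ l) = \<one>"
  by (metis le_add_diff_inverse nat_pow_one nat_pow_pow power_add)

lemma torsion_int: "x \<in> carrier P \<Longrightarrow> x [^] (p ^ k) = \<one> \<Longrightarrow> int p ^ k dvd n \<Longrightarrow> x [^] n = \<one>"
proof -
  assume x: "x \<in> carrier P" "x [^] (p ^ k) = \<one>" and "int p ^ k dvd n"
  then obtain d where d: "n = int (p ^ k) * d" by auto
  have "x [^] n = (x [^] int (p ^ k)) [^] d" using x by (simp add: d int_pow_pow)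
  also have "x [^] int (p ^ k) = \<one>" using x by (simp only: int_pow_int)
  finally show ?thesis by simp
qed

text \<open>Written as a power of \<open>g (Suc k)\<close>, such a y has an exponent prime to p,
  which is invertible modulo p^(k + 1).\<close>

lemma torsion_step:
  assumes y: "y \<in> carrier P" "y [^] (p ^ Suc k) = \<one>" "y [^] (p ^ k) \<noteq> \<one>"
    and w: "w \<in> carrier P" "w [^] (p ^ Suc k) = \<one>"
  shows "\<exists>n::int. w = y [^] n"
proof -
  obtain e where e: "y = g (Suc k) [^] (e::int)" using g_generates y by blast
  obtain f where f: "w = g (Suc k) [^] (f::int)" using g_generates w by blast
  have "\<not> int p dvd e"
  proof
    assume "int p dvd e"
    then have "int p ^ Suc k dvd e * int (p ^ k)" by (auto intro: mult_dvd_mono)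
    then have "g (Suc k) [^] (e * int (p ^ k)) = \<one>" by (simp only: g_pow_eq_one_iff)
    then have "y [^] int (p ^ k) = \<one>" using e by (simp add: int_pow_pow)
    then show False using y(3) by (simp only: int_pow_int)
  qed
  then have "coprime e (int p ^ Suc k)"
    using prime_imp_coprime[of "int p" e] prime by (simp add: coprime_commute del: power_Suc)
  then obtain h q where hq: "h * e + q * int p ^ Suc k = 1" using bezout_int[of e "int p ^ Suc k"] by auto
  have "f - e * (h * f) = f * (1 - h * e)" by (simp add: algebra_simps)
  also have "\<dots> = f * (q * int p ^ Suc k)" using hq by simp
  finally have "int p ^ Suc k dvd f - e * (h * f)" by simp
  then have "w = g (Suc k) [^] (e * (h * f))" using f by (simp add: g_pow_eq_iff del: power_Suc)
  then have "w = y [^] (h * f)" using e by (simp add: int_pow_pow)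
  then show ?thesis ..
qed

end

lemma (in comm_group) hom_finprod_one:
  assumes "group H" "\<chi> \<in> hom G H" "\<And>i. i \<in> A \<Longrightarrow> f i \<in> carrier G" "\<And>i. i \<in> A \<Longrightarrow> \<chi> (f i) = \<one>\<^bsub>H\<^esub>"
  shows "\<chi> (finprod G f A) = \<one>\<^bsub>H\<^esub>"
  using assms(3,4)
proof (induction A rule: infinite_finite_induct)
  interpret group_hom G H \<chi> using assms(1,2) is_group by (simp add: group_hom_def group_hom_axioms_def)
  { case (infinite A) then show ?case by simp }
  { case empty then show ?case by simp }
  { case (insert i A)
    then have "f \<in> A \<rightarrow> carrier G" "f i \<in> carrier G" by auto
    moreover have "\<chi> (f i) = \<one>\<^bsub>H\<^esub>" "\<chi> (finprod G f A) = \<one>\<^bsub>H\<^esub>" using insert by auto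
    ultimately show ?case using insert.hyps by simp }
qed

context filtered_group
begin

text \<open>Continuity into a discrete group, stated without a topology: the kernel contains some
  \<open>U m\<close>.\<close>

definition chars :: "('x, 'n) monoid_scheme \<Rightarrow> ('g \<Rightarrow> 'x) set" where
  "chars P = {\<chi> \<in> hom G P. \<exists>m. \<forall>x\<in>U m. \<chi> x = \<one>\<^bsub>P\<^esub>}"

definition jump_set :: "('g \<Rightarrow> 'x) \<Rightarrow> nat set" where
  "jump_set \<chi> = {i. 1 \<le> i \<and> \<chi> ` U i \<noteq> \<chi> ` U (Suc i)}"

definition J :: "('x, 'n) monoid_scheme \<Rightarrow> nat set set" where
  "J P = jump_set ` chars P"

end

context jump_shift
begin

lemma p_pow_dvd_iff: "int p ^ m dvd int p ^ n \<longleftrightarrow> m \<le> n"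
  using p_ge_2 by (simp add: dvd_power_iff)

text \<open>Both ends are included, so the chain has n + 1 points; a character with this jump set
  has order p^(n + 1).\<close>

definition path :: "nat \<Rightarrow> nat \<Rightarrow> nat set" where
  "path i n = (\<lambda>l. (\<rho> ^^ l) i) ` {..n}"

lemma path_iff: "k \<in> path i n \<longleftrightarrow> (\<rho> ^^ L i k) i = k \<and> L i k \<le> n" if "1 \<le> i"
  using that by (auto simp: path_def image_iff intro!: bexI[of _ "L i k"])

end

context filtered_group
begin

text \<open>The character sends \<open>\<eta> j\<close> to the z j-th power of an element of order
  p^(n + 1). The second condition on z says that the relation is respected. The third bounds the
  image of every \<open>U k\<close> by what powers of \<open>\<eta> i\<close> in \<open>U k\<close>
  produce, so only the chain of i contributes jumps.\<close>

lemma path_in_J: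
  assumes P: "prufer_group P p g" and \<eta>: "generators \<eta>" and r: "relation \<eta> m b u"
    and i: "i \<in> T" "(\<rho> ^^ n) i < m"
    and z: "z i = 1" "int p ^ Suc n dvd (\<Sum>j\<in>T. z j * (int p ^ b j * u j))"
      "\<And>j k. j \<in> T \<Longrightarrow> int p ^ min (Suc n) (L i k) dvd z j * int p ^ L j k"
  shows "path i n \<in> J P"
proof -
  interpret P: prufer_group P p g by fact
  note car = generators_carrier[OF \<eta>]
  define f where "f = (\<lambda>c. \<Sum>j\<in>T. z j * c j)"
  have i1: "1 \<le> i" using i T_pos by blast
  have m1: "1 \<le> m" using i(2) by simp
  have f_W: "int p ^ min (Suc n) (L i k) dvd f c" if "c \<in> W k" for c k
    unfolding f_def
  proof (rule dvd_sum)
    fix j assume j: "j \<in> T"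
    then obtain d where "c j = int p ^ L j k * d" using \<open>c \<in> W k\<close> unfolding W_def by blast
    then show "int p ^ min (Suc n) (L i k) dvd z j * c j"
      using z(3)[OF j, of k] by (metis dvd_mult2 mult.assoc)
  qed
  have f_diff: "f (\<lambda>j. c j - d j) = f c - f d" for c d
    by (simp add: f_def right_diff_distrib sum_subtractf)
  have f_add: "f (\<lambda>j. c j + d j) = f c + f d" for c d
    by (simp add: f_def distrib_left sum.distrib)
  have f_scale: "f (\<lambda>j. q * c j) = q * f c" for c q
    by (simp add: f_def sum_distrib_left mult_ac)
  \<comment> \<open>The chain up to step n stays below m, so vectors in \<open>W m\<close> are sent
    to multiples of p^(n + 1) and the character factors modulo \<open>U m\<close>.\<close>
  have Lim: "Suc n \<le> L i m" using L_le_iff[OF i1, of m n] i(2) by linarith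
  have f_rel: "int p ^ Suc n dvd f c" if Ec: "E \<eta> c \<in> U m" for c
  proof -
    obtain q where q: "(\<lambda>j. c j - q * (int p ^ b j * u j)) \<in> W m"
      using relation_E[OF \<eta> m1 r Ec] by blast
    have "int p ^ Suc n dvd f (\<lambda>j. c j - q * (int p ^ b j * u j))"
      using f_W[OF q] Lim by (simp add: min_absorb1 del: power_Suc)
    then have "int p ^ Suc n dvd f c - q * f (\<lambda>j. int p ^ b j * u j)"
      by (simp only: f_diff f_scale)
    moreover have "int p ^ Suc n dvd q * f (\<lambda>j. int p ^ b j * u j)"
      using z(2) by (intro dvd_mult) (simp add: f_def)
    ultimately show ?thesis using dvd_add by fastforce
  qed
  define G0 where "G0 = g (Suc n)"
  have G0 [simp]: "G0 \<in> carrier P" by (simp add: G0_def)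
  have G0_eq_iff: "G0 [^]\<^bsub>P\<^esub> (e::int) = G0 [^]\<^bsub>P\<^esub> (e'::int) \<longleftrightarrow> int p ^ Suc n dvd e - e'" for e e'
    unfolding G0_def by (rule P.g_pow_eq_iff)
  \<comment> \<open>The exponent vector is an arbitrary choice; \<open>f_rel\<close> makes the value
    independent of it.\<close>
  define \<chi> where "\<chi> = (\<lambda>x. G0 [^]\<^bsub>P\<^esub> f (SOME c. cong_mod m x (E \<eta> c)))"
  have \<chi>: "\<chi> x = G0 [^]\<^bsub>P\<^esub> f c" if c: "cong_mod m x (E \<eta> c)" for x c
  proof -
    have "cong_mod m x (E \<eta> (SOME c. cong_mod m x (E \<eta> c)))" (is "cong_mod m x (E \<eta> ?d)")
      by (rule someI[of "\<lambda>c. cong_mod m x (E \<eta> c)", OF c])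
    then have "cong_mod m (E \<eta> ?d) (E \<eta> c)" using c cong_sym cong_trans by blast
    then have "E \<eta> (\<lambda>j. ?d j - c j) \<in> U m" using car by (simp add: E_diff cong_mod_def)
    then have "int p ^ Suc n dvd f ?d - f c" using f_rel[of "\<lambda>j. ?d j - c j"] by (simp add: f_diff)
    then show ?thesis unfolding \<chi>_def G0_eq_iff .
  qed
  have ex: "\<exists>c. cong_mod m x (E \<eta> c)" if "x \<in> carrier G" for x
    using E_surj[OF \<eta>, of "Suc 0" m x] that m1 U_1 by auto
  have hom: "\<chi> \<in> hom G P"
  proof (rule homI)
    fix x assume "x \<in> carrier G"
    then show "\<chi> x \<in> carrier P" by (simp add: \<chi>_def)
    fix y assume "y \<in> carrier G"
    then obtain c d where cd: "cong_mod m x (E \<eta> c)" "cong_mod m y (E \<eta> d)"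
      using ex \<open>x \<in> carrier G\<close> by blast
    then have "cong_mod m (x \<otimes> y) (E \<eta> (\<lambda>j. c j + d j))"
      using cong_mult[OF cd] car by (simp add: E_add)
    then show "\<chi> (x \<otimes> y) = \<chi> x \<otimes>\<^bsub>P\<^esub> \<chi> y"
      using cd by (simp add: \<chi> f_add P.int_pow_mult)
  qed
  have one: "\<chi> x = \<one>\<^bsub>P\<^esub>" if "x \<in> U m" for x
  proof -
    have "cong_mod m x (E \<eta> (\<lambda>_. 0))" using that by (simp add: E_def cong_one_iff)
    then show ?thesis by (simp add: \<chi> f_def)
  qed
  then have "\<chi> \<in> chars P" using hom by (auto simp: chars_def)
  \<comment> \<open>The cyclic subgroup generated by the p^l-th power. The image of
    \<open>U k\<close> will be \<open>S (L i k)\<close>, so a jump occurs at k exactly when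
    \<open>L i\<close> grows there and has not yet exceeded n.\<close>
  define S where "S = (\<lambda>l. {G0 [^]\<^bsub>P\<^esub> (int p ^ l * d) | d. True})"
  have S_trivial: "S l = {\<one>\<^bsub>P\<^esub>}" if "Suc n \<le> l" for l
  proof -
    have "G0 [^]\<^bsub>P\<^esub> (int p ^ l * d) = \<one>\<^bsub>P\<^esub>" for d
      using P.g_pow_eq_one_iff[of "Suc n"] le_imp_power_dvd[OF that, of "int p"] dvd_mult2
      unfolding G0_def by blast
    then show ?thesis by (auto simp: S_def)
  qed
  have image: "\<chi> ` U k = S (L i k)" if k1: "1 \<le> k" for k
  proof (cases "k \<le> m")
    case True
    show ?thesis
    proof (intro equalityI subsetI)
      fix y assume "y \<in> \<chi> ` U k"
      then obtain x where x: "x \<in> U k" "y = \<chi> x" by blast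
      then obtain c where c: "c \<in> W k" "cong_mod m x (E \<eta> c)" using E_surj[OF \<eta> k1 True] by blast
      then have y: "y = G0 [^]\<^bsub>P\<^esub> f c" using x \<chi> by blast
      show "y \<in> S (L i k)"
      proof (cases "Suc n \<le> L i k")
        case True
        then have "int p ^ Suc n dvd f c" using f_W[OF c(1)] by (simp add: min_absorb1 del: power_Suc)
        then have "y = \<one>\<^bsub>P\<^esub>" using y P.g_pow_eq_one_iff by (simp add: G0_def del: power_Suc)
        then show ?thesis using S_trivial True by blast
      next
        case False
        then have "int p ^ L i k dvd f c" using f_W[OF c(1)] by (simp add: min_absorb2 del: power_Suc)
        then obtain d where "f c = int p ^ L i k * d" by blast
        then show ?thesis using y by (auto simp: S_def)
      qed
    next
      fix y assume "y \<in> S (L i k)"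
      then obtain d where y: "y = G0 [^]\<^bsub>P\<^esub> (int p ^ L i k * d)" by (auto simp: S_def)
      define c where "c = (\<lambda>j. if j = i then int p ^ L i k * d else 0)"
      have "c \<in> W k" by (auto simp: c_def W_def)
      then have "E \<eta> c \<in> U k" by (rule E_mem[OF \<eta>])
      moreover have "f c = int p ^ L i k * d"
        using i z(1) by (simp add: f_def c_def if_distrib cong: if_cong)
      then have "\<chi> (E \<eta> c) = y" using \<chi>[OF cong_refl, of c] car y by simp
      ultimately show "y \<in> \<chi> ` U k" by blast
    qed
  next
    case False
    then have "Suc n \<le> L i k" using Lim L_mono[OF i1, of m k] by simp
    moreover have "\<chi> x = \<one>\<^bsub>P\<^esub>" if "x \<in> U k" for x
      using False U_antimono[of m k] one that by auto
    then have "\<chi> ` U k = {\<one>\<^bsub>P\<^esub>}" using U_one[of k] by (metis image_cong image_constant)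
    ultimately show ?thesis using S_trivial by simp
  qed
  have S_Suc: "S l = S (Suc l) \<longleftrightarrow> Suc n \<le> l" for l
  proof
    assume "S l = S (Suc l)"
    moreover have "G0 [^]\<^bsub>P\<^esub> (int p ^ l * 1) \<in> S l" unfolding S_def by blast
    ultimately obtain d where "G0 [^]\<^bsub>P\<^esub> (int p ^ l * 1) = G0 [^]\<^bsub>P\<^esub> (int p ^ Suc l * d)"
      by (auto simp: S_def)
    then have "int p ^ Suc n dvd int p ^ l * 1 - int p ^ Suc l * d" using G0_eq_iff by blast
    then have *: "int p ^ Suc n dvd int p ^ l * (1 - int p * d)" by (simp add: algebra_simps)
    have "\<not> int p dvd 1 - int p * d"
    proof
      assume "int p dvd 1 - int p * d"
      then have "int p dvd (1 - int p * d) + int p * d" by (intro dvd_add) auto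
      then show False using p_ge_2 by auto
    qed
    then have "coprime (int p ^ Suc n) (1 - int p * d)"
      using prime_p by (simp add: prime_imp_coprime del: power_Suc)
    then have "int p ^ Suc n dvd int p ^ l" using * coprime_dvd_mult_left_iff by blast
    then show "Suc n \<le> l" by (simp only: p_pow_dvd_iff)
  qed (simp add: S_trivial)
  have "jump_set \<chi> = path i n"
  proof (intro Set.set_eqI)
    fix k
    show "k \<in> jump_set \<chi> \<longleftrightarrow> k \<in> path i n"
    proof (cases "1 \<le> k")
      case True
      then have "k \<in> jump_set \<chi> \<longleftrightarrow> S (L i k) \<noteq> S (L i (Suc k))"
        using image[of k] image[of "Suc k"] by (simp add: jump_set_def)
      also have "\<dots> \<longleftrightarrow> k \<in> path i n"
        using S_Suc[of "L i k"] L_Suc[OF i1, of k] path_iff[OF i1] by auto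
      finally show ?thesis .
    next
      case False
      then show ?thesis using i1 rho_pow_pos[OF i1, of "L i k"] by (auto simp: jump_set_def path_iff)
    qed
  qed
  then show ?thesis using \<open>\<chi> \<in> chars P\<close> by (force simp: J_def)
qed

text \<open>The p-th power of an element of \<open>U k\<close> lies in \<open>U (Suc k)\<close>, so
  each jump enlarges the image by exactly one factor p. Going back from a level with trivial image,
  the image is the full torsion subgroup counted by the jumps met so far.\<close>

lemma char_image_path:
  assumes P: "prufer_group P p g" and \<chi>: "\<chi> \<in> chars P" and i: "1 \<le> i" and jumps: "jump_set \<chi> = path i n"
    and k: "1 \<le> k"
  shows "\<chi> ` U k = {x \<in> carrier P. x [^]\<^bsub>P\<^esub> (p ^ (Suc n - L i k)) = \<one>\<^bsub>P\<^esub>}"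
proof -
  interpret P: prufer_group P p g by fact
  have hom: "\<chi> \<in> hom G P" using \<chi> by (simp add: chars_def)
  interpret group_hom G P \<chi>
    using hom P.is_group is_group by (simp add: group_hom_def group_hom_axioms_def)
  obtain m0 where m0: "\<And>x. x \<in> U m0 \<Longrightarrow> \<chi> x = \<one>\<^bsub>P\<^esub>" using \<chi> by (auto simp: chars_def)
  define m where "m = max k (max m0 (Suc ((\<rho> ^^ n) i)))"
  have "k \<le> m" by (simp add: m_def)
  then show ?thesis using k
  proof (induction k rule: inc_induct)
    case base
    have "\<not> L i m \<le> n" using L_le_iff[OF i, of m n] by (simp add: m_def)
    moreover have "\<chi> x = \<one>\<^bsub>P\<^esub>" if "x \<in> U m" for x
      proof -
      have "m0 \<le> m" by (simp add: m_def)
      then show ?thesis using m0 U_antimono that by blast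
    qed
    then have "\<chi> ` U m = {\<one>\<^bsub>P\<^esub>}" using U_one[of m] by (metis image_cong image_constant)
    ultimately show ?case by auto
  next
    case (step k)
    then have IH: "\<chi> ` U (Suc k) = {x \<in> carrier P. x [^]\<^bsub>P\<^esub> (p ^ (Suc n - L i (Suc k))) = \<one>\<^bsub>P\<^esub>}" by simp
    show ?case
    proof (cases "k \<in> path i n")
      case False
      then have "\<chi> ` U k = \<chi> ` U (Suc k)" using jumps step.prems by (auto simp: jump_set_def)
      moreover have "Suc n - L i (Suc k) = Suc n - L i k"
        using False path_iff[OF i] L_Suc[OF i, of k] by auto
      ultimately show ?thesis using IH by simp
    next
      case True
      define N where "N = n - L i k"
      have N: "Suc n - L i k = Suc N" "Suc n - L i (Suc k) = N"
        using True path_iff[OF i] L_Suc[OF i, of k] by (auto simp: N_def)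
      have "\<chi> ` U k \<noteq> \<chi> ` U (Suc k)" using jumps True by (auto simp: jump_set_def)
      then have "\<not> \<chi> ` U k \<subseteq> \<chi> ` U (Suc k)" using U_Suc_subset by blast
      then obtain x where x: "x \<in> U k" "\<chi> x \<notin> \<chi> ` U (Suc k)" by blast
      have sub: "\<chi> y [^]\<^bsub>P\<^esub> (p ^ Suc N) = \<one>\<^bsub>P\<^esub>" if "y \<in> U k" for y
      proof -
        have y: "y \<in> carrier G" using that U_carrier by blast
        have "\<chi> (y [^] p) \<in> \<chi> ` U (Suc k)" using U_pow_Suc step.prems that by blast
        then have "(\<chi> y [^]\<^bsub>P\<^esub> p) [^]\<^bsub>P\<^esub> (p ^ N) = \<one>\<^bsub>P\<^esub>" using IH N y by (simp add: hom_nat_pow)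
        then show ?thesis using y by (simp add: P.nat_pow_pow)
      qed
      have xc: "x \<in> carrier G" using x U_carrier by blast
      have "\<chi> x [^]\<^bsub>P\<^esub> (p ^ N) \<noteq> \<one>\<^bsub>P\<^esub>" using x(2) xc IH N by auto
      then have "y \<in> \<chi> ` U k" if y: "y \<in> carrier P" "y [^]\<^bsub>P\<^esub> (p ^ Suc N) = \<one>\<^bsub>P\<^esub>" for y
      proof -
        obtain e :: int where "y = \<chi> x [^]\<^bsub>P\<^esub> e"
          using P.torsion_step[of "\<chi> x" N y] sub[OF x(1)] xc y \<open>\<chi> x [^]\<^bsub>P\<^esub> (p ^ N) \<noteq> \<one>\<^bsub>P\<^esub>\<close> by auto
        then have "y = \<chi> (x [^] e)" using xc by (simp add: hom_int_pow)
        then show ?thesis using U_int_pow[OF x(1)] by blast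
      qed
      moreover have "\<chi> y \<in> carrier P" if "y \<in> U k" for y using that U_carrier by simp
      ultimately show ?thesis unfolding N using sub by blast
    qed
  qed
qed

text \<open>A character with these jumps kills every other term of the relation, hence also the term
  of i. Then the image of \<open>U i\<close> is killed by p^(b i), although it must contain an
  element of order p^(b i + 1).\<close>

lemma path_not_in_J:
  assumes P: "prufer_group P p g" and \<eta>: "generators \<eta>" and r: "relation \<eta> m b u"
    and i: "i \<in> T" "(\<rho> ^^ b i) i < m"
    and min: "\<And>j. j \<in> T \<Longrightarrow> j \<noteq> i \<Longrightarrow> b j \<le> b i \<Longrightarrow> (\<rho> ^^ b i) i < (\<rho> ^^ b j) j"
  shows "path i (b i) \<notin> J P"
proof
  assume "path i (b i) \<in> J P"
  then obtain \<chi> where \<chi>: "\<chi> \<in> chars P" "jump_set \<chi> = path i (b i)" by (auto simp: J_def)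
  interpret P: prufer_group P p g by fact
  have hom: "\<chi> \<in> hom G P" using \<chi> by (simp add: chars_def)
  interpret group_hom G P \<chi>
    using hom P.is_group is_group by (simp add: group_hom_def group_hom_axioms_def)
  note car = generators_carrier[OF \<eta>]
  define n where "n = b i"
  define v where "v = (\<lambda>j. int p ^ b j * u j)"
  have i1: "1 \<le> i" using i T_pos by blast
  have img: "\<chi> x \<in> carrier P \<and> \<chi> x [^]\<^bsub>P\<^esub> (p ^ (Suc n - L i k)) = \<one>\<^bsub>P\<^esub>" if "x \<in> U k" "1 \<le> k" for x k
    using char_image_path[OF P \<chi>(1) i1 \<chi>(2) that(2)] that(1) unfolding n_def by blast
  have "\<chi> (\<eta> j [^] v j) = \<one>\<^bsub>P\<^esub>" if j: "j \<in> T" "j \<noteq> i" for j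
  proof -
    have j1: "1 \<le> j" using j T_pos by blast
    \<comment> \<open>\<open>\<chi> (\<eta> j)\<close> is killed by the power of p on the left. If
      that exceeded b j, the chain of i would be at j or beyond after n - b j steps, and b j further
      steps would contradict \<open>min\<close>.\<close>
    have "Suc n - L i j \<le> b j"
    proof (cases "b j \<le> n")
      case True
      then have lt: "(\<rho> ^^ n) i < (\<rho> ^^ b j) j" using min[OF j] by (simp add: n_def)
      have "\<not> L i j \<le> n - b j"
      proof
        assume "L i j \<le> n - b j"
        then have "j \<le> (\<rho> ^^ (n - b j)) i" using L_le_iff[OF i1] by blast
        then have "(\<rho> ^^ b j) j \<le> (\<rho> ^^ b j) ((\<rho> ^^ (n - b j)) i)" by (simp only: rho_pow_le_iff)
        also have "\<dots> = (\<rho> ^^ n) i" using True by (simp flip: rho_pow_add)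
        finally show False using lt by simp
      qed
      then show ?thesis using True by simp
    qed simp
    moreover have "\<eta> j \<in> U j" using \<eta> j by (simp add: generators_def)
    ultimately have "\<chi> (\<eta> j) [^]\<^bsub>P\<^esub> (p ^ b j) = \<one>\<^bsub>P\<^esub>"
      using P.torsion_mono img[of "\<eta> j" j] j1 by blast
    then have "\<chi> (\<eta> j) [^]\<^bsub>P\<^esub> v j = \<one>\<^bsub>P\<^esub>"
      using P.torsion_int[of "\<chi> (\<eta> j)" "b j" "v j"] car[OF j(1)] by (simp add: v_def)
    then show ?thesis using car[OF j(1)] by (simp add: hom_int_pow)
  qed
  then have *: "\<chi> (\<Otimes>j\<in>T - {i}. \<eta> j [^] v j) = \<one>\<^bsub>P\<^esub>"
    using car by (intro hom_finprod_one[OF P.is_group hom]) auto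
  have "E \<eta> v \<in> U m" using r by (simp add: relation_def v_def)
  moreover have "Suc n - L i m = 0" using L_le_iff[OF i1, of m n] i(2) by (simp add: n_def)
  ultimately have "\<chi> (E \<eta> v) = \<one>\<^bsub>P\<^esub>" using img[of "E \<eta> v" m] i(2) by auto
  moreover have "(\<Otimes>j\<in>T - {i}. \<eta> j [^] v j) \<in> carrier G" using car by (intro finprod_closed) auto
  ultimately have "\<chi> (\<eta> i [^] v i) = \<one>\<^bsub>P\<^esub>"
    using E_remove[OF i(1) car, where c=v] * car[OF i(1)] by simp
  then have vi: "\<chi> (\<eta> i) [^]\<^bsub>P\<^esub> v i = \<one>\<^bsub>P\<^esub>" using car[OF i(1)] by (simp add: hom_int_pow)
  have \<eta>i: "\<eta> i \<in> U i" "\<eta> i \<in> U i - U (Suc i)" using \<eta> i by (auto simp: generators_def)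
  have Lii: "L i i = 0" using L_le_iff[OF i1, of i 0] by simp
  have "\<chi> (\<eta> i) [^]\<^bsub>P\<^esub> (p ^ Suc n) = \<one>\<^bsub>P\<^esub>" using img[OF \<eta>i(1) i1] Lii by simp
  then obtain e where e: "\<chi> (\<eta> i) = g (Suc n) [^]\<^bsub>P\<^esub> (e::int)"
    using P.g_generates[of "\<chi> (\<eta> i)" "Suc n"] hom_closed[OF car[OF i(1)]] by blast
  have "g (Suc n) [^]\<^bsub>P\<^esub> (e * v i) = \<one>\<^bsub>P\<^esub>" using vi e by (simp add: P.int_pow_pow)
  then have "int p ^ Suc n dvd e * v i" by (simp only: P.g_pow_eq_one_iff)
  then have "int p dvd e * u i" using p_ge_2 by (simp add: v_def n_def)
  then have "int p dvd e" using r i prime_p by (auto simp: relation_def prime_dvd_mult_iff)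
  then have "int p ^ Suc n dvd e * int (p ^ n)" by (auto intro: mult_dvd_mono)
  then have "g (Suc n) [^]\<^bsub>P\<^esub> (e * int (p ^ n)) = \<one>\<^bsub>P\<^esub>" by (simp only: P.g_pow_eq_one_iff)
  then have "\<chi> (\<eta> i) [^]\<^bsub>P\<^esub> int (p ^ n) = \<one>\<^bsub>P\<^esub>" using e by (simp add: P.int_pow_pow)
  then have \<eta>n: "\<chi> (\<eta> i) [^]\<^bsub>P\<^esub> (p ^ n) = \<one>\<^bsub>P\<^esub>" by (simp only: int_pow_int)
  \<comment> \<open>An element of \<open>U i\<close> is a power of \<open>\<eta> i\<close> times an
    element of \<open>U (Suc i)\<close>. The former is killed by p^n as just shown, the latter
    because \<open>L i (Suc i)\<close> = 1.\<close>
  have small: "\<chi> x [^]\<^bsub>P\<^esub> (p ^ n) = \<one>\<^bsub>P\<^esub>" if x: "x \<in> U i" for x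
  proof -
    obtain d :: int where d: "x \<otimes> inv (\<eta> i [^] d) \<in> U (Suc i)" using U_cyclic[OF i1 \<eta>i(2) x] by blast
    define y where "y = x \<otimes> inv (\<eta> i [^] d)"
    have "L i (Suc i) = 1" using L_Suc[OF i1, of i] Lii by simp
    then have y: "y \<in> carrier G" "\<chi> y [^]\<^bsub>P\<^esub> (p ^ n) = \<one>\<^bsub>P\<^esub>"
      using img[of y "Suc i"] d U_carrier by (auto simp: y_def)
    have xc: "x \<in> carrier G" using x U_carrier by blast
    then have "x = y \<otimes> \<eta> i [^] d" using car[OF i(1)] by (simp add: y_def m_assoc)
    then have "\<chi> x = \<chi> y \<otimes>\<^bsub>P\<^esub> \<chi> (\<eta> i) [^]\<^bsub>P\<^esub> d" using y car[OF i(1)] by (simp add: hom_int_pow)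
    moreover have "(\<chi> (\<eta> i) [^]\<^bsub>P\<^esub> d) [^]\<^bsub>P\<^esub> (p ^ n) = (\<chi> (\<eta> i) [^]\<^bsub>P\<^esub> int (p ^ n)) [^]\<^bsub>P\<^esub> d"
      using car[OF i(1)] by (simp add: P.int_pow_pow mult.commute del: of_nat_power flip: int_pow_int)
    ultimately show ?thesis
      using y car[OF i(1)] \<eta>n by (simp add: P.nat_pow_distrib int_pow_int del: of_nat_power)
  qed
  have "g (Suc n) [^]\<^bsub>P\<^esub> int (p ^ Suc n) = \<one>\<^bsub>P\<^esub>" by (simp only: P.g_pow_eq_one_iff) simp
  then have "g (Suc n) [^]\<^bsub>P\<^esub> (p ^ Suc n) = \<one>\<^bsub>P\<^esub>" by (simp only: int_pow_int)
  then have "g (Suc n) \<in> \<chi> ` U i"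
    using char_image_path[OF P \<chi>(1) i1 \<chi>(2) i1] Lii by (simp add: n_def)
  then obtain x where "x \<in> U i" "g (Suc n) = \<chi> x" by (rule imageE)
  then have "g (Suc n) [^]\<^bsub>P\<^esub> (p ^ n) = \<one>\<^bsub>P\<^esub>" using small by metis
  then have "g (Suc n) [^]\<^bsub>P\<^esub> int (p ^ n) = \<one>\<^bsub>P\<^esub>" by (simp only: int_pow_int)
  then have "int p ^ Suc n dvd int (p ^ n)" by (simp only: P.g_pow_eq_one_iff)
  then have "Suc n \<le> n" by (simp only: of_nat_power p_pow_dvd_iff)
  then show False by simp
qed

end

section \<open>Jump sets determine a normal form of the relation\<close>

context jump_shift
begin

definition front :: "nat set set \<Rightarrow> nat \<Rightarrow> nat \<Rightarrow> bool" where
  "front \<J> i n \<longleftrightarrow> path i n \<notin> \<J> \<and> (\<forall>n'<n. path i n' \<in> \<J>)"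

text \<open>An exponent vector computed from the jump sets alone. Positions without a pair, or with
  a pair that is invisible modulo level m, get exponent 0.\<close>

definition normal_form :: "nat set set \<Rightarrow> nat \<Rightarrow> nat \<Rightarrow> int" where
  "normal_form \<J> m i = (if \<exists>n. front \<J> i n \<and> (\<rho> ^^ n) i < m then int p ^ (THE n. front \<J> i n) else 0)"

lemma front_unique: "front \<J> i n \<Longrightarrow> front \<J> i n' \<Longrightarrow> n = n'"
  unfolding front_def by (metis linorder_neqE_nat)

end

context filtered_group
begin

text \<open>Only \<open>\<eta> i\<close> gets a nontrivial value; its term in the relation dies
  because p^(n + 1) divides p^(b i).\<close>

lemma short_path_in_J:
  assumes P: "prufer_group P p g" and \<eta>: "generators \<eta>" and r: "relation \<eta> m b u"
    and i: "i \<in> T" "(\<rho> ^^ n) i < m" "n < b i"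
  shows "path i n \<in> J P"
proof (rule path_in_J[OF P \<eta> r i(1,2), where z="\<lambda>j. if j = i then 1 else 0"])
  let ?z = "\<lambda>j. if j = i then 1 else 0 :: int"
  show "?z i = 1" by simp
  have "(\<Sum>j\<in>T. ?z j * (int p ^ b j * u j)) = int p ^ b i * u i"
    using i(1) by (simp add: if_distrib[of "\<lambda>x. x * _"] cong: if_cong)
  moreover have "int p ^ Suc n dvd int p ^ b i" using i(3) by (intro le_imp_power_dvd) simp
  ultimately show "int p ^ Suc n dvd (\<Sum>j\<in>T. ?z j * (int p ^ b j * u j))" by (simp del: power_Suc)
  fix j k assume "j \<in> T"
  show "int p ^ min (Suc n) (L i k) dvd ?z j * int p ^ L j k"
    by (auto intro: le_imp_power_dvd simp del: power_Suc)
qed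

text \<open>The term of i in the relation is compensated by a value on the dominating
  \<open>\<eta> j\<close>. With d = b i - b j, domination puts j at or below the d-th point of the
  chain of i; as the value on \<open>\<eta> j\<close> is a multiple of p^d, it creates no jump
  outside that chain.\<close>

lemma dominated_path_in_J:
  assumes P: "prufer_group P p g" and \<eta>: "generators \<eta>" and r: "relation \<eta> m b u"
    and i: "i \<in> T" "(\<rho> ^^ n) i < m" "b i \<le> n"
    and j: "j \<in> T" "j \<noteq> i" "b j \<le> b i" "(\<rho> ^^ b j) j \<le> (\<rho> ^^ b i) i"
  shows "path i n \<in> J P"
proof -
  have i1: "1 \<le> i" and j1: "1 \<le> j" using i(1) j(1) T_pos by blast+
  have "\<not> int p dvd u j" using r j(1) by (simp add: relation_def)
  then have "coprime (u j) (int p ^ Suc n)"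
    using prime_imp_coprime[of "int p" "u j"] prime_p by (simp add: coprime_commute del: power_Suc)
  \<comment> \<open>w inverts u j modulo p^(n + 1), which makes z j * p^(b j) * u j congruent to -
    p^(b i) * u i.\<close>
  then obtain w q where wq: "w * u j + q * int p ^ Suc n = 1"
    using bezout_int[of "u j" "int p ^ Suc n"] by auto
  define d where "d = b i - b j"
  define z where "z = (\<lambda>k. if k = i then 1 else if k = j then - (w * u i * int p ^ d) else 0)"
  show ?thesis
  proof (rule path_in_J[OF P \<eta> r i(1,2)])
    show "z i = 1" by (simp add: z_def)
    have "(\<Sum>k\<in>T. z k * (int p ^ b k * u k)) = (\<Sum>k\<in>{i, j}. z k * (int p ^ b k * u k))"
      using i(1) j(1) by (intro sum.mono_neutral_right) (auto simp: z_def)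
    also have "\<dots> = int p ^ b i * u i - w * u i * (int p ^ d * int p ^ b j) * u j"
      using j(2) by (simp add: z_def)
    also have "int p ^ d * int p ^ b j = int p ^ b i" using j(3) by (simp add: d_def flip: power_add)
    also have "int p ^ b i * u i - w * u i * int p ^ b i * u j = int p ^ b i * u i * (1 - w * u j)"
      by (simp add: algebra_simps)
    also have "1 - w * u j = q * int p ^ Suc n" using wq by (simp del: power_Suc)
    finally show "int p ^ Suc n dvd (\<Sum>k\<in>T. z k * (int p ^ b k * u k))" by (simp del: power_Suc)
    fix l k assume "l \<in> T"
    have "j \<le> (\<rho> ^^ d) i"
    proof -
      have "(\<rho> ^^ b j) j \<le> (\<rho> ^^ b j) ((\<rho> ^^ d) i)" using j(3,4) by (simp add: d_def flip: rho_pow_add)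
      then show ?thesis by (simp only: rho_pow_le_iff)
    qed
    have "k \<le> (\<rho> ^^ L j k) j" using L_le_iff[OF j1] by blast
    also have "\<dots> \<le> (\<rho> ^^ L j k) ((\<rho> ^^ d) i)" using \<open>j \<le> (\<rho> ^^ d) i\<close> by simp
    also have "\<dots> = (\<rho> ^^ (L j k + d)) i" by (simp only: rho_pow_add)
    finally have "L i k \<le> L j k + d" using L_le_iff[OF i1] by blast
    then have "int p ^ min (Suc n) (L i k) dvd int p ^ d * int p ^ L j k"
      unfolding power_add[symmetric] by (intro le_imp_power_dvd) simp
    then have "int p ^ min (Suc n) (L i k) dvd w * u i * int p ^ d * int p ^ L j k"
      unfolding mult.assoc by (rule dvd_mult[OF dvd_mult])
    then have "int p ^ min (Suc n) (L i k) dvd - (w * u i * int p ^ d) * int p ^ L j k"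
      by (simp only: mult_minus_left dvd_minus_iff)
    moreover have "int p ^ min (Suc n) (L i k) dvd int p ^ L i k" by (intro le_imp_power_dvd) simp
    ultimately show "int p ^ min (Suc n) (L i k) dvd z l * int p ^ L l k"
      unfolding z_def by (cases "l = i"; cases "l = j") (simp_all del: power_Suc)
  qed
qed

text \<open>Minimality for the componentwise order on the pairs formed by b j and the end of the
  chain of j after b j steps. Distinct indices give distinct pairs, as the iterates of
  \<open>\<rho>\<close> are injective.\<close>

definition undominated :: "(nat \<Rightarrow> nat) \<Rightarrow> nat \<Rightarrow> bool" where
  "undominated b i \<longleftrightarrow> (\<forall>j\<in>T. j \<noteq> i \<longrightarrow> b j \<le> b i \<longrightarrow> (\<rho> ^^ b i) i < (\<rho> ^^ b j) j)"

text \<open>The left side mentions neither \<open>\<eta>\<close> nor b and u, so the undominated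
  pairs below level m do not depend on the chosen generators and are determined by the jump
  sets.\<close>

lemma front_iff:
  assumes P: "prufer_group P p g" and \<eta>: "generators \<eta>" and r: "relation \<eta> m b u"
    and i: "i \<in> T" "(\<rho> ^^ n) i < m"
  shows "front (J P) i n \<longleftrightarrow> n = b i \<and> undominated b i"
proof
  assume f: "front (J P) i n"
  have i1: "1 \<le> i" using i(1) T_pos by blast
  have bi: "b i \<le> n" using short_path_in_J[OF P \<eta> r i] f by (force simp: front_def)
  have un: "undominated b i"
    unfolding undominated_def
    using dominated_path_in_J[OF P \<eta> r i bi] f by (meson front_def linorder_not_le)
  have "(\<rho> ^^ b i) i \<le> (\<rho> ^^ n) i" using bi rho_pow_left_le_iff[OF i1] by blast
  then have "path i (b i) \<notin> J P"
    using un i by (intro path_not_in_J[OF P \<eta> r]) (auto simp: undominated_def)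
  then show "n = b i \<and> undominated b i" using f bi un by (auto simp: front_def le_less)
next
  assume *: "n = b i \<and> undominated b i"
  have i1: "1 \<le> i" using i(1) T_pos by blast
  have "path i (b i) \<notin> J P"
    using * i by (intro path_not_in_J[OF P \<eta> r]) (auto simp: undominated_def)
  moreover have "path i n' \<in> J P" if "n' < n" for n'
    using * i that rho_pow_strict_left[OF i1 that] by (intro short_path_in_J[OF P \<eta> r]) auto
  ultimately show "front (J P) i n" using * by (simp add: front_def)
qed

lemma normal_form_eq:
  assumes P: "prufer_group P p g" and \<eta>: "generators \<eta>" and r: "relation \<eta> m b u" and i: "i \<in> T"
  shows "normal_form (J P) m i = (if (\<rho> ^^ b i) i < m \<and> undominated b i then int p ^ b i else 0)"
proof (cases "(\<rho> ^^ b i) i < m \<and> undominated b i")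
  case True
  then have f: "front (J P) i (b i)" using front_iff[OF P \<eta> r i] by blast
  then have "(THE n. front (J P) i n) = b i" using front_unique by blast
  then show ?thesis using True f by (auto simp: normal_form_def)
next
  case False
  then have nex: "\<not> (\<exists>n. front (J P) i n \<and> (\<rho> ^^ n) i < m)" using front_iff[OF P \<eta> r i] by blast
  have "normal_form (J P) m i = 0" unfolding normal_form_def by (rule if_not_P[OF nex])
  then show ?thesis using False by (simp only: if_False)
qed

text \<open>The normal form has the shape that \<open>E_relation\<close> asks of a relation. The
  pair of \<open>t\<close> is never dominated: its chain ends at p * a, and all other terms end
  beyond p * a.\<close>

lemma normal_form_relation:
  assumes P: "prufer_group P p g" and m: "p * a < m"
  shows "normal_form (J P) m t = int p ^ Suc s * 1"
    and "\<And>j. j \<in> T \<Longrightarrow> j \<noteq> t \<Longrightarrow> int p ^ L j (Suc (p * a)) dvd normal_form (J P) m j"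
proof -
  obtain \<eta> where \<eta>: "generators \<eta>" using generators_exist by blast
  obtain b u where r: "relation \<eta> m b u" using relation_exists[OF \<eta> m] by blast
  have bt: "b t = Suc s" "(\<rho> ^^ b t) t = p * a" using r rho_Suc_s_t by (auto simp: relation_def)
  then have "undominated b t" using r by (auto simp: undominated_def relation_def)
  then show "normal_form (J P) m t = int p ^ Suc s * 1"
    using normal_form_eq[OF P \<eta> r t_in_T] bt m by simp
  fix j assume j: "j \<in> T" "j \<noteq> t"
  then have "p * a < (\<rho> ^^ b j) j" using r by (auto simp: relation_def)
  then have "L j (Suc (p * a)) \<le> b j" using L_le_iff[OF T_pos[OF j(1)]] by (simp add: Suc_le_eq)
  then show "int p ^ L j (Suc (p * a)) dvd normal_form (J P) m j"
    using normal_form_eq[OF P \<eta> r j(1)] by (simp add: le_imp_power_dvd)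
qed

text \<open>Each visible term j is assigned to an undominated index d j that dominates it. The new
  generator at i collects all \<open>\<eta> j\<close> with d j = i, with exponents p^(b j - b i) * u
  j, so its p^(b i)-th power is the product of the assigned terms and only pure powers of p
  remain.\<close>

lemma normal_generators_exist:
  assumes P: "prufer_group P p g" and m: "p * a < m"
  shows "\<exists>\<eta>. generators \<eta> \<and> E \<eta> (normal_form (J P) m) \<in> U m"
proof -
  obtain \<eta> where \<eta>: "generators \<eta>" using generators_exist by blast
  note car = generators_carrier[OF \<eta>]
  obtain b u where r: "relation \<eta> m b u" using relation_exists[OF \<eta> m] by blast
  define w where "w = (\<lambda>j. (\<rho> ^^ b j) j)"
  define D where "D = {j \<in> T. w j < m}"
  define N where "N = {i \<in> D. undominated b i}"
  \<comment> \<open>A minimum of the sum b + w among the terms that dominate j cannot itself be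
    dominated.\<close>
  have min_dom: "\<exists>i\<in>N. b i \<le> b j \<and> w i \<le> w j" if j: "j \<in> D" for j
  proof -
    define C where "C = {i \<in> D. b i \<le> b j \<and> w i \<le> w j}"
    have "j \<in> C" using j by (simp add: C_def)
    then obtain i where i: "i \<in> C" "\<And>k. k \<in> C \<Longrightarrow> b i + w i \<le> b k + w k"
      using ex_has_least_nat[of "\<lambda>i. i \<in> C" j "\<lambda>i. b i + w i"] by blast
    have "undominated b i"
      unfolding undominated_def
    proof (intro ballI impI)
      fix k assume k: "k \<in> T" "k \<noteq> i" "b k \<le> b i"
      show "(\<rho> ^^ b i) i < (\<rho> ^^ b k) k"
      proof (rule ccontr)
        assume "\<not> ?thesis"
        then have wk: "w k \<le> w i" by (simp add: w_def)
        then have "k \<in> C" using k i(1) by (auto simp: C_def D_def)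
        then have "b i + w i \<le> b k + w k" by (rule i(2))
        then have "b k = b i" "w k = w i" using k(3) wk by linarith+
        then show False using k(2) by (simp add: w_def)
      qed
    qed
    then show ?thesis using i(1) by (auto simp: C_def N_def)
  qed
  then obtain d where d: "\<And>j. j \<in> D \<Longrightarrow> d j \<in> N \<and> b (d j) \<le> b j \<and> w (d j) \<le> w j" by metis
  have d_N: "d i = i" if "i \<in> N" for i
  proof (rule ccontr)
    assume "d i \<noteq> i"
    have "i \<in> D" "undominated b i" using that by (auto simp: N_def)
    moreover have "d i \<in> T" using d[OF \<open>i \<in> D\<close>] by (auto simp: N_def D_def)
    ultimately show False using d[OF \<open>i \<in> D\<close>] \<open>d i \<noteq> i\<close> by (auto simp: undominated_def w_def)
  qed
  define M where "M = (\<lambda>i j. if i \<in> N then (if j \<in> D \<and> d j = i then int p ^ (b j - b i) * u j else 0)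
    else (if j = i then 1 else 0))"
  define nf where "nf = normal_form (J P) m"
  have nf: "nf i = (if i \<in> N then int p ^ b i else 0)" if "i \<in> T" for i
    unfolding nf_def normal_form_eq[OF P \<eta> r that] using that by (auto simp: N_def D_def w_def)
  define v where "v = (\<lambda>j. int p ^ b j * u j)"
  have sum: "(\<Sum>i\<in>T. nf i * M i j) = (if j \<in> D then v j else 0)" if "j \<in> T" for j
  proof (cases "j \<in> D")
    case True
    have dj: "d j \<in> T" "d j \<in> N" "b (d j) \<le> b j" using d[OF True] by (auto simp: N_def D_def)
    have "(\<Sum>i\<in>T. nf i * M i j) = (\<Sum>i\<in>{d j}. nf i * M i j)"
      using dj True nf by (intro sum.mono_neutral_right) (auto simp: M_def)
    also have "\<dots> = int p ^ b (d j) * int p ^ (b j - b (d j)) * u j"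
      using dj True nf by (simp add: M_def)
    also have "\<dots> = v j" using dj by (simp add: v_def flip: power_add)
    finally show ?thesis using True by simp
  next
    case False
    then have "nf i * M i j = 0" if "i \<in> T" for i using nf[OF that] by (simp add: M_def)
    then show ?thesis using False by (simp add: sum.neutral)
  qed
  define \<theta> where "\<theta> = (\<lambda>i. E \<eta> (M i))"
  have "E \<theta> nf = E \<eta> (\<lambda>j. \<Sum>i\<in>T. nf i * M i j)" unfolding \<theta>_def by (rule E_E[OF car])
  also have "\<dots> = E \<eta> (\<lambda>j. v j - (if j \<in> D then 0 else v j))"
    using sum by (intro E_cong[OF car]) auto
  also have "\<dots> = E \<eta> v \<otimes> inv (E \<eta> (\<lambda>j. if j \<in> D then 0 else v j))" by (rule E_diff[OF car])
  also have "\<dots> \<in> U m"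
  proof (intro U_mult U_inv)
    show "E \<eta> v \<in> U m" using r by (simp add: relation_def v_def)
    have "int p ^ L j m dvd v j" if "j \<in> T" "j \<notin> D" for j
      using that L_le_iff[OF T_pos[OF that(1)], of m "b j"]
      by (auto simp: v_def D_def w_def intro!: dvd_mult2 le_imp_power_dvd)
    then have "(\<lambda>j. if j \<in> D then 0 else v j) \<in> W m" by (auto simp: W_def)
    then show "E \<eta> (\<lambda>j. if j \<in> D then 0 else v j) \<in> U m" by (rule E_mem[OF \<eta>])
  qed
  finally have rel: "E \<theta> nf \<in> U m" .
  \<comment> \<open>For i in \<open>N\<close>, the factor \<open>\<eta> i\<close> enters with
    exponent u i prime to p and so keeps the exact level; it remains to see that all other factors
    lie in \<open>U (Suc i)\<close>.\<close>
  have "\<theta> i \<in> U i - U (Suc i)" if i: "i \<in> T" for i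
  proof (cases "i \<in> N")
    case False
    then have "\<theta> i = \<eta> i [^] (1::int)" using E_single[OF i car, where n=1] by (simp add: \<theta>_def M_def)
    then show ?thesis using car[OF i] \<eta> i by (simp add: generators_def)
  next
    case True
    have i1: "1 \<le> i" using i T_pos by blast
    have \<eta>i: "\<eta> i \<in> U i - U (Suc i)" using \<eta> i by (simp add: generators_def)
    have "\<eta> j [^] M i j \<in> U (Suc i)" if j: "j \<in> T" "j \<noteq> i" for j
    proof (cases "j \<in> D \<and> d j = i")
      case False
      then have "M i j = 0" using True by (auto simp: M_def)
      then show ?thesis by simp
    next
      case jD: True
      then have bw: "b i \<le> b j" "w i \<le> w j" using d by blast+
      define e where "e = b j - b i"
      have Mij: "M i j = int (p ^ e) * u j" using True jD by (simp add: M_def e_def)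
      have "(\<rho> ^^ b i) i \<le> (\<rho> ^^ b i) ((\<rho> ^^ e) j)"
        using bw by (simp add: w_def e_def flip: rho_pow_add)
      then have le: "i \<le> (\<rho> ^^ e) j" by simp
      have \<eta>j: "\<eta> j \<in> U j" using \<eta> j by (simp add: generators_def)
      have j1: "1 \<le> j" using j T_pos by blast
      have "\<eta> j [^] (p ^ e) \<in> U (Suc i)"
      proof (cases "i = (\<rho> ^^ e) j")
        case False
        then have "Suc i \<le> (\<rho> ^^ e) j" using le by simp
        then show ?thesis using U_pow_pow[OF j1 \<eta>j, of e] U_antimono by blast
      next
        \<comment> \<open>Equality makes i the end of a nonempty chain although i is in
          \<open>T\<close>, so the last step starts at \<open>a\<close>; then j = \<open>t\<close>,
          and the drop at \<open>a\<close> gives the missing level.\<close>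
        case eq: True
        then obtain e' where e': "e = Suc e'" using j(2) by (cases e) auto
        then have "\<rho> ((\<rho> ^^ e') j) \<in> T" using eq i by simp
        then have "(\<rho> ^^ e') j = a" by (rule rho_in_T)
        then have "\<not> unramified_path e j" unfolding unramified_path_def e' by blast
        then have "j = t \<and> s < e" by (rule ramified_path[OF j(1)])
        then show ?thesis using U_pow_pow_t[of "\<eta> j" e] \<eta>j eq by simp
      qed
      then have "(\<eta> j [^] (p ^ e)) [^] u j \<in> U (Suc i)" by (rule U_int_pow)
      then show ?thesis unfolding Mij using car[OF j(1)] by (simp add: int_pow_pow flip: int_pow_int)
    qed
    then have rest: "(\<Otimes>j\<in>T - {i}. \<eta> j [^] M i j) \<in> U (Suc i)" by (intro U_finprod) auto
    have "M i i = u i" using True d_N[OF True] by (simp add: M_def N_def)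
    then have \<theta>: "\<theta> i = (\<Otimes>j\<in>T - {i}. \<eta> j [^] M i j) \<otimes> \<eta> i [^] u i"
      unfolding \<theta>_def using E_remove[OF i car, where c="M i"] car[OF i] U_carrier[OF rest] by (simp add: m_comm)
    have "\<not> int p dvd u i" using r i by (simp add: relation_def)
    then have "\<eta> i [^] u i \<notin> U (Suc i)" using p_dvd_exponent[OF i1 \<eta>i] by blast
    then have "\<theta> i \<notin> U (Suc i)" unfolding \<theta> using U_mult_left_iff[OF rest] car[OF i] by simp
    moreover have "\<theta> i \<in> U i"
      unfolding \<theta> using rest U_Suc_subset \<eta>i by (blast intro: U_mult U_int_pow)
    ultimately show ?thesis by blast
  qed
  then show ?thesis using rel by (auto simp: generators_def nf_def)
qed

text \<open>A character with a single jump has order p and kills p-th powers, while a level outside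
  \<open>T\<close> is generated modulo the next one by a p-th power. For a level in
  \<open>T\<close>, the order of its term in the relation is positive, so a one-point chain is
  admissible.\<close>

lemma singleton_in_J_iff:
  assumes P: "prufer_group P p g" and i: "1 \<le> i"
  shows "{i} \<in> J P \<longleftrightarrow> i \<in> T"
proof
  assume iT: "i \<in> T"
  obtain \<eta> where \<eta>: "generators \<eta>" using generators_exist by blast
  have m: "p * a < Suc (p * a)" by simp
  obtain b u where r: "relation \<eta> (Suc (p * a)) b u" using relation_exists[OF \<eta> m] by blast
  have "0 < b i"
  proof (cases "i = t")
    case False
    then have "p * a < (\<rho> ^^ b i) i" using r iT by (simp add: relation_def)
    then show ?thesis using T_le[OF iT] by (cases "b i") auto
  qed (use r in \<open>simp add: relation_def\<close>)
  then have "path i 0 \<in> J P"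
    using iT T_le[OF iT] by (intro short_path_in_J[OF P \<eta> r]) auto
  then show "{i} \<in> J P" by (simp add: path_def)
next
  assume "{i} \<in> J P"
  then obtain \<chi> where \<chi>: "\<chi> \<in> chars P" and jumps: "jump_set \<chi> = path i 0" by (auto simp: J_def path_def)
  interpret P: prufer_group P p g by fact
  interpret group_hom G P \<chi>
    using \<chi> P.is_group is_group by (simp add: chars_def group_hom_def group_hom_axioms_def)
  have img: "\<chi> ` U k = {x \<in> carrier P. x [^]\<^bsub>P\<^esub> (p ^ (Suc 0 - L i k)) = \<one>\<^bsub>P\<^esub>}" if "1 \<le> k" for k
    using char_image_path[OF P \<chi> i jumps that] .
  show "i \<in> T"
  proof (rule ccontr)
    assume "i \<notin> T"
    then obtain j where j: "1 \<le> j" "j \<noteq> a" "\<rho> j = i" using not_in_T i by blast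
    then have "j < i" using rho_gt by blast
    obtain x where x: "x \<in> U j - U (Suc j)" using U_strict j by blast
    then have xc: "x \<in> carrier G" using U_carrier by blast
    have xp: "x [^] p \<in> U i - U (Suc i)" using U_pow[OF j(1)] U_pow_exact[OF j(1,2) x] x j(3) by auto
    have "L i j = 0" "L i i = 0" using L_le_iff[OF i, of _ 0] \<open>j < i\<close> by auto
    moreover have "L i (Suc i) = 1" using L_Suc[OF i, of i] \<open>L i i = 0\<close> by simp
    ultimately have imgs: "\<chi> ` U j = {x \<in> carrier P. x [^]\<^bsub>P\<^esub> p = \<one>\<^bsub>P\<^esub>}"
      "\<chi> ` U i = {x \<in> carrier P. x [^]\<^bsub>P\<^esub> p = \<one>\<^bsub>P\<^esub>}"
      "\<chi> ` U (Suc i) = {x \<in> carrier P. x = \<one>\<^bsub>P\<^esub>}"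
      using img[of j] img[of i] img[of "Suc i"] i j(1) by auto
    have "\<chi> x \<in> \<chi> ` U j" using x by blast
    then have "\<chi> (x [^] p) = \<one>\<^bsub>P\<^esub>" using imgs(1) xc by (simp add: hom_nat_pow)
    have "\<chi> y = \<one>\<^bsub>P\<^esub>" if y: "y \<in> U i" for y
    proof -
      obtain n :: int where n: "y \<otimes> inv ((x [^] p) [^] n) \<in> U (Suc i)" using U_cyclic[OF i xp y] by blast
      then have "\<chi> (y \<otimes> inv ((x [^] p) [^] n)) = \<one>\<^bsub>P\<^esub>" using imgs(3) by blast
      moreover have "\<chi> ((x [^] p) [^] n) = \<one>\<^bsub>P\<^esub>" using \<open>\<chi> (x [^] p) = \<one>\<^bsub>P\<^esub>\<close> xc by (simp add: hom_int_pow)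
      ultimately show ?thesis using xc U_carrier[OF y] by simp
    qed
    moreover have "g 1 [^]\<^bsub>P\<^esub> int p = \<one>\<^bsub>P\<^esub>" by (simp add: P.g_pow_eq_one_iff)
    then have "g 1 \<in> \<chi> ` U i" unfolding imgs(2) by (simp add: int_pow_int)
    ultimately have "g 1 = \<one>\<^bsub>P\<^esub>" by auto
    then have "g 1 [^]\<^bsub>P\<^esub> (1::int) = \<one>\<^bsub>P\<^esub>" by simp
    then have "int p ^ 1 dvd 1" by (simp only: P.g_pow_eq_one_iff)
    then show False using p_ge_2 by simp
  qed
qed

lemma T_eq_J: "prufer_group P p g \<Longrightarrow> T = {i. 1 \<le> i \<and> {i} \<in> J P}"
  using singleton_in_J_iff T_pos by blast

lemma Max_T: "Max T = p * a"
  using T_le by (intro Max_eqI) auto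

end

section \<open>Isomorphism of filtered groups with the same jump sets\<close>

context filtered_group
begin

text \<open>Each graded piece contributes at most p classes; finiteness of the quotients is the
  input of the compactness argument.\<close>

lemma finite_representatives: "\<exists>R. finite R \<and> R \<subseteq> carrier G \<and> (\<forall>x\<in>carrier G. \<exists>r\<in>R. cong_mod k x r)"
proof (induction k)
  case 0
  then show ?case by (intro exI[of _ "{\<one>}"]) (auto simp: cong_one_iff U_0)
next
  case (Suc k)
  then obtain R where R: "finite R" "R \<subseteq> carrier G" "\<And>x. x \<in> carrier G \<Longrightarrow> \<exists>r\<in>R. cong_mod k x r" by blast
  show ?case
  proof (cases "k = 0")
    case True
    then show ?thesis by (intro exI[of _ "{\<one>}"]) (auto simp: cong_one_iff U_1)
  next
    case False
    then have k: "1 \<le> k" by simp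
    obtain y where y: "y \<in> U k - U (Suc k)" using U_strict k by blast
    then have yc: "y \<in> carrier G" using U_carrier by blast
    define R' where "R' = (\<lambda>(r, n). r \<otimes> y [^] int n) ` (R \<times> {..<p})"
    have "\<exists>r\<in>R'. cong_mod (Suc k) x r" if x: "x \<in> carrier G" for x
    proof -
      obtain r where r: "r \<in> R" "cong_mod k x r" using R(3) x by blast
      then have rc: "r \<in> carrier G" using R(2) by blast
      obtain n :: int where n: "(x \<otimes> inv r) \<otimes> inv (y [^] n) \<in> U (Suc k)"
        using U_cyclic[OF k y] r(2) by (auto simp: cong_mod_def)
      define n' where "n' = nat (n mod int p)"
      have n': "int n' = n mod int p" "n' < p" using p_ge_2 by (auto simp: n'_def nat_less_iff)
      have "y [^] int p \<in> U (Suc k)" using U_pow_Suc[OF k] y by (simp add: int_pow_int)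
      then have "(y [^] int p) [^] (n div int p) \<in> U (Suc k)" by (rule U_int_pow)
      moreover have "y [^] n = y [^] int n' \<otimes> (y [^] int p) [^] (n div int p)"
        using yc n' by (simp add: int_pow_pow flip: int_pow_mult)
      ultimately have "cong_mod (Suc k) (y [^] n) (y [^] int n')"
        using yc by (simp add: cong_mod_def m_comm m_assoc) (simp flip: m_assoc)
      moreover have "cong_mod (Suc k) (x \<otimes> inv r) (y [^] n)" using n x rc yc by (simp add: cong_mod_def)
      ultimately have "cong_mod (Suc k) (x \<otimes> inv r) (y [^] int n')" using cong_trans by blast
      then have "cong_mod (Suc k) (r \<otimes> (x \<otimes> inv r)) (r \<otimes> y [^] int n')"
        using rc by (intro cong_mult cong_refl)
      then have "cong_mod (Suc k) x (r \<otimes> y [^] int n')"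
        using x rc m_lcomm[of r x "inv r"] by simp
      moreover have "r \<otimes> y [^] int n' \<in> R'" using r n'(2) unfolding R'_def by (intro image_eqI[of _ _ "(r, n')"]) auto
      ultimately show ?thesis by blast
    qed
    moreover have "finite R'" "R' \<subseteq> carrier G" using R yc by (auto simp: R'_def)
    ultimately show ?thesis by blast
  qed
qed

text \<open>Sequential compactness of a finite power of the group. The bound m \<ge> k matters in
  the application, where properties of \<open>Y m\<close> are known only up to level m.\<close>

lemma diagonal_limit:
  assumes Y: "\<And>m i. i \<in> T \<Longrightarrow> Y m i \<in> carrier G"
  shows "\<exists>y. (\<forall>i\<in>T. y i \<in> carrier G) \<and> (\<forall>k. \<exists>m\<ge>k. \<forall>i\<in>T. cong_mod k (Y m i) (y i))"
proof -
  \<comment> \<open>The indices m at which \<open>Y m\<close> agrees with z modulo level k. The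
    pigeonhole principle keeps these sets infinite, so arbitrarily large m stay available.\<close>
  define S where "S = (\<lambda>k z. {m::nat. \<forall>i\<in>T. cong_mod k (Y m i) (z i)})"
  have step: "\<exists>z'. infinite (S (Suc k) z') \<and> (\<forall>i\<in>T. cong_mod k (z' i) (z i))" if inf: "infinite (S k z)" for k z
  proof -
    obtain R where R: "finite R" "\<And>x. x \<in> carrier G \<Longrightarrow> \<exists>r\<in>R. cong_mod (Suc k) x r"
      using finite_representatives[of "Suc k"] by blast
    define c where "c = (\<lambda>x. SOME r. r \<in> R \<and> cong_mod (Suc k) x r)"
    have c: "c x \<in> R \<and> cong_mod (Suc k) x (c x)" if "x \<in> carrier G" for x
      unfolding c_def by (rule someI_ex) (use R(2)[OF that] in blast)
    define f where "f = (\<lambda>m. restrict (\<lambda>i. c (Y m i)) T)"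
    have "f ` S k z \<subseteq> T \<rightarrow>\<^sub>E R" using c Y by (auto simp: f_def)
    then have fin: "finite (f ` S k z)" using finite_PiE[of T "\<lambda>_. R"] R(1) finite_subset by auto
    obtain z' where z': "infinite {m \<in> S k z. f m = z'}"
      using pigeonhole_infinite[OF inf fin] by blast
    have "cong_mod (Suc k) (Y m i) (z' i)" if "m \<in> S k z" "f m = z'" "i \<in> T" for m i
      using c[OF Y[OF that(3)], of m] that by (auto simp: f_def)
    then have "{m \<in> S k z. f m = z'} \<subseteq> S (Suc k) z'" by (auto simp: S_def)
    then have inf': "infinite (S (Suc k) z')" using z' finite_subset by blast
    have "\<forall>i\<in>T. cong_mod k (z' i) (z i)"
    proof
      fix i assume i: "i \<in> T"
      obtain m where m: "m \<in> S k z" "f m = z'"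
        using infinite_imp_nonempty[OF z'] by blast
      then have "cong_mod (Suc k) (Y m i) (z' i)" using c[OF Y[OF i], of m] i by (auto simp: f_def)
      then have "cong_mod k (z' i) (Y m i)" using cong_mono cong_sym by (meson le_SucI order_refl)
      moreover have "cong_mod k (Y m i) (z i)" using m i by (simp add: S_def)
      ultimately show "cong_mod k (z' i) (z i)" by (rule cong_trans)
    qed
    then show ?thesis using inf' by blast
  qed
  have "infinite (S 0 (\<lambda>_. \<one>))" using Y by (simp add: S_def cong_one_iff U_0)
  then obtain z where z: "\<And>k. infinite (S k (z k))" "\<And>k. \<forall>i\<in>T. cong_mod k (z (Suc k) i) (z k i)"
    using dependent_nat_choice[of "\<lambda>k z. infinite (S k z)" "\<lambda>k z z'. \<forall>i\<in>T. cong_mod k (z' i) (z i)"] step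
    by metis
  have "\<exists>y\<in>carrier G. \<forall>k. y \<otimes> inv (z k i) \<in> U k" if "i \<in> T" for i
    using z(2) that by (intro U_complete) (auto simp: cong_mod_def)
  then obtain y where y: "\<And>i. i \<in> T \<Longrightarrow> y i \<in> carrier G \<and> (\<forall>k. y i \<otimes> inv (z k i) \<in> U k)" by metis
  have "\<exists>m\<ge>k. \<forall>i\<in>T. cong_mod k (Y m i) (y i)" for k
  proof -
    obtain m where m: "k \<le> m" "m \<in> S k (z k)" using z(1)[of k] by (meson infinite_nat_iff_unbounded_le)
    have "cong_mod k (Y m i) (y i)" if "i \<in> T" for i
    proof -
      have *: "cong_mod k (Y m i) (z k i)" using m that by (simp add: S_def)
      have "cong_mod k (y i) (z k i)" using y that * by (auto simp: cong_mod_def)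
      then show ?thesis using * cong_sym cong_trans by blast
    qed
    then show ?thesis using m by blast
  qed
  then show ?thesis using y by blast
qed

end

section \<open>Transfer between two filtered groups with the same shift\<close>

locale two_filtered_groups =
  G: filtered_group G U p a + H: filtered_group H V p a
  for G :: "('g, 'm) monoid_scheme" and U and H :: "('h, 'k) monoid_scheme" and V and p a :: nat
begin

abbreviation T :: "nat set" where "T \<equiv> G.T"

text \<open>Up to level m, membership in \<open>U k\<close> depends only on \<open>W\<close>, which
  is the same for both groups, and on the common relation v: an exponent vector with product in
  \<open>U k\<close> is one from \<open>W k\<close> plus one that is trivial modulo level m.\<close>

lemma E_transfer:
  assumes \<eta>: "G.generators \<eta>" and \<theta>: "H.generators \<theta>" and m: "1 \<le> m"
    and v: "v G.t = int p ^ Suc G.s * 1" "\<And>j. j \<in> T \<Longrightarrow> j \<noteq> G.t \<Longrightarrow> int p ^ G.L j (Suc (p * a)) dvd v j"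
    and rel: "G.E \<eta> v \<in> U m" "H.E \<theta> v \<in> V m"
    and k: "1 \<le> k" "k \<le> m" and c: "G.E \<eta> c \<in> U k"
  shows "H.E \<theta> c \<in> V k"
proof -
  note \<eta>c = G.generators_carrier[OF \<eta>] and \<theta>c = H.generators_carrier[OF \<theta>]
  have p1: "\<not> int p dvd 1" using G.p_ge_2 by auto
  have top: "H.E \<theta> d \<in> V m" if d: "G.E \<eta> d \<in> U m" for d
  proof -
    obtain z where z: "(\<lambda>j. d j - z * v j) \<in> G.W m"
      using G.E_relation[OF \<eta> m rel(1) d p1 v] by blast
    then have "H.E \<theta> (\<lambda>j. d j - z * v j) \<in> V m"
      by (intro H.E_mem[OF \<theta>]) (simp add: G.W_def H.W_def)
    moreover have "H.E \<theta> (\<lambda>j. z * v j) \<in> V m"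
      using rel(2) \<theta>c by (simp add: H.E_scale H.U_int_pow)
    ultimately have "H.E \<theta> (\<lambda>j. (d j - z * v j) + z * v j) \<in> V m"
      using \<theta>c by (simp only: H.E_add H.U_mult)
    then show ?thesis by simp
  qed
  obtain c' where c': "c' \<in> G.W k" "G.cong_mod m (G.E \<eta> c) (G.E \<eta> c')"
    using G.E_surj[OF \<eta> k c] by blast
  then have "H.E \<theta> c' \<in> V k" by (intro H.E_mem[OF \<theta>]) (simp add: G.W_def H.W_def)
  moreover have "G.E \<eta> (\<lambda>j. c j - c' j) \<in> U m" using c'(2) \<eta>c by (simp add: G.E_diff G.cong_mod_def)
  then have "H.E \<theta> (\<lambda>j. c j - c' j) \<in> V k" using top H.U_antimono[OF k(2)] by blast
  ultimately have "H.E \<theta> (\<lambda>j. (c j - c' j) + c' j) \<in> V k"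
    using \<theta>c by (simp only: H.E_add H.U_mult)
  then show ?thesis by simp
qed

text \<open>The adapted generators depend on m, so \<open>\<eta>\<close> is fixed in advance and
  only its image is recorded: \<open>\<eta>\<close> is written modulo level m through adapted
  generators of G, and the same exponents are applied to those of H.\<close>

lemma level_generators:
  assumes P: "prufer_group P p g" and J: "G.J P = H.J P" and m: "p * a < m" and \<eta>: "G.generators \<eta>"
  shows "\<exists>y. (\<forall>i\<in>T. y i \<in> carrier H) \<and> (\<forall>k\<le>m. \<forall>c. G.E \<eta> c \<in> U k \<longleftrightarrow> H.E y c \<in> V k)"
proof -
  interpret sym: two_filtered_groups H V G U p a by unfold_locales
  define v where "v = G.normal_form (G.J P) m"
  have v_H: "v = G.normal_form (H.J P) m" by (simp add: v_def J)
  obtain \<eta>' where \<eta>': "G.generators \<eta>'" "G.E \<eta>' v \<in> U m"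
    using G.normal_generators_exist[OF P m] by (auto simp: v_def)
  obtain \<theta> where \<theta>: "H.generators \<theta>" "H.E \<theta> v \<in> V m"
    using H.normal_generators_exist[OF P m] by (auto simp: v_H)
  have m1: "1 \<le> m" using m by simp
  note v = G.normal_form_relation[OF P m, folded v_def]
  note car = G.generators_carrier[OF \<eta>] G.generators_carrier[OF \<eta>'(1)] H.generators_carrier[OF \<theta>(1)]
  have iff: "G.E \<eta>' c \<in> U k \<longleftrightarrow> H.E \<theta> c \<in> V k" if "k \<le> m" for k c
  proof (cases "k = 0")
    case True
    then show ?thesis using car by (simp add: G.U_0 H.U_0)
  next
    case False
    then have "1 \<le> k" by simp
    then show ?thesis
      using E_transfer[OF \<eta>'(1) \<theta>(1) m1 v \<eta>'(2) \<theta>(2) _ that] sym.E_transfer[OF \<theta>(1) \<eta>'(1) m1 v \<theta>(2) \<eta>'(2) _ that]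
      by blast
  qed
  have "\<exists>c. G.cong_mod m (\<eta> i) (G.E \<eta>' c)" if "i \<in> T" for i
    using G.E_surj[OF \<eta>'(1), of "Suc 0" m "\<eta> i"] car(1)[OF that] m1 by (auto simp: G.U_1)
  then obtain C where C: "\<And>i. i \<in> T \<Longrightarrow> G.cong_mod m (\<eta> i) (G.E \<eta>' (C i))" by metis
  define y where "y = (\<lambda>i. H.E \<theta> (C i))"
  have "G.E \<eta> c \<in> U k \<longleftrightarrow> H.E y c \<in> V k" if "k \<le> m" for k c
  proof -
    have "G.cong_mod m (G.E \<eta> c) (G.E (\<lambda>i. G.E \<eta>' (C i)) c)" using C by (rule G.cong_E)
    then have "G.E \<eta> c \<in> U k \<longleftrightarrow> G.E (\<lambda>i. G.E \<eta>' (C i)) c \<in> U k" using that by (rule G.cong_mem_iff)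
    also have "\<dots> \<longleftrightarrow> G.E \<eta>' (\<lambda>j. \<Sum>i\<in>T. c i * C i j) \<in> U k" using car by (subst G.E_E) auto
    also have "\<dots> \<longleftrightarrow> H.E \<theta> (\<lambda>j. \<Sum>i\<in>T. c i * C i j) \<in> V k" using that by (rule iff)
    also have "\<dots> \<longleftrightarrow> H.E y c \<in> V k" unfolding y_def using car by (subst H.E_E) auto
    finally show ?thesis .
  qed
  moreover have "y i \<in> carrier H" if "i \<in> T" for i using car by (simp add: y_def)
  ultimately show ?thesis by blast
qed

text \<open>The equivalence at level k involves y only modulo \<open>V k\<close>, so it survives the
  passage to a limit point.\<close>

lemma limit_generators:
  assumes P: "prufer_group P p g" and J: "G.J P = H.J P" and \<eta>: "G.generators \<eta>"
  shows "\<exists>y. (\<forall>i\<in>T. y i \<in> carrier H) \<and> (\<forall>k c. G.E \<eta> c \<in> U k \<longleftrightarrow> H.E y c \<in> V k)"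
proof -
  have "\<exists>y. (\<forall>i\<in>T. y i \<in> carrier H) \<and> (\<forall>k\<le>m. \<forall>c. G.E \<eta> c \<in> U k \<longleftrightarrow> H.E y c \<in> V k)" for m
  proof -
    \<comment> \<open>\<open>level_generators\<close> needs a level above p * a; a smaller m
      inherits the claim from a larger one.\<close>
    have "p * a < max m (Suc (p * a))" by linarith
    then obtain y where y: "\<forall>i\<in>T. y i \<in> carrier H"
      "\<forall>k\<le>max m (Suc (p * a)). \<forall>c. G.E \<eta> c \<in> U k \<longleftrightarrow> H.E y c \<in> V k"
      using level_generators[OF P J _ \<eta>] by meson
    have "k \<le> max m (Suc (p * a))" if "k \<le> m" for k using that by linarith
    then have "\<forall>k\<le>m. \<forall>c. G.E \<eta> c \<in> U k \<longleftrightarrow> H.E y c \<in> V k" using y(2) by presburger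
    then show ?thesis using y(1) by (intro exI[of _ y] conjI)
  qed
  then obtain Y where Y: "\<And>m i. i \<in> T \<Longrightarrow> Y m i \<in> carrier H"
      "\<And>m k c. k \<le> m \<Longrightarrow> G.E \<eta> c \<in> U k \<longleftrightarrow> H.E (Y m) c \<in> V k"
    by metis
  obtain y where y: "\<forall>i\<in>T. y i \<in> carrier H" "\<And>k. \<exists>m\<ge>k. \<forall>i\<in>T. H.cong_mod k (Y m i) (y i)"
    using H.diagonal_limit[of Y] Y(1) by blast
  have "G.E \<eta> c \<in> U k \<longleftrightarrow> H.E y c \<in> V k" for k c
  proof -
    obtain m where m: "k \<le> m" "\<forall>i\<in>T. H.cong_mod k (Y m i) (y i)" using y(2) by blast
    then have "H.cong_mod k (H.E (Y m) c) (H.E y c)" by (intro H.cong_E) blast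
    then show ?thesis using Y(2)[OF m(1)] H.cong_mem_iff by blast
  qed
  then show ?thesis using y(1) by blast
qed

text \<open>Products with integer exponents are dense in G. An element x approximated by such
  products over \<open>\<eta>\<close> is sent to the limit of the products over y with the same
  exponents; the equivalence of memberships makes this well defined, injective and strict for the
  filtration.\<close>

theorem filtered_iso_exists:
  assumes P: "prufer_group P p g" and J: "G.J P = H.J P"
  shows "\<exists>\<phi>\<in>iso G H. \<forall>k. \<phi> ` U k = V k"
proof -
  obtain \<eta> where \<eta>: "G.generators \<eta>" using G.generators_exist by blast
  obtain y where y: "\<And>i. i \<in> T \<Longrightarrow> y i \<in> carrier H" and iff: "\<And>k c. G.E \<eta> c \<in> U k \<longleftrightarrow> H.E y c \<in> V k"
    using limit_generators[OF P J \<eta>] by blast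
  note car = G.generators_carrier[OF \<eta>]
  have ex: "\<exists>c. G.cong_mod n x (G.E \<eta> c)" if "x \<in> carrier G" for x n
  proof (cases "n = 0")
    case True
    then show ?thesis using that car by (intro exI[of _ "\<lambda>_. 0"]) (simp add: G.cong_mod_def G.U_0)
  next
    case False
    then show ?thesis using G.E_surj[OF \<eta>, of "Suc 0" n x] that by (auto simp: G.U_1)
  qed
  have transfer: "H.cong_mod n (H.E y c) (H.E y d)" if "G.cong_mod n (G.E \<eta> c) (G.E \<eta> d)" for n c d
  proof -
    have "G.E \<eta> (\<lambda>j. c j - d j) \<in> U n" using that car by (simp add: G.E_diff G.cong_mod_def)
    then have "H.E y (\<lambda>j. c j - d j) \<in> V n" using iff by blast
    then show ?thesis using y by (simp add: H.E_diff H.cong_mod_def)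
  qed
  \<comment> \<open>The image is characterised by all approximations of x at once, which avoids any
    dependence on a chosen sequence.\<close>
  define Q where "Q = (\<lambda>x z. z \<in> carrier H \<and>
    (\<forall>n c. G.cong_mod n x (G.E \<eta> c) \<longrightarrow> H.cong_mod n z (H.E y c)))"
  have "\<exists>z. Q x z" if x: "x \<in> carrier G" for x
  proof -
    obtain c where c: "\<And>n. G.cong_mod n x (G.E \<eta> (c n))" using ex[OF x] by metis
    have "H.cong_mod n (H.E y (c (Suc n))) (H.E y (c n))" for n
      using c[of n] G.cong_mono[OF c[of "Suc n"], of n] G.cong_sym G.cong_trans by (intro transfer) (meson le_SucI order_refl)
    then have "\<exists>z\<in>carrier H. \<forall>n. z \<otimes>\<^bsub>H\<^esub> inv\<^bsub>H\<^esub> (H.E y (c n)) \<in> V n"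
      by (intro H.U_complete) (auto simp: H.cong_mod_def)
    then obtain z where z: "z \<in> carrier H" "\<And>n. H.cong_mod n z (H.E y (c n))"
      using y by (auto simp: H.cong_mod_def)
    have "H.cong_mod n z (H.E y d)" if "G.cong_mod n x (G.E \<eta> d)" for n d
      using transfer[of n "c n" d] z(2)[of n] that c[of n] G.cong_sym G.cong_trans H.cong_trans by blast
    then show ?thesis using z by (auto simp: Q_def)
  qed
  then obtain \<phi> where \<phi>: "\<And>x. x \<in> carrier G \<Longrightarrow> Q x (\<phi> x)" by metis
  have \<phi>_closed: "\<phi> x \<in> carrier H" if "x \<in> carrier G" for x using \<phi>[OF that] by (simp add: Q_def)
  have \<phi>_cong: "H.cong_mod n (\<phi> x) (H.E y c)" if "x \<in> carrier G" "G.cong_mod n x (G.E \<eta> c)" for n x c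
    using \<phi>[OF that(1)] that(2) by (simp add: Q_def)
  have eqI: "z = z'" if z: "z \<in> carrier H" "z' \<in> carrier H" "\<And>n. H.cong_mod n z z'" for z z'
  proof -
    have "z \<otimes>\<^bsub>H\<^esub> inv\<^bsub>H\<^esub> z' = \<one>\<^bsub>H\<^esub>" using z(3) by (intro H.U_separated) (simp add: H.cong_mod_def)
    then show ?thesis using z(1,2) H.inv_equality[of z "inv\<^bsub>H\<^esub> z'"] by simp
  qed
  have hom: "\<phi> \<in> hom G H"
  proof (rule homI)
    fix x x' assume x: "x \<in> carrier G" "x' \<in> carrier G"
    show "\<phi> (x \<otimes>\<^bsub>G\<^esub> x') = \<phi> x \<otimes>\<^bsub>H\<^esub> \<phi> x'"
    proof (rule eqI)
      fix n
      obtain c c' where c: "G.cong_mod n x (G.E \<eta> c)" "G.cong_mod n x' (G.E \<eta> c')" using ex x by metis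
      have "G.cong_mod n (x \<otimes>\<^bsub>G\<^esub> x') (G.E \<eta> (\<lambda>j. c j + c' j))"
        using G.cong_mult[OF c] car by (simp add: G.E_add)
      then have "H.cong_mod n (\<phi> (x \<otimes>\<^bsub>G\<^esub> x')) (H.E y c \<otimes>\<^bsub>H\<^esub> H.E y c')"
        using \<phi>_cong[of "x \<otimes>\<^bsub>G\<^esub> x'"] x y by (simp flip: H.E_add)
      moreover have "H.cong_mod n (\<phi> x \<otimes>\<^bsub>H\<^esub> \<phi> x') (H.E y c \<otimes>\<^bsub>H\<^esub> H.E y c')"
        using \<phi>_cong x c by (intro H.cong_mult) auto
      ultimately show "H.cong_mod n (\<phi> (x \<otimes>\<^bsub>G\<^esub> x')) (\<phi> x \<otimes>\<^bsub>H\<^esub> \<phi> x')"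
        using H.cong_sym H.cong_trans by blast
    qed (use x \<phi>_closed in auto)
  qed (rule \<phi>_closed)
  interpret group_hom G H \<phi>
    using hom by (simp add: group_hom_def group_hom_axioms_def G.is_group H.is_group)
  have mem_iff: "x \<in> U k \<longleftrightarrow> \<phi> x \<in> V k" if x: "x \<in> carrier G" for x k
  proof -
    obtain c where c: "G.cong_mod k x (G.E \<eta> c)" using ex x by blast
    then show ?thesis
      using G.cong_mem_iff[OF c order_refl] H.cong_mem_iff[OF \<phi>_cong[OF x c] order_refl] iff by simp
  qed
  have inj: "inj_on \<phi> (carrier G)"
    unfolding inj_on_one_iff using mem_iff G.U_separated H.U_one by metis
  \<comment> \<open>Surjectivity on graded pieces: an element of exact level k has an image of exact
    level k, which generates the piece at k. Completeness of G then turns this into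
    surjectivity.\<close>
  have approx: "\<exists>x\<in>U k. H.cong_mod (Suc k) z (\<phi> x)" if z: "z \<in> V k" for z k
  proof (cases "k = 0")
    case True
    then show ?thesis using z H.U_1 H.U_carrier by (intro bexI[of _ "\<one>\<^bsub>G\<^esub>"]) (auto simp: H.cong_one_iff)
  next
    case False
    then have k: "1 \<le> k" by simp
    obtain x where x: "x \<in> U k - U (Suc k)" using G.U_strict k by blast
    then have xc: "x \<in> carrier G" using G.U_carrier by blast
    then have "\<phi> x \<in> V k - V (Suc k)" using x mem_iff by blast
    then obtain n :: int where "z \<otimes>\<^bsub>H\<^esub> inv\<^bsub>H\<^esub> (\<phi> x [^]\<^bsub>H\<^esub> n) \<in> V (Suc k)" using H.U_cyclic k z by blast
    then have "H.cong_mod (Suc k) z (\<phi> (x [^]\<^bsub>G\<^esub> n))"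
      using xc H.U_carrier[OF z] by (simp add: H.cong_mod_def hom_int_pow)
    then show ?thesis using x G.U_int_pow by blast
  qed
  have surj: "\<exists>x\<in>carrier G. z = \<phi> x" if z: "z \<in> carrier H" for z
  proof -
    have step: "\<exists>x'. (x' \<in> carrier G \<and> H.cong_mod (Suc n) z (\<phi> x')) \<and> x' \<otimes>\<^bsub>G\<^esub> inv\<^bsub>G\<^esub> x \<in> U n"
      if x: "x \<in> carrier G" "H.cong_mod n z (\<phi> x)" for x n
    proof -
      have "z \<otimes>\<^bsub>H\<^esub> inv\<^bsub>H\<^esub> (\<phi> x) \<in> V n" using x by (simp add: H.cong_mod_def)
      then obtain w where w: "w \<in> U n" "H.cong_mod (Suc n) (z \<otimes>\<^bsub>H\<^esub> inv\<^bsub>H\<^esub> (\<phi> x)) (\<phi> w)"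
        using approx by blast
      then have wc: "w \<in> carrier G" using G.U_carrier by blast
      have "H.cong_mod (Suc n) (z \<otimes>\<^bsub>H\<^esub> inv\<^bsub>H\<^esub> (\<phi> x) \<otimes>\<^bsub>H\<^esub> \<phi> x) (\<phi> w \<otimes>\<^bsub>H\<^esub> \<phi> x)"
        using w x by (intro H.cong_mult H.cong_refl) auto
      then have "H.cong_mod (Suc n) z (\<phi> (w \<otimes>\<^bsub>G\<^esub> x))" using x z wc by (simp add: H.m_assoc)
      moreover have "(w \<otimes>\<^bsub>G\<^esub> x) \<otimes>\<^bsub>G\<^esub> inv\<^bsub>G\<^esub> x \<in> U n" using w wc x by (simp add: G.m_assoc)
      ultimately show ?thesis using wc x by blast
    qed
    have "\<exists>\<xi>. \<forall>n. (\<xi> n \<in> carrier G \<and> H.cong_mod n z (\<phi> (\<xi> n))) \<and> \<xi> (Suc n) \<otimes>\<^bsub>G\<^esub> inv\<^bsub>G\<^esub> (\<xi> n) \<in> U n"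
    proof (rule dependent_nat_choice)
      show "\<exists>x. x \<in> carrier G \<and> H.cong_mod 0 z (\<phi> x)"
        using z by (intro exI[of _ "\<one>\<^bsub>G\<^esub>"]) (simp add: H.cong_one_iff H.U_0)
    qed (use step in blast)
    then obtain \<xi> where \<xi>: "\<And>n. \<xi> n \<in> carrier G \<and> H.cong_mod n z (\<phi> (\<xi> n))"
        "\<And>n. \<xi> (Suc n) \<otimes>\<^bsub>G\<^esub> inv\<^bsub>G\<^esub> (\<xi> n) \<in> U n"
      by blast
    obtain x where x: "x \<in> carrier G" "\<And>n. x \<otimes>\<^bsub>G\<^esub> inv\<^bsub>G\<^esub> (\<xi> n) \<in> U n"
      using G.U_complete[of \<xi>] \<xi> by blast
    have "H.cong_mod n z (\<phi> x)" for n
    proof -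
      have \<xi>n: "\<xi> n \<in> carrier G" using \<xi> by blast
      then have "\<phi> (x \<otimes>\<^bsub>G\<^esub> inv\<^bsub>G\<^esub> (\<xi> n)) \<in> V n" using mem_iff x by blast
      then have "H.cong_mod n (\<phi> x) (\<phi> (\<xi> n))" using x \<xi>n by (simp add: H.cong_mod_def)
      then show ?thesis using \<xi> H.cong_sym H.cong_trans by blast
    qed
    then show ?thesis using x z eqI[of z "\<phi> x"] by auto
  qed
  have "\<phi> ` U k = V k" for k
  proof (intro equalityI subsetI)
    fix z assume "z \<in> \<phi> ` U k"
    then show "z \<in> V k" using mem_iff G.U_carrier by blast
  next
    fix z assume "z \<in> V k"
    then show "z \<in> \<phi> ` U k" using surj[OF H.U_carrier] mem_iff by blast
  qed
  moreover have "\<phi> ` carrier G = carrier H" using surj by auto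
  then have "\<phi> \<in> iso G H" using hom inj by (simp add: iso_def bij_betw_def)
  ultimately show ?thesis by blast
qed

end

text \<open>The jump sets of order-\<open>p\<close> characters determine \<open>a\<close>.\<close>

theorem filtered_groups_iso:
  assumes "filtered_group G U p a" "filtered_group H V p a'" and P: "prufer_group P p g"
    and J: "filtered_group.J G U P = filtered_group.J H V P"
  shows "\<exists>\<phi>\<in>iso G H. \<forall>k. \<phi> ` U k = V k"
proof -
  have "a' = a"
  proof -
    interpret G: filtered_group G U p a by fact
    interpret H: filtered_group H V p a' by fact
    have "G.T = H.T" using G.T_eq_J[OF P] H.T_eq_J[OF P] J by simp
    then have "p * a = p * a'" using G.Max_T H.Max_T by (simp only:)
    moreover have "p \<noteq> 0" using G.p_ge_2 by linarith
    ultimately show ?thesis by simp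
  qed
  then have "two_filtered_groups G U H V p a" using assms(1,2) by (simp add: two_filtered_groups_def)
  then show ?thesis using two_filtered_groups.filtered_iso_exists[OF _ P J] by blast
qed

section \<open>The p-adic numbers as a completion\<close>

locale padic =
  fixes p :: nat
  assumes prime_p: "Factorial_Ring.prime p"
begin

lemma p_ge_2: "2 \<le> p"
  using prime_p prime_ge_2_nat by blast

lemma prime_elem_p: "prime_elem (int p)"
  using prime_p by simp

lemma not_unit_p: "\<not> is_unit (int p)"
  using p_ge_2 by simp

section \<open>The p-adic valuation on the rationals\<close>

lemma padic_val_divide:
  assumes "c \<noteq> 0" "d \<noteq> 0"
  shows "padic_val p (of_int c / of_int d) = int (multiplicity (int p) c) - int (multiplicity (int p) d)"
proof -
  obtain m n where mn: "quotient_of (of_int c / of_int d) = (m, n)" by fastforce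
  then have eq: "(of_int c / of_int d :: rat) = of_int m / of_int n" by (rule quotient_of_div)
  have n: "0 < n" using quotient_of_denom_pos[OF mn] .
  have "(of_int (c * n) :: rat) = of_int (m * d)" using eq assms n by (simp add: field_simps)
  then have cn: "c * n = m * d" by (simp only: of_int_eq_iff)
  then have m: "m \<noteq> 0" using assms n by auto
  have "multiplicity (int p) (c * n) = multiplicity (int p) (m * d)" using cn by simp
  then have "multiplicity (int p) c + multiplicity (int p) n = multiplicity (int p) m + multiplicity (int p) d"
    using assms n m by (simp add: prime_elem_multiplicity_mult_distrib[OF prime_elem_p])
  then show ?thesis using mn by (simp add: padic_val_def)
qed

lemma padic_val_of_int: "c \<noteq> 0 \<Longrightarrow> padic_val p (of_int c) = int (multiplicity (int p) c)"
  using padic_val_divide[of c 1] by simp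

lemma rat_cases:
  fixes x :: rat
  assumes "x \<noteq> 0"
  obtains c d where "c \<noteq> 0" "d \<noteq> 0" "x = of_int c / of_int d"
proof -
  obtain c d where cd: "quotient_of x = (c, d)" by fastforce
  then have "x = of_int c / of_int d" "d > 0" by (auto intro: quotient_of_div quotient_of_denom_pos)
  then show ?thesis using that[of c d] assms by auto
qed

lemma padic_val_mult: "x \<noteq> 0 \<Longrightarrow> y \<noteq> 0 \<Longrightarrow> padic_val p (x * y) = padic_val p x + padic_val p y"
proof -
  assume "x \<noteq> 0" "y \<noteq> 0"
  then obtain c d c' d' where *: "c \<noteq> 0" "d \<noteq> 0" "x = of_int c / of_int d"
    "c' \<noteq> 0" "d' \<noteq> 0" "y = of_int c' / of_int d'" by (metis rat_cases)
  then have xy: "x * y = of_int (c * c') / of_int (d * d')" by simp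
  show ?thesis
    unfolding xy unfolding *(3,6) using *(1,2,4,5)
    by (simp add: padic_val_divide prime_elem_multiplicity_mult_distrib[OF prime_elem_p] del: of_int_mult)
qed

lemma padic_val_add: "x \<noteq> 0 \<Longrightarrow> y \<noteq> 0 \<Longrightarrow> x + y \<noteq> 0 \<Longrightarrow> min (padic_val p x) (padic_val p y) \<le> padic_val p (x + y)"
proof -
  assume "x \<noteq> 0" "y \<noteq> 0" and nz: "x + y \<noteq> 0"
  then obtain c d c' d' where *: "c \<noteq> 0" "d \<noteq> 0" "x = of_int c / of_int d"
    "c' \<noteq> 0" "d' \<noteq> 0" "y = of_int c' / of_int d'" by (metis rat_cases)
  define m n D where "m = c * d'" and "n = c' * d" and "D = d * d'"
  have x: "x = of_int m / of_int D" and y: "y = of_int n / of_int D" and xy: "x + y = of_int (m + n) / of_int D"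
    using * by (simp_all add: m_def n_def D_def field_simps)
  have nz': "m \<noteq> 0" "n \<noteq> 0" "D \<noteq> 0" "m + n \<noteq> 0"
    using * nz xy by (simp_all add: m_def n_def D_def) (metis of_int_0 of_int_add of_int_mult)
  define k where "k = min (multiplicity (int p) m) (multiplicity (int p) n)"
  have "int p ^ k dvd m" "int p ^ k dvd n" by (auto simp: k_def intro: multiplicity_dvd')
  then have "int p ^ k dvd m + n" by simp
  then have "k \<le> multiplicity (int p) (m + n)" using nz' not_unit_p by (intro multiplicity_geI) auto
  then show ?thesis unfolding xy unfolding x y using nz' by (simp add: padic_val_divide k_def del: of_int_add)
qed

abbreviation B :: "int \<Rightarrow> rat set" where "B k \<equiv> vball (rat_padic p) k"

lemma B_iff: "x \<in> B k \<longleftrightarrow> x = 0 \<or> k \<le> padic_val p x"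
  by (simp add: vball_def rat_padic_def)

lemma B_0 [simp]: "0 \<in> B k"
  by (simp add: B_iff)

lemma B_add: "x \<in> B k \<Longrightarrow> y \<in> B k \<Longrightarrow> x + y \<in> B k"
  using padic_val_add[of x y] by (fastforce simp: B_iff)

lemma B_mult: "x \<in> B k \<Longrightarrow> y \<in> B l \<Longrightarrow> x * y \<in> B (k + l)"
  using padic_val_mult[of x y] by (auto simp: B_iff)

lemma B_of_int: "of_int c \<in> B k" if "k \<le> 0"
  using that padic_val_of_int[of c] by (auto simp: B_iff)

lemma B_uminus: "x \<in> B k \<Longrightarrow> - x \<in> B k"
  using B_mult[OF B_of_int[of 0 "-1"], of x k] by simp

lemma B_diff: "x \<in> B k \<Longrightarrow> y \<in> B k \<Longrightarrow> x - y \<in> B k"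
  using B_add[OF _ B_uminus, of x k y] by simp

lemma B_antimono: "k \<le> l \<Longrightarrow> x \<in> B l \<Longrightarrow> x \<in> B k"
  by (auto simp: B_iff)

lemma of_int_in_B_iff: "of_int c \<in> B (int k) \<longleftrightarrow> int p ^ k dvd c"
proof (cases "c = 0")
  case False
  then show ?thesis
    using power_dvd_iff_le_multiplicity[of c "int p" k] not_unit_p
    by (simp add: B_iff padic_val_of_int)
qed simp

lemma p_powi_mem: "1 / of_nat p ^ n \<in> B (- int n)"
  using padic_val_divide[of 1 "int p ^ n"] p_ge_2 prime_p
  by (simp add: B_iff multiplicity_same_power)

lemma fraction_in_B_0_iff: "of_int c / of_nat p ^ n \<in> B 0 \<longleftrightarrow> int p ^ n dvd c"
proof
  assume "of_int c / of_nat p ^ n \<in> B 0"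
  then have "of_int c / of_nat p ^ n * of_int (int p ^ n) \<in> B (0 + int n)"
    by (intro B_mult) (simp_all only: of_int_in_B_iff dvd_refl)
  then have "of_int c \<in> B (int n)" using p_ge_2 by simp
  then show "int p ^ n dvd c" by (simp only: of_int_in_B_iff)
next
  assume "int p ^ n dvd c"
  then obtain d where "c = int p ^ n * d" by blast
  then have "of_int c / of_nat p ^ n = (of_int d :: rat)" using p_ge_2 by simp
  then show "of_int c / of_nat p ^ n \<in> B 0" using B_of_int[of 0 d] by simp
qed

text \<open>In lowest terms the denominator is prime to p, so it can be inverted modulo p^k.\<close>

lemma approx_int:
  assumes "x \<in> B 0"
  shows "\<exists>n::nat. x - of_nat n \<in> B (int k)"
proof (cases "x = 0")
  case True
  then show ?thesis by (intro exI[of _ 0]) simp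
next
  case False
  obtain c d where cd: "quotient_of x = (c, d)" by fastforce
  then have x: "x = of_int c / of_int d" and d: "d > 0" and co: "coprime c d"
    by (auto intro: quotient_of_div quotient_of_denom_pos quotient_of_coprime)
  have c: "c \<noteq> 0" using x False by auto
  have "multiplicity (int p) d \<le> multiplicity (int p) c"
    using assms False c d padic_val_divide[of c d] by (simp add: B_iff x)
  have "\<not> int p dvd d"
  proof
    assume pd: "int p dvd d"
    then have "0 < multiplicity (int p) d" using d not_unit_p by (simp add: prime_multiplicity_gt_zero_iff prime_elem_p multiplicity_gt_zero_iff)
    then have "int p dvd c"
      using \<open>multiplicity (int p) d \<le> multiplicity (int p) c\<close> not_dvd_imp_multiplicity_0 by fastforce
    then show False using pd co not_unit_p coprime_common_divisor by blast
  qed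
  then have "coprime d (int p ^ k)"
    using prime_imp_coprime[of "int p" d] prime_p by (simp add: coprime_commute)
  then obtain u v where uv: "u * d + v * int p ^ k = 1" using bezout_int[of d "int p ^ k"] by auto
  define n where "n = nat ((u * c) mod int p ^ k)"
  have n: "int n = (u * c) mod int p ^ k" using p_ge_2 by (simp add: n_def)
  have "int p ^ k dvd int n - u * c" unfolding n by (simp add: mod_eq_dvd_iff[symmetric])
  then have "of_int (int n - u * c) \<in> B (int k)" by (simp only: of_int_in_B_iff)
  have "c - u * c * d = c * (1 - u * d)" by (simp add: algebra_simps)
  also have "\<dots> = c * (v * int p ^ k)" using uv by simp
  finally have "of_int (c - u * c * d) \<in> B (int k)" by (simp only: of_int_in_B_iff) simp
  moreover have "1 / of_int d \<in> B 0"
    using padic_val_divide[of 1 d] d \<open>\<not> int p dvd d\<close> by (simp add: B_iff not_dvd_imp_multiplicity_0)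
  ultimately have "of_int (c - u * c * d) * (1 / of_int d) \<in> B (int k + 0)" by (rule B_mult)
  then have "x - of_int (u * c) \<in> B (int k)" using d by (simp add: x field_simps)
  then have "(x - of_int (u * c)) - of_int (int n - u * c) \<in> B (int k)"
    using \<open>of_int (int n - u * c) \<in> B (int k)\<close> by (rule B_diff)
  then show ?thesis by (intro exI[of _ n]) simp
qed

text \<open>Multiplication by a power of p reduces the claim to p-integral x. Denominators that are
  powers of p are what the torsion of Qp/Zp calls for.\<close>

lemma approx_fraction: "\<exists>(c::int) n. x - of_int c / of_nat p ^ n \<in> B (int k)"
proof (cases "x = 0")
  case True
  then show ?thesis by (intro exI[of _ 0]) simp
next
  case False
  define n where "n = nat (- padic_val p x)"
  have "x \<in> B (- int n)" using False by (simp add: B_iff n_def)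
  then have "x * of_int (int p ^ n) \<in> B (- int n + int n)"
    by (intro B_mult) (simp_all only: of_int_in_B_iff dvd_refl)
  then have "x * of_nat p ^ n \<in> B 0" by simp
  then obtain c where "x * of_nat p ^ n - of_nat c \<in> B (int (k + n))" using approx_int by blast
  then have "(x * of_nat p ^ n - of_nat c) * (1 / of_nat p ^ n) \<in> B (int (k + n) + - int n)"
    using p_powi_mem by (rule B_mult)
  moreover have "(x * of_nat p ^ n - of_nat c) * (1 / of_nat p ^ n) = x - of_int (int c) / of_nat p ^ n"
    using p_ge_2 by (simp add: field_simps)
  ultimately show ?thesis by (intro exI[of _ "int c"] exI[of _ n]) simp
qed

section \<open>Cauchy sequences of rationals and the ideal of null sequences\<close>

lemma cring_rat: "cring (rat_padic p)"
proof (intro cringI abelian_groupI comm_monoidI)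
  show "\<exists>y\<in>carrier (rat_padic p). y \<oplus>\<^bsub>rat_padic p\<^esub> x = \<zero>\<^bsub>rat_padic p\<^esub>" for x
    by (rule bexI[of _ "- x"]) (auto simp: rat_padic_def)
qed (auto simp: rat_padic_def algebra_simps)

lemma minus_rat [simp]: "x \<ominus>\<^bsub>rat_padic p\<^esub> y = x - y"
proof -
  interpret cring "rat_padic p" by (rule cring_rat)
  have "\<ominus>\<^bsub>rat_padic p\<^esub> y = - y" by (rule minus_equality) (auto simp: rat_padic_def)
  then show ?thesis by (simp add: a_minus_def) (simp add: rat_padic_def)
qed

abbreviation cauchy :: "(nat \<Rightarrow> rat) \<Rightarrow> bool" where "cauchy f \<equiv> vcauchy (rat_padic p) f"

lemma cauchy_iff: "cauchy f \<longleftrightarrow> (\<forall>k. \<exists>N. \<forall>m\<ge>N. \<forall>n\<ge>N. f m - f n \<in> B k)"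
  by (simp add: vcauchy_def) (simp add: rat_padic_def)

lemma vlim_rat_iff: "vlim (rat_padic p) f x \<longleftrightarrow> (\<forall>k. \<exists>N. \<forall>n\<ge>N. f n - x \<in> B k)"
  by (simp add: vlim_def)

lemma cauchy_const: "cauchy (\<lambda>_. x)"
  by (simp add: cauchy_iff)

lemma cauchy_add:
  assumes "cauchy f" "cauchy g"
  shows "cauchy (\<lambda>n. f n + g n)"
  unfolding cauchy_iff
proof
  fix k
  obtain M N where MN: "\<And>m n. m \<ge> M \<Longrightarrow> n \<ge> M \<Longrightarrow> f m - f n \<in> B k" "\<And>m n. m \<ge> N \<Longrightarrow> n \<ge> N \<Longrightarrow> g m - g n \<in> B k"
    using assms unfolding cauchy_iff by metis
  have "f m + g m - (f n + g n) \<in> B k" if "m \<ge> max M N" "n \<ge> max M N" for m n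
    using B_add[OF MN(1)[of m n] MN(2)[of m n]] that by (simp add: algebra_simps)
  then show "\<exists>N. \<forall>m\<ge>N. \<forall>n\<ge>N. f m + g m - (f n + g n) \<in> B k" by blast
qed

lemma cauchy_bounded:
  assumes "cauchy f"
  shows "\<exists>k N. \<forall>n\<ge>N. f n \<in> B k"
proof -
  obtain N where N: "\<And>m n. m \<ge> N \<Longrightarrow> n \<ge> N \<Longrightarrow> f m - f n \<in> B 0" using assms unfolding cauchy_iff by metis
  define k where "k = min 0 (padic_val p (f N))"
  have "f n \<in> B k" if "n \<ge> N" for n
  proof -
    have "f n - f N \<in> B k" using N[of n N] that B_antimono[of k 0] by (simp add: k_def)
    moreover have "f N \<in> B k" by (simp add: B_iff k_def)
    ultimately have "(f n - f N) + f N \<in> B k" by (rule B_add)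
    then show ?thesis by simp
  qed
  then show ?thesis by blast
qed

lemma cauchy_mult:
  assumes "cauchy f" "cauchy g"
  shows "cauchy (\<lambda>n. f n * g n)"
  unfolding cauchy_iff
proof
  fix k
  obtain K1 N1 K2 N2 where b: "\<And>n. n \<ge> N1 \<Longrightarrow> f n \<in> B K1" "\<And>n. n \<ge> N2 \<Longrightarrow> g n \<in> B K2"
    using cauchy_bounded assms by meson
  obtain M N where MN: "\<And>m n. m \<ge> M \<Longrightarrow> n \<ge> M \<Longrightarrow> f m - f n \<in> B (k - K2)"
      "\<And>m n. m \<ge> N \<Longrightarrow> n \<ge> N \<Longrightarrow> g m - g n \<in> B (k - K1)"
    using assms unfolding cauchy_iff by metis
  define N0 where "N0 = Max {M, N, N1, N2}"
  have N0: "M \<le> N0" "N \<le> N0" "N1 \<le> N0" "N2 \<le> N0" by (simp_all add: N0_def)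
  have "f m * g m - f n * g n \<in> B k" if mn: "m \<ge> N0" "n \<ge> N0" for m n
  proof -
    have "f m * (g m - g n) \<in> B (K1 + (k - K1))" using b(1)[of m] MN(2)[of m n] N0 mn by (intro B_mult) simp_all
    moreover have "(f m - f n) * g n \<in> B ((k - K2) + K2)" using b(2)[of n] MN(1)[of m n] N0 mn by (intro B_mult) simp_all
    ultimately have "f m * (g m - g n) + (f m - f n) * g n \<in> B k" by (intro B_add) simp_all
    then show ?thesis by (simp add: algebra_simps)
  qed
  then show "\<exists>N. \<forall>m\<ge>N. \<forall>n\<ge>N. f m * g m - f n * g n \<in> B k" by blast
qed

lemma cauchy_uminus: "cauchy f \<Longrightarrow> cauchy (\<lambda>n. - f n)"
  using cauchy_mult[OF cauchy_const[of "-1"], of f] by simp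

lemma cauchy_diff: "cauchy f \<Longrightarrow> cauchy g \<Longrightarrow> cauchy (\<lambda>n. f n - g n)"
  using cauchy_add[OF _ cauchy_uminus, of f g] by simp

abbreviation C :: "(nat \<Rightarrow> rat) ring" where "C \<equiv> cauchy_ring (rat_padic p)"
abbreviation I :: "(nat \<Rightarrow> rat) set" where "I \<equiv> null_seqs (rat_padic p)"

lemma C_simps [simp]:
  "carrier C = {f. cauchy f}" "f \<otimes>\<^bsub>C\<^esub> g = (\<lambda>n. f n * g n)" "\<one>\<^bsub>C\<^esub> = (\<lambda>_. 1)"
  "\<zero>\<^bsub>C\<^esub> = (\<lambda>_. 0)" "f \<oplus>\<^bsub>C\<^esub> g = (\<lambda>n. f n + g n)"
  by (simp_all add: cauchy_ring_def) (simp_all add: rat_padic_def)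

lemma cring_C: "cring C"
proof (intro cringI abelian_groupI comm_monoidI)
  show "\<exists>y\<in>carrier C. y \<oplus>\<^bsub>C\<^esub> f = \<zero>\<^bsub>C\<^esub>" if "f \<in> carrier C" for f
    using that by (intro bexI[of _ "\<lambda>n. - f n"]) (auto intro: cauchy_uminus)
qed (auto simp: algebra_simps intro: cauchy_add cauchy_mult cauchy_const)

lemma uminus_C: "cauchy f \<Longrightarrow> \<ominus>\<^bsub>C\<^esub> f = (\<lambda>n. - f n)"
proof -
  assume f: "cauchy f"
  interpret cring C by (rule cring_C)
  show ?thesis using f by (intro minus_equality) (auto intro: cauchy_uminus)
qed

lemma zero_rat: "\<zero>\<^bsub>rat_padic p\<^esub> = 0"
  by (simp add: rat_padic_def)

lemma I_iff: "f \<in> I \<longleftrightarrow> cauchy f \<and> (\<forall>k. \<exists>N. \<forall>n\<ge>N. f n \<in> B k)"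
  by (simp add: null_seqs_def vlim_rat_iff zero_rat)

lemma I_add: "f \<in> I \<Longrightarrow> g \<in> I \<Longrightarrow> (\<lambda>n. f n + g n) \<in> I"
  unfolding I_iff
proof (intro conjI allI)
  fix k
  assume "cauchy f \<and> (\<forall>k. \<exists>N. \<forall>n\<ge>N. f n \<in> B k)" "cauchy g \<and> (\<forall>k. \<exists>N. \<forall>n\<ge>N. g n \<in> B k)"
  then obtain M N where "\<And>n. n \<ge> M \<Longrightarrow> f n \<in> B k" "\<And>n. n \<ge> N \<Longrightarrow> g n \<in> B k" by meson
  then have "\<forall>n\<ge>max M N. f n + g n \<in> B k" by (auto intro: B_add)
  then show "\<exists>N. \<forall>n\<ge>N. f n + g n \<in> B k" by blast
qed (auto intro: cauchy_add)

lemma I_mult: "f \<in> I \<Longrightarrow> cauchy g \<Longrightarrow> (\<lambda>n. f n * g n) \<in> I"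
  unfolding I_iff
proof (intro conjI allI)
  fix k
  assume f: "cauchy f \<and> (\<forall>k. \<exists>N. \<forall>n\<ge>N. f n \<in> B k)" and g: "cauchy g"
  obtain l N where N: "\<And>n. n \<ge> N \<Longrightarrow> g n \<in> B l" using cauchy_bounded[OF g] by blast
  obtain M where M: "\<And>n. n \<ge> M \<Longrightarrow> f n \<in> B (k - l)" using f by meson
  have "f n * g n \<in> B k" if "n \<ge> max M N" for n using B_mult[OF M N, of n n] that by simp
  then show "\<exists>N. \<forall>n\<ge>N. f n * g n \<in> B k" by blast
qed (auto intro: cauchy_mult)

lemma ideal_I: "ideal I C"
proof (rule idealI)
  show "ring C" using cring_C by (simp add: cring_def)
  interpret cring C by (rule cring_C)
  have neg: "(\<lambda>n. - f n) \<in> I" if "f \<in> I" for f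
    using I_mult[OF that cauchy_const[of "-1"]] by simp
  show "subgroup I (add_monoid C)"
  proof (rule add.subgroupI)
    show "I \<subseteq> carrier C" by (auto simp: I_iff)
    have "(\<lambda>_. 0) \<in> I" by (simp add: I_iff cauchy_const)
    then show "I \<noteq> {}" by blast
    show "\<ominus>\<^bsub>C\<^esub> f \<in> I" if "f \<in> I" for f using neg[OF that] that by (simp add: I_iff uminus_C)
    show "f \<oplus>\<^bsub>C\<^esub> g \<in> I" if "f \<in> I" "g \<in> I" for f g using I_add that by simp
  qed
  show "f \<otimes>\<^bsub>C\<^esub> g \<in> I" if "g \<in> I" "f \<in> carrier C" for f g
    using I_mult[OF that(1), of f] that by (simp add: mult.commute)
  show "g \<otimes>\<^bsub>C\<^esub> f \<in> I" if "g \<in> I" "f \<in> carrier C" for f g using I_mult[OF that(1), of f] that by simp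
qed

definition cls :: "(nat \<Rightarrow> rat) \<Rightarrow> padic" where "cls f = I +>\<^bsub>C\<^esub> f"

section \<open>Arithmetic and valuation of classes of Cauchy sequences\<close>

lemma Qp_sel:
  "carrier (Qp p) = carrier (C Quot I)" "x \<otimes>\<^bsub>Qp p\<^esub> y = x \<otimes>\<^bsub>C Quot I\<^esub> y" "\<one>\<^bsub>Qp p\<^esub> = \<one>\<^bsub>C Quot I\<^esub>"
  "\<zero>\<^bsub>Qp p\<^esub> = \<zero>\<^bsub>C Quot I\<^esub>" "x \<oplus>\<^bsub>Qp p\<^esub> y = x \<oplus>\<^bsub>C Quot I\<^esub> y"
  by (simp_all add: Qp_def completion_def ring.defs)

lemma cring_Qp: "cring (Qp p)"
proof -
  interpret ideal I C by (rule ideal_I)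
  interpret Q: cring "C Quot I" by (rule quotient_is_cring[OF cring_C])
  show ?thesis
  proof (intro cringI abelian_groupI comm_monoidI)
    show "\<exists>y\<in>carrier (Qp p). y \<oplus>\<^bsub>Qp p\<^esub> x = \<zero>\<^bsub>Qp p\<^esub>" if "x \<in> carrier (Qp p)" for x
      using that Q.add.l_inv_ex by (simp add: Qp_sel)
  qed (simp_all add: Qp_sel Q.a_ac Q.m_ac Q.l_distr Q.r_distr)
qed

lemma Qp_carrier: "carrier (Qp p) = cls ` Collect cauchy"
  unfolding Qp_sel FactRing_def A_RCOSETS_defs cls_def a_r_coset_def by auto

lemma cls_closed: "cauchy f \<Longrightarrow> cls f \<in> carrier (Qp p)"
  by (simp add: Qp_carrier)

lemma Qp_cases:
  assumes "x \<in> carrier (Qp p)"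
  obtains f where "cauchy f" "x = cls f"
  using assms that by (auto simp: Qp_carrier)

lemma cls_add: "cauchy f \<Longrightarrow> cauchy g \<Longrightarrow> cls f \<oplus>\<^bsub>Qp p\<^esub> cls g = cls (\<lambda>n. f n + g n)"
  using ideal.a_rcos_sum[OF ideal_I, of f g]
  by (simp add: Qp_sel FactRing_def cls_def)

lemma cls_mult: "cauchy f \<Longrightarrow> cauchy g \<Longrightarrow> cls f \<otimes>\<^bsub>Qp p\<^esub> cls g = cls (\<lambda>n. f n * g n)"
  using ideal.rcoset_mult_add[OF ideal_I, of f g] by (simp add: Qp_sel FactRing_def cls_def)

lemma cls_one: "\<one>\<^bsub>Qp p\<^esub> = cls (\<lambda>_. 1)"
  by (simp add: Qp_sel FactRing_def cls_def)

lemma cls_eq_zero_iff: "cauchy f \<Longrightarrow> cls f = \<zero>\<^bsub>Qp p\<^esub> \<longleftrightarrow> f \<in> I"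
proof -
  assume f: "cauchy f"
  interpret ideal I C by (rule ideal_I)
  have "cls f = I \<longleftrightarrow> f \<in> I"
    unfolding cls_def using f a_rcos_const a_rcos_self by auto
  then show ?thesis by (simp add: Qp_sel FactRing_def)
qed

lemma cls_zero: "\<zero>\<^bsub>Qp p\<^esub> = cls (\<lambda>_. 0)"
  using cls_eq_zero_iff[of "\<lambda>_. 0"] by (simp add: I_iff cauchy_const)

lemma cls_uminus: "cauchy f \<Longrightarrow> \<ominus>\<^bsub>Qp p\<^esub> cls f = cls (\<lambda>n. - f n)"
proof -
  assume f: "cauchy f"
  interpret Q: cring "Qp p" by (rule cring_Qp)
  show ?thesis
    using f by (intro Q.minus_equality) (simp_all add: cls_add cls_zero cls_closed cauchy_uminus)
qed

lemma cls_diff: "cauchy f \<Longrightarrow> cauchy g \<Longrightarrow> cls f \<ominus>\<^bsub>Qp p\<^esub> cls g = cls (\<lambda>n. f n - g n)"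
  by (simp add: a_minus_def cls_uminus cls_add cauchy_uminus)

text \<open>A sequence that is not null leaves some ball infinitely often, while its late terms
  differ by elements of that ball; differences so small cannot change a valuation.\<close>

lemma cauchy_val:
  assumes "cauchy f" "f \<notin> I"
  shows "\<exists>k N. \<forall>n\<ge>N. f n \<noteq> 0 \<and> padic_val p (f n) = k"
proof -
  obtain l where l: "\<And>N. \<exists>n\<ge>N. f n \<notin> B l" using assms by (auto simp: I_iff)
  obtain N where N: "\<And>m n. m \<ge> N \<Longrightarrow> n \<ge> N \<Longrightarrow> f m - f n \<in> B l" using assms unfolding cauchy_iff by metis
  obtain n0 where n0: "n0 \<ge> N" "f n0 \<notin> B l" using l by blast
  have "f n \<noteq> 0 \<and> padic_val p (f n) = padic_val p (f n0)" if "n \<ge> N" for n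
  proof -
    have d: "f n - f n0 \<in> B l" "f n0 - f n \<in> B l" using N that n0 by blast+
    have nB: "f n \<notin> B l" using B_diff[OF _ d(1)] n0 by fastforce
    then have nz: "f n \<noteq> 0" "f n0 \<noteq> 0" using n0 by (metis B_0)+
    have lt: "padic_val p (f n) < l" "padic_val p (f n0) < l" using nB n0 by (auto simp: B_iff)
    have "f n \<in> B (padic_val p (f n0))"
      using B_add[of "f n0" "padic_val p (f n0)" "f n - f n0"] d lt B_antimono[of "padic_val p (f n0)" l]
      by (auto simp: B_iff)
    moreover have "f n0 \<in> B (padic_val p (f n))"
      using B_add[of "f n" "padic_val p (f n)" "f n0 - f n"] d lt B_antimono[of "padic_val p (f n)" l]
      by (auto simp: B_iff)
    ultimately show ?thesis using nz by (simp add: B_iff)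
  qed
  then show ?thesis by blast
qed

lemma mem_cls_iff: "cauchy f \<Longrightarrow> g \<in> cls f \<longleftrightarrow> (\<exists>h\<in>I. g = (\<lambda>n. h n + f n))"
  by (auto simp: cls_def a_r_coset_def r_coset_def)

text \<open>The valuation of a class is a definite description over all its representatives. If f is
  not null, an added null sequence is eventually smaller than f, so all representatives share the
  same eventual valuation; if f is null, its class is zero and lies in every ball.\<close>

lemma cls_in_vball_iff:
  assumes "cauchy f"
  shows "cls f \<in> vball (Qp p) k \<longleftrightarrow> (\<exists>N. \<forall>n\<ge>N. f n \<in> B k)"
proof (cases "f \<in> I")
  case True
  then show ?thesis using assms by (auto simp: vball_def cls_closed cls_eq_zero_iff I_iff)
next
  case False
  obtain v N where v: "\<And>n. n \<ge> N \<Longrightarrow> f n \<noteq> 0 \<and> padic_val p (f n) = v"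
    using cauchy_val[OF assms False] by blast
  have "val (Qp p) (cls f) = (THE k. \<forall>g\<in>cls f. \<exists>N. \<forall>n\<ge>N. padic_val p (g n) = k)"
    by (simp add: Qp_def completion_def ring.defs valued_field.defs) (simp add: rat_padic_def)
  also have "\<dots> = v"
  proof (rule the_equality)
    show "\<forall>g\<in>cls f. \<exists>N. \<forall>n\<ge>N. padic_val p (g n) = v"
    proof
      fix g assume "g \<in> cls f"
      then obtain h where h: "h \<in> I" "g = (\<lambda>n. h n + f n)" using mem_cls_iff[OF assms] by blast
      obtain M where M: "\<And>n. n \<ge> M \<Longrightarrow> h n \<in> B (v + 1)" using h(1) by (auto simp: I_iff)
      have "padic_val p (g n) = v" if "n \<ge> max M N" for n
      proof -
        have hn: "h n \<in> B (v + 1)" and fn: "f n \<noteq> 0" "padic_val p (f n) = v" using M v that by auto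
        have fB: "f n \<notin> B (v + 1)" "f n \<in> B v" using fn by (auto simp: B_iff)
        then have "g n \<notin> B (v + 1)" using B_diff[of "h n + f n" "v + 1" "h n"] hn h(2) by auto
        moreover have "g n \<in> B v" using B_add[OF B_antimono[OF _ hn] fB(2)] h(2) by simp
        ultimately show ?thesis by (auto simp: B_iff)
      qed
      then show "\<exists>N. \<forall>n\<ge>N. padic_val p (g n) = v" by blast
    qed
  next
    fix k assume "\<forall>g\<in>cls f. \<exists>N. \<forall>n\<ge>N. padic_val p (g n) = k"
    moreover have "f \<in> cls f"
      using mem_cls_iff[OF assms] by (auto simp: I_iff cauchy_const intro!: bexI[of _ "\<lambda>_. 0"])
    ultimately obtain M where "\<And>n. n \<ge> M \<Longrightarrow> padic_val p (f n) = k" by blast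
    then have "padic_val p (f (max M N)) = k" by simp
    moreover have "f (max M N) \<noteq> 0 \<and> padic_val p (f (max M N)) = v" by (intro v) simp
    ultimately show "k = v" by simp
  qed
  finally have val: "val (Qp p) (cls f) = v" .
  have "cls f \<in> vball (Qp p) k \<longleftrightarrow> k \<le> v"
    using False assms val by (simp add: vball_def cls_closed cls_eq_zero_iff)
  also have "\<dots> \<longleftrightarrow> (\<exists>N. \<forall>n\<ge>N. f n \<in> B k)"
  proof
    assume "k \<le> v"
    then show "\<exists>N. \<forall>n\<ge>N. f n \<in> B k" using v by (auto simp: B_iff)
  next
    assume "\<exists>N. \<forall>n\<ge>N. f n \<in> B k"
    then obtain M where "\<And>n. n \<ge> M \<Longrightarrow> f n \<in> B k" by blast
    then have "f (max M N) \<in> B k" by simp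
    moreover have "f (max M N) \<noteq> 0 \<and> padic_val p (f (max M N)) = v" by (intro v) simp
    ultimately show "k \<le> v" by (simp add: B_iff)
  qed
  finally show ?thesis .
qed

lemma vball_add:
  assumes "x \<in> vball (Qp p) k" "y \<in> vball (Qp p) k"
  shows "x \<oplus>\<^bsub>Qp p\<^esub> y \<in> vball (Qp p) k"
proof -
  have "x \<in> carrier (Qp p)" "y \<in> carrier (Qp p)" using assms by (auto simp: vball_def)
  then obtain f g where fg: "cauchy f" "x = cls f" "cauchy g" "y = cls g" by (metis Qp_cases)
  then obtain M N where "\<And>n. n \<ge> M \<Longrightarrow> f n \<in> B k" "\<And>n. n \<ge> N \<Longrightarrow> g n \<in> B k"
    using assms cls_in_vball_iff by meson
  then have "\<forall>n\<ge>max M N. f n + g n \<in> B k" by (auto intro: B_add)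
  then have "cls (\<lambda>n. f n + g n) \<in> vball (Qp p) k" using fg cls_in_vball_iff[OF cauchy_add] by blast
  then show ?thesis using fg by (simp add: cls_add)
qed

lemma vball_uminus:
  assumes "x \<in> vball (Qp p) k"
  shows "\<ominus>\<^bsub>Qp p\<^esub> x \<in> vball (Qp p) k"
proof -
  have "x \<in> carrier (Qp p)" using assms by (auto simp: vball_def)
  then obtain f where f: "cauchy f" "x = cls f" by (metis Qp_cases)
  then obtain M where "\<And>n. n \<ge> M \<Longrightarrow> f n \<in> B k" using assms cls_in_vball_iff by meson
  then have "cls (\<lambda>n. - f n) \<in> vball (Qp p) k"
    using f cls_in_vball_iff[OF cauchy_uminus] B_uminus by blast
  then show ?thesis using f by (simp add: cls_uminus)
qed

section \<open>The rationals inside \<open>Qp p\<close> and approximation by them\<close>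

definition q :: "rat \<Rightarrow> padic" where "q x = cls (\<lambda>_. x)"

lemma q_closed [simp]: "q x \<in> carrier (Qp p)"
  by (simp add: q_def cls_closed cauchy_const)

lemma q_add: "q x \<oplus>\<^bsub>Qp p\<^esub> q y = q (x + y)"
  by (simp add: q_def cls_add cauchy_const)

lemma q_mult: "q x \<otimes>\<^bsub>Qp p\<^esub> q y = q (x * y)"
  by (simp add: q_def cls_mult cauchy_const)

lemma q_one: "q 1 = \<one>\<^bsub>Qp p\<^esub>"
  by (simp add: q_def cls_one)

lemma q_zero: "q 0 = \<zero>\<^bsub>Qp p\<^esub>"
  by (simp add: q_def cls_zero)

lemma q_diff: "q x \<ominus>\<^bsub>Qp p\<^esub> q y = q (x - y)"
  by (simp add: q_def cls_diff cauchy_const)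

lemma q_uminus: "\<ominus>\<^bsub>Qp p\<^esub> q x = q (- x)"
  by (simp add: q_def cls_uminus cauchy_const)

lemma q_in_vball_iff: "q x \<in> vball (Qp p) k \<longleftrightarrow> x \<in> B k"
  unfolding q_def by (subst cls_in_vball_iff) (auto simp: cauchy_const)

lemma q_nonzero: "x \<noteq> 0 \<Longrightarrow> q x \<noteq> \<zero>\<^bsub>Qp p\<^esub>"
proof
  assume "x \<noteq> 0" "q x = \<zero>\<^bsub>Qp p\<^esub>"
  then have "q x \<in> vball (Qp p) (padic_val p x + 1)" using q_closed[of x] by (simp add: vball_def)
  then show False using \<open>x \<noteq> 0\<close> by (simp add: q_in_vball_iff B_iff)
qed

lemma q_val: "x \<noteq> 0 \<Longrightarrow> val (Qp p) (q x) = padic_val p x"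
proof -
  assume x: "x \<noteq> 0"
  have "k \<le> val (Qp p) (q x) \<longleftrightarrow> k \<le> padic_val p x" for k
    using q_in_vball_iff[of x k] q_nonzero[OF x] x unfolding B_iff by (simp add: vball_def)
  then show ?thesis by (meson order_antisym order_refl)
qed

lemma q_of_nat: "[n] \<cdot>\<^bsub>Qp p\<^esub> \<one>\<^bsub>Qp p\<^esub> = q (of_nat n)"
proof -
  interpret Q: cring "Qp p" by (rule cring_Qp)
  show ?thesis by (induction n) (simp_all add: q_zero q_add add.commute flip: q_one)
qed

lemma approx_q:
  assumes "x \<in> carrier (Qp p)"
  shows "\<exists>r. x \<ominus>\<^bsub>Qp p\<^esub> q r \<in> vball (Qp p) k"
proof -
  obtain f where f: "cauchy f" "x = cls f" using assms Qp_cases by blast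
  then obtain N where N: "\<And>m n. m \<ge> N \<Longrightarrow> n \<ge> N \<Longrightarrow> f m - f n \<in> B k" unfolding cauchy_iff by metis
  have "cls (\<lambda>n. f n - f N) \<in> vball (Qp p) k"
    using cls_in_vball_iff[OF cauchy_diff[OF f(1) cauchy_const], of "f N" k] N[OF _ order_refl] by blast
  then show ?thesis using f by (auto simp: q_def cls_diff cauchy_const intro!: exI[of _ "f N"])
qed

lemma vball_diff_trans:
  assumes "x \<ominus>\<^bsub>Qp p\<^esub> y \<in> vball (Qp p) k" "y \<ominus>\<^bsub>Qp p\<^esub> z \<in> vball (Qp p) k"
    and "x \<in> carrier (Qp p)" "y \<in> carrier (Qp p)" "z \<in> carrier (Qp p)"
  shows "x \<ominus>\<^bsub>Qp p\<^esub> z \<in> vball (Qp p) k"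
proof -
  interpret Q: cring "Qp p" by (rule cring_Qp)
  have "(x \<ominus>\<^bsub>Qp p\<^esub> y) \<oplus>\<^bsub>Qp p\<^esub> (y \<ominus>\<^bsub>Qp p\<^esub> z) = x \<ominus>\<^bsub>Qp p\<^esub> z" using assms(3-5) by algebra
  then show ?thesis using vball_add[OF assms(1,2)] by simp
qed

lemma vball_diff_commute:
  assumes "x \<ominus>\<^bsub>Qp p\<^esub> y \<in> vball (Qp p) k" and "x \<in> carrier (Qp p)" "y \<in> carrier (Qp p)"
  shows "y \<ominus>\<^bsub>Qp p\<^esub> x \<in> vball (Qp p) k"
proof -
  interpret Q: cring "Qp p" by (rule cring_Qp)
  have "\<ominus>\<^bsub>Qp p\<^esub> (x \<ominus>\<^bsub>Qp p\<^esub> y) = y \<ominus>\<^bsub>Qp p\<^esub> x" using assms(2-3) by algebra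
  then show ?thesis using vball_uminus[OF assms(1)] by simp
qed

lemma approx_q_fraction:
  assumes "x \<in> carrier (Qp p)"
  shows "\<exists>(c::int) n. x \<ominus>\<^bsub>Qp p\<^esub> q (of_int c / of_nat p ^ n) \<in> vball (Qp p) (int k)"
proof -
  obtain r where r: "x \<ominus>\<^bsub>Qp p\<^esub> q r \<in> vball (Qp p) (int k)" using approx_q[OF assms] by blast
  obtain c :: int and n where "r - of_int c / of_nat p ^ n \<in> B (int k)" using approx_fraction by blast
  then have "q r \<ominus>\<^bsub>Qp p\<^esub> q (of_int c / of_nat p ^ n) \<in> vball (Qp p) (int k)"
    by (simp add: q_diff q_in_vball_iff)
  then have "x \<ominus>\<^bsub>Qp p\<^esub> q (of_int c / of_nat p ^ n) \<in> vball (Qp p) (int k)"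
    by (rule vball_diff_trans[OF r]) (simp_all add: assms)
  then show ?thesis by blast
qed

text \<open>Provides the sequences over which p-adic powers are defined; without one, every element
  of the carrier would satisfy the condition in \<open>zp_power\<close>.\<close>

lemma nat_dense:
  assumes "x \<in> carrier (Zp p)"
  shows "\<exists>f :: nat \<Rightarrow> nat. vlim (Qp p) (\<lambda>n. [f n] \<cdot>\<^bsub>Qp p\<^esub> \<one>\<^bsub>Qp p\<^esub>) x"
proof -
  have x: "x \<in> vball (Qp p) 0" "x \<in> carrier (Qp p)"
    using assms by (auto simp: Zp_def valuation_ring_def vball_def)
  interpret Q: cring "Qp p" by (rule cring_Qp)
  have "\<exists>n::nat. q (of_nat n) \<ominus>\<^bsub>Qp p\<^esub> x \<in> vball (Qp p) (int k)" for k
  proof -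
    obtain r where r: "x \<ominus>\<^bsub>Qp p\<^esub> q r \<in> vball (Qp p) (int k)" using approx_q x by blast
    then have "x \<ominus>\<^bsub>Qp p\<^esub> q r \<in> vball (Qp p) 0" by (auto simp: vball_def)
    then have "\<ominus>\<^bsub>Qp p\<^esub> (x \<ominus>\<^bsub>Qp p\<^esub> q r) \<oplus>\<^bsub>Qp p\<^esub> x \<in> vball (Qp p) 0"
      using x by (intro vball_add vball_uminus)
    moreover have "\<ominus>\<^bsub>Qp p\<^esub> (x \<ominus>\<^bsub>Qp p\<^esub> q r) \<oplus>\<^bsub>Qp p\<^esub> x = q r" using x(2) q_closed[of r] by algebra
    ultimately have "r \<in> B 0" using q_in_vball_iff by simp
    then obtain n where "r - of_nat n \<in> B (int k)" using approx_int by blast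
    then have "q r \<ominus>\<^bsub>Qp p\<^esub> q (of_nat n) \<in> vball (Qp p) (int k)" by (simp add: q_diff q_in_vball_iff)
    then have "x \<ominus>\<^bsub>Qp p\<^esub> q (of_nat n) \<in> vball (Qp p) (int k)" by (rule vball_diff_trans[OF r]) (simp_all add: x)
    then have "q (of_nat n) \<ominus>\<^bsub>Qp p\<^esub> x \<in> vball (Qp p) (int k)"
      by (rule vball_diff_commute) (simp_all add: x)
    then show ?thesis by blast
  qed
  then obtain f where f: "\<And>k. q (of_nat (f k)) \<ominus>\<^bsub>Qp p\<^esub> x \<in> vball (Qp p) (int k)" by metis
  have "q (of_nat (f n)) \<ominus>\<^bsub>Qp p\<^esub> x \<in> vball (Qp p) k" if "n \<ge> nat k" for n k
    using f[of n] that by (auto simp: vball_def)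
  then show ?thesis unfolding vlim_def q_of_nat by blast
qed

text \<open>The indices m and n vary independently, so the case f = g gives the Cauchy property and
  the general case the independence of the approximating sequence.\<close>

lemma vlim_nat_cong:
  assumes "vlim (Qp p) (\<lambda>n. [f n] \<cdot>\<^bsub>Qp p\<^esub> \<one>\<^bsub>Qp p\<^esub>) x" "vlim (Qp p) (\<lambda>n. [g n] \<cdot>\<^bsub>Qp p\<^esub> \<one>\<^bsub>Qp p\<^esub>) x"
    and "x \<in> carrier (Qp p)"
  shows "\<exists>N. \<forall>m\<ge>N. \<forall>n\<ge>N. int p ^ k dvd int (f m) - int (g n)"
proof -
  obtain M where M: "\<And>n. n \<ge> M \<Longrightarrow> q (of_nat (f n)) \<ominus>\<^bsub>Qp p\<^esub> x \<in> vball (Qp p) (int k)"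
    using assms(1) unfolding vlim_def q_of_nat by meson
  obtain N where N: "\<And>n. n \<ge> N \<Longrightarrow> q (of_nat (g n)) \<ominus>\<^bsub>Qp p\<^esub> x \<in> vball (Qp p) (int k)"
    using assms(2) unfolding vlim_def q_of_nat by meson
  have "int p ^ k dvd int (f m) - int (g n)" if mn: "m \<ge> max M N" "n \<ge> max M N" for m n
  proof -
    have "q (of_nat (f m)) \<ominus>\<^bsub>Qp p\<^esub> q (of_nat (g n)) \<in> vball (Qp p) (int k)"
      using vball_diff_trans[OF M[of m] vball_diff_commute[OF N[of n]]] assms(3) mn by simp
    then have "of_int (int (f m) - int (g n)) \<in> B (int k)" by (simp add: q_diff q_in_vball_iff)
    then show ?thesis by (simp only: of_int_in_B_iff)
  qed
  then show ?thesis by blast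
qed

end

context padic
begin

section \<open>The quotient Qp/Zp\<close>

lemma Zp_carrier: "carrier (Zp p) = vball (Qp p) 0"
  by (simp add: Zp_def valuation_ring_def)

lemma Zp_subgroup: "subgroup (carrier (Zp p)) (add_monoid (Qp p))"
proof -
  interpret Q: cring "Qp p" by (rule cring_Qp)
  show ?thesis
    unfolding Zp_carrier
    by (rule Q.add.subgroupI)
      (use vball_add vball_uminus Q.zero_closed in \<open>auto simp: vball_def\<close>)
qed

definition unit_fraction :: "nat \<Rightarrow> padic set" where
  "unit_fraction n = carrier (Zp p) +>\<^bsub>Qp p\<^esub> q (1 / of_nat p ^ n)"

text \<open>A class killed by p^k has a representative i / p^n for which p^n divides p^k * i, and
  this fraction equals j / p^k for an integer j.\<close>

lemma prufer_Qp_mod_Zp: "prufer_group (Qp_mod_Zp p) p unit_fraction"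
proof -
  interpret Q: cring "Qp p" by (rule cring_Qp)
  interpret S: normal "carrier (Zp p)" "add_monoid (Qp p)"
    using Zp_subgroup by (rule Q.add.subgroup_imp_normal)
  have comm: "comm_group (Qp_mod_Zp p)"
    unfolding Qp_mod_Zp_def using Zp_subgroup by (rule Q.add.abelian_FactGroup)
  then interpret P: comm_group "Qp_mod_Zp p" .
  define c where "c = (\<lambda>x. carrier (Zp p) +>\<^bsub>Qp p\<^esub> x)"
  have c_hom: "c \<in> hom (add_monoid (Qp p)) (Qp_mod_Zp p)"
    using S.r_coset_hom_Mod by (simp add: c_def Qp_mod_Zp_def a_r_coset_def)
  interpret h: group_hom "add_monoid (Qp p)" "Qp_mod_Zp p" c
    using c_hom by (simp add: group_hom_def group_hom_axioms_def Q.add.is_group)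
  have c_one: "c x = \<one>\<^bsub>Qp_mod_Zp p\<^esub> \<longleftrightarrow> x \<in> vball (Qp p) 0" if "x \<in> carrier (Qp p)" for x
    using that Q.add.coset_join1[OF _ _ Zp_subgroup, of x] Q.add.coset_join2[OF _ Zp_subgroup, of x]
      subgroup.subset[OF Zp_subgroup]
    by (auto simp: c_def Qp_mod_Zp_def Zp_carrier a_r_coset_def)
  have q_pow: "q x [^]\<^bsub>add_monoid (Qp p)\<^esub> (n::int) = q (of_int n * x)" for x n
  proof -
    have nat: "q x [^]\<^bsub>add_monoid (Qp p)\<^esub> (n::nat) = q (of_nat n * x)" for n
      by (induction n) (simp_all add: q_zero q_add algebra_simps)
    show ?thesis
    proof (cases n rule: int_cases)
      case (nonneg k)
      then show ?thesis using nat by (simp add: int_pow_int)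
    next
      case (neg k)
      have "q x [^]\<^bsub>add_monoid (Qp p)\<^esub> n = inv\<^bsub>add_monoid (Qp p)\<^esub> (q x [^]\<^bsub>add_monoid (Qp p)\<^esub> Suc k)"
        unfolding neg by (rule group.int_pow_neg_int[OF Q.add.is_group]) simp
      also have "\<dots> = \<ominus>\<^bsub>Qp p\<^esub> q (of_nat (Suc k) * x)" unfolding nat by (simp add: a_inv_def)
      also have "\<dots> = q (of_int n * x)" unfolding neg q_uminus by (simp add: algebra_simps)
      finally show ?thesis .
    qed
  qed
  have uf: "unit_fraction n = c (q (1 / of_nat p ^ n))" for n by (simp add: unit_fraction_def c_def)
  have uf_pow: "unit_fraction n [^]\<^bsub>Qp_mod_Zp p\<^esub> (i::int) = c (q (of_int i / of_nat p ^ n))" for n i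
    using h.hom_int_pow[of "q (1 / of_nat p ^ n)" i] by (simp add: uf q_pow)
  show ?thesis
  proof (intro prufer_group.intro comm prufer_group_axioms.intro prime_p)
    show "unit_fraction n \<in> carrier (Qp_mod_Zp p)" for n unfolding uf using h.hom_closed by simp
    show "unit_fraction n [^]\<^bsub>Qp_mod_Zp p\<^esub> i = \<one>\<^bsub>Qp_mod_Zp p\<^esub> \<longleftrightarrow> int p ^ n dvd i" for n i
      unfolding uf_pow using c_one q_in_vball_iff fraction_in_B_0_iff by simp
    fix x k assume x: "x \<in> carrier (Qp_mod_Zp p)" "x [^]\<^bsub>Qp_mod_Zp p\<^esub> (p ^ k) = \<one>\<^bsub>Qp_mod_Zp p\<^esub>"
    then obtain y where y: "y \<in> carrier (Qp p)" "x = c y"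
      by (auto simp: Qp_mod_Zp_def carrier_FactGroup c_def a_r_coset_def)
    \<comment> \<open>Precision 0 suffices, because a difference in the ring of p-adic integers does
      not change the class.\<close>
    obtain i :: int and n where i: "y \<ominus>\<^bsub>Qp p\<^esub> q (of_int i / of_nat p ^ n) \<in> vball (Qp p) (int 0)"
      using approx_q_fraction[OF y(1)] by blast
    define r where "r = (of_int i / of_nat p ^ n :: rat)"
    have "y = (y \<ominus>\<^bsub>Qp p\<^esub> q r) \<oplus>\<^bsub>Qp p\<^esub> q r" using y(1) q_closed[of r] by algebra
    then have "c y = c (y \<ominus>\<^bsub>Qp p\<^esub> q r) \<otimes>\<^bsub>Qp_mod_Zp p\<^esub> c (q r)"
      using h.hom_mult[of "y \<ominus>\<^bsub>Qp p\<^esub> q r" "q r"] y(1) by simp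
    also have "c (y \<ominus>\<^bsub>Qp p\<^esub> q r) = \<one>\<^bsub>Qp_mod_Zp p\<^esub>" using i y(1) c_one by (simp add: r_def)
    finally have xr: "x = c (q r)" using y h.hom_closed[of "q r"] by simp
    have "x [^]\<^bsub>Qp_mod_Zp p\<^esub> int (p ^ k) = \<one>\<^bsub>Qp_mod_Zp p\<^esub>" using x(2) by (simp only: int_pow_int)
    then have "c (q (of_int (int (p ^ k)) * r)) = \<one>\<^bsub>Qp_mod_Zp p\<^esub>"
      unfolding xr using h.hom_int_pow[of "q r" "int (p ^ k)"] by (simp add: q_pow)
    then have "of_int (int (p ^ k)) * r \<in> B 0" using c_one q_in_vball_iff by simp
    then have "of_int (int p ^ k * i) / of_nat p ^ n \<in> B 0" by (simp add: r_def)
    then have "int p ^ n dvd int p ^ k * i" by (simp only: fraction_in_B_0_iff)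
    then obtain j where j: "int p ^ k * i = int p ^ n * j" by blast
    have "(of_int (int p ^ k * i) :: rat) = of_int (int p ^ n * j)" by (simp only: j)
    then have "r = of_int j / of_nat p ^ k" using p_ge_2 by (simp add: r_def field_simps)
    then show "\<exists>j::int. x = unit_fraction k [^]\<^bsub>Qp_mod_Zp p\<^esub> j" using xr uf_pow by blast
  qed
qed

end

text \<open>The binomial coefficients at 2, ..., p - 1 are divisible by p and come with x^2, so
  their terms are absorbed into p * x * (1 + x * w). The identity is proved for integer polynomials,
  where the algebra of type classes is available, and evaluated in record-based rings later.\<close>

lemma one_plus_pow_prime:
  assumes "Factorial_Ring.prime p"
  shows "\<exists>w :: int poly. [:1, 1:] ^ p = 1 + [:0, 1:] ^ p + of_nat p * [:0, 1:] * (1 + [:0, 1:] * w)"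
proof -
  define x :: "int poly" where "x = [:0, 1:]"
  have p2: "2 \<le> p" using assms prime_ge_2_nat by blast
  have "p dvd p choose k" if "2 \<le> k" "k < p" for k
    using that p2 assms by (intro dvd_choose_prime) auto
  then obtain d where d: "\<And>k. 2 \<le> k \<Longrightarrow> k < p \<Longrightarrow> p choose k = p * d k" unfolding dvd_def by metis
  have "[:1, 1:] ^ p = (x + 1) ^ p" by (simp add: x_def one_pCons)
  also have "\<dots> = (\<Sum>k\<le>p. of_nat (p choose k) * x ^ k)" by (simp add: binomial_ring)
  also have "{..p} = {0, 1, p} \<union> {2..<p}" using p2 by auto
  also have "(\<Sum>k\<in>{0, 1, p} \<union> {2..<p}. of_nat (p choose k) * x ^ k)
      = (\<Sum>k\<in>{0, 1, p}. of_nat (p choose k) * x ^ k) + (\<Sum>k\<in>{2..<p}. of_nat (p choose k) * x ^ k)"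
    by (rule sum.union_disjoint) auto
  also have "(\<Sum>k\<in>{0, 1, p}. of_nat (p choose k) * x ^ k) = 1 + of_nat p * x + x ^ p" using p2 by simp
  also have "(\<Sum>k\<in>{2..<p}. of_nat (p choose k) * x ^ k) = (\<Sum>k\<in>{2..<p}. of_nat p * x * x * (of_nat (d k) * x ^ (k - 2)))"
  proof (rule sum.cong)
    fix k assume k: "k \<in> {2..<p}"
    have "x ^ k = x * x * x ^ (k - 2)" using k by (metis atLeastLessThan_iff le_add_diff_inverse power2_eq_square power_add)
    then show "of_nat (p choose k) * x ^ k = of_nat p * x * x * (of_nat (d k) * x ^ (k - 2))"
      using d k by (simp add: mult_ac)
  qed simp
  also have "\<dots> = of_nat p * x * x * (\<Sum>k\<in>{2..<p}. of_nat (d k) * x ^ (k - 2))"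
    by (simp add: sum_distrib_left)
  finally have "[:1, 1:] ^ p = 1 + x ^ p + of_nat p * x * (1 + x * (\<Sum>k\<in>{2..<p}. of_nat (d k) * x ^ (k - 2)))"
    by (simp add: algebra_simps)
  then show ?thesis unfolding x_def by blast
qed

section \<open>Evaluation of integer polynomials in a commutative ring\<close>

context cring
begin

definition int_embed :: "int \<Rightarrow> 'a" where "int_embed n = [n] \<cdot> \<one>"

lemma int_embed_closed [simp]: "int_embed n \<in> carrier R"
  by (simp add: int_embed_def)

lemma int_embed_0 [simp]: "int_embed 0 = \<zero>"
  by (simp add: int_embed_def add_pow_def)

lemma int_embed_1 [simp]: "int_embed 1 = \<one>"
  by (simp add: int_embed_def)

lemma int_embed_add: "int_embed (m + n) = int_embed m \<oplus> int_embed n"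
  by (simp add: int_embed_def add.int_pow_mult)

lemma int_embed_mult: "int_embed (m * n) = int_embed m \<otimes> int_embed n"
proof -
  have "[(m * n)] \<cdot> \<one> = [n] \<cdot> ([m] \<cdot> \<one>)" by (simp add: add.int_pow_pow)
  also have "\<dots> = [n] \<cdot> (int_embed m \<otimes> \<one>)" by (simp add: int_embed_def)
  also have "\<dots> = int_embed m \<otimes> [n] \<cdot> \<one>" by (rule add_pow_rdistr_int[symmetric]) simp_all
  finally show ?thesis by (simp add: int_embed_def)
qed

lemma int_embed_uminus: "int_embed (- n) = \<ominus> int_embed n"
  by (simp add: int_embed_def add.int_pow_neg)

text \<open>Horner evaluation. It carries polynomial identities over to the ring, and its values at
  x are the subring generated by x.\<close>

definition ev :: "'a \<Rightarrow> int poly \<Rightarrow> 'a" where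
  "ev x f = fold_coeffs (\<lambda>c y. int_embed c \<oplus> x \<otimes> y) f \<zero>"

lemma ev_0 [simp]: "ev x 0 = \<zero>"
  by (simp add: ev_def)

lemma ev_pCons: "x \<in> carrier R \<Longrightarrow> ev x (pCons c f) = int_embed c \<oplus> x \<otimes> ev x f"
  by (cases "f = 0"; cases "c = 0") (simp_all add: ev_def)

lemma ev_closed [simp]: "x \<in> carrier R \<Longrightarrow> ev x f \<in> carrier R"
  by (induction f) (simp_all add: ev_pCons)

lemma ev_add: "x \<in> carrier R \<Longrightarrow> ev x (f + g) = ev x f \<oplus> ev x g"
proof (induction f g rule: poly_induct2)
  case (pCons c f d g)
  then have *: "ev x f \<in> carrier R" "ev x g \<in> carrier R" "int_embed c \<in> carrier R" "int_embed d \<in> carrier R" by simp_all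
  have "int_embed c \<oplus> int_embed d \<oplus> x \<otimes> (ev x f \<oplus> ev x g) = int_embed c \<oplus> x \<otimes> ev x f \<oplus> (int_embed d \<oplus> x \<otimes> ev x g)"
    using * pCons.prems by algebra
  then show ?case using pCons by (simp add: ev_pCons int_embed_add)
qed simp

lemma ev_smult: "x \<in> carrier R \<Longrightarrow> ev x (smult c f) = int_embed c \<otimes> ev x f"
proof (induction f)
  case (pCons d f)
  then have *: "ev x f \<in> carrier R" "int_embed c \<in> carrier R" "int_embed d \<in> carrier R" by simp_all
  have "int_embed c \<otimes> int_embed d \<oplus> x \<otimes> (int_embed c \<otimes> ev x f) = int_embed c \<otimes> (int_embed d \<oplus> x \<otimes> ev x f)"
    using * pCons.prems by algebra
  then show ?case using pCons by (simp add: ev_pCons int_embed_mult)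
qed simp

lemma ev_mult: "x \<in> carrier R \<Longrightarrow> ev x (f * g) = ev x f \<otimes> ev x g"
proof (induction f)
  case (pCons d f)
  then have *: "ev x f \<in> carrier R" "ev x g \<in> carrier R" "int_embed d \<in> carrier R" by simp_all
  have "int_embed d \<otimes> ev x g \<oplus> x \<otimes> (ev x f \<otimes> ev x g) = (int_embed d \<oplus> x \<otimes> ev x f) \<otimes> ev x g"
    using * pCons.prems by algebra
  then show ?case using pCons by (simp add: ev_pCons ev_add ev_smult)
qed simp

lemma ev_const [simp]: "x \<in> carrier R \<Longrightarrow> ev x [:c:] = int_embed c"
  by (simp add: ev_pCons)

lemma ev_1 [simp]: "x \<in> carrier R \<Longrightarrow> ev x 1 = \<one>"
  by (simp add: one_pCons)

lemma ev_of_nat: "x \<in> carrier R \<Longrightarrow> ev x (of_nat n) = int_embed (int n)"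
  by (simp add: of_nat_poly)

lemma ev_var [simp]: "x \<in> carrier R \<Longrightarrow> ev x [:0, 1:] = x"
  by (simp add: ev_pCons)

lemma ev_power: "x \<in> carrier R \<Longrightarrow> ev x (f ^ n) = ev x f [^] n"
  by (induction n) (simp_all add: ev_mult m_comm)

lemma one_plus_pow:
  assumes "Factorial_Ring.prime p"
  shows "\<exists>w. \<forall>x\<in>carrier R. (\<one> \<oplus> x) [^] p = \<one> \<oplus> x [^] p \<oplus> int_embed (int p) \<otimes> x \<otimes> (\<one> \<oplus> x \<otimes> ev x w)"
proof -
  obtain w :: "int poly" where w: "[:1, 1:] ^ p = 1 + [:0, 1:] ^ p + of_nat p * [:0, 1:] * (1 + [:0, 1:] * w)"
    using one_plus_pow_prime[OF assms] by blast
  have "(\<one> \<oplus> x) [^] p = \<one> \<oplus> x [^] p \<oplus> int_embed (int p) \<otimes> x \<otimes> (\<one> \<oplus> x \<otimes> ev x w)" if x: "x \<in> carrier R" for x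
  proof -
    have "(\<one> \<oplus> x) [^] p = ev x ([:1, 1:] ^ p)" using x by (simp add: ev_power ev_pCons)
    also have "\<dots> = \<one> \<oplus> x [^] p \<oplus> int_embed (int p) \<otimes> x \<otimes> (\<one> \<oplus> x \<otimes> ev x w)"
      unfolding w using x by (simp only: ev_add ev_mult ev_power ev_1 ev_var ev_of_nat)
    finally show ?thesis .
  qed
  then show ?thesis by blast
qed

end

section \<open>Valuations in totally ramified extensions\<close>

context local_field
begin

section \<open>Balls and valuations in a local field\<close>

abbreviation B :: "int \<Rightarrow> 'a set" where "B k \<equiv> vball K k"

lemma B_carrier: "x \<in> B k \<Longrightarrow> x \<in> carrier K"
  by (simp add: vball_def)

lemma B_zero [simp]: "\<zero> \<in> B k"
  by (simp add: vball_def)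

lemma B_iff: "x \<in> carrier K \<Longrightarrow> x \<noteq> \<zero> \<Longrightarrow> x \<in> B k \<longleftrightarrow> k \<le> val K x"
  by (simp add: vball_def)

lemma B_antimono: "k \<le> l \<Longrightarrow> x \<in> B l \<Longrightarrow> x \<in> B k"
  by (auto simp: vball_def)

lemma val_one: "val K \<one> = 0"
  using val_mult[of \<one> \<one>] by simp

lemma val_minus_one: "val K (\<ominus> \<one>) = 0"
proof -
  have "\<ominus> \<one> \<noteq> \<zero>" using minus_minus[OF one_closed] minus_zero one_not_zero by metis
  then have nz: "\<ominus> \<one> \<in> carrier K - {\<zero>}" by simp
  have "val K (\<ominus> \<one> \<otimes> \<ominus> \<one>) = val K (\<ominus> \<one>) + val K (\<ominus> \<one>)" by (rule val_mult[OF nz nz])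
  moreover have "\<ominus> \<one> \<otimes> \<ominus> \<one> = \<one>" by (simp add: l_minus)
  ultimately show ?thesis using val_one by simp
qed

lemma B_mult: "x \<in> B k \<Longrightarrow> y \<in> B l \<Longrightarrow> x \<otimes> y \<in> B (k + l)"
  using val_mult[of x y] by (cases "x = \<zero>"; cases "y = \<zero>") (auto simp: vball_def)

lemma B_add: "x \<in> B k \<Longrightarrow> y \<in> B k \<Longrightarrow> x \<oplus> y \<in> B k"
  using val_add[of x y] by (fastforce simp: vball_def)

lemma B_one: "\<one> \<in> B 0"
  by (simp add: vball_def val_one)

lemma B_uminus: "x \<in> B k \<Longrightarrow> \<ominus> x \<in> B k"
proof -
  assume x: "x \<in> B k"
  have "\<ominus> \<one> \<in> B 0" by (simp add: vball_def val_minus_one)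
  then have "\<ominus> \<one> \<otimes> x \<in> B (0 + k)" using x by (rule B_mult)
  then show ?thesis using B_carrier[OF x] by (simp add: l_minus)
qed

lemma B_diff: "x \<in> B k \<Longrightarrow> y \<in> B k \<Longrightarrow> x \<ominus> y \<in> B k"
  by (simp add: a_minus_def B_add B_uminus)

lemma B_diff_trans: "x \<ominus> y \<in> B k \<Longrightarrow> y \<ominus> z \<in> B k \<Longrightarrow>
    x \<in> carrier K \<Longrightarrow> y \<in> carrier K \<Longrightarrow> z \<in> carrier K \<Longrightarrow> x \<ominus> z \<in> B k"
proof -
  assume *: "x \<ominus> y \<in> B k" "y \<ominus> z \<in> B k" "x \<in> carrier K" "y \<in> carrier K" "z \<in> carrier K"
  have "(x \<ominus> y) \<oplus> (y \<ominus> z) = x \<ominus> z" using *(3-5) by algebra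
  then show ?thesis using B_add[OF *(1,2)] by simp
qed

lemma B_diff_commute: "x \<ominus> y \<in> B k \<Longrightarrow> x \<in> carrier K \<Longrightarrow> y \<in> carrier K \<Longrightarrow> y \<ominus> x \<in> B k"
proof -
  assume *: "x \<ominus> y \<in> B k" "x \<in> carrier K" "y \<in> carrier K"
  have "\<ominus> (x \<ominus> y) = y \<ominus> x" using *(2-3) by algebra
  then show ?thesis using B_uminus[OF *(1)] by simp
qed

lemma B_diff_mem: "x \<ominus> y \<in> B k \<Longrightarrow> y \<in> B k \<Longrightarrow> x \<in> carrier K \<Longrightarrow> x \<in> B k"
proof -
  assume *: "x \<ominus> y \<in> B k" "y \<in> B k" "x \<in> carrier K"
  have "(x \<ominus> y) \<oplus> y = x" using *(3) B_carrier[OF *(2)] by algebra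
  then show ?thesis using B_add[OF *(1,2)] by simp
qed

lemma B_pow: "x \<in> B k \<Longrightarrow> x [^] (n::nat) \<in> B (int n * k)"
proof (induction n)
  case (Suc n)
  then have "x [^] n \<otimes> x \<in> B (int n * k + k)" by (intro B_mult) auto
  then show ?case by (simp add: algebra_simps)
qed (simp add: B_one)

lemma int_embed_mem: "int_embed n \<in> B 0"
proof -
  have nat: "int_embed (int n) \<in> B 0" for n
    by (induction n) (simp_all add: int_embed_add B_add B_one)
  show ?thesis
  proof (cases n rule: int_cases)
    case (neg k)
    then show ?thesis unfolding neg int_embed_uminus by (intro B_uminus nat)
  qed (simp add: nat)
qed

lemma ev_mem: "x \<in> B 0 \<Longrightarrow> ev x f \<in> B 0"
proof (induction f)
  case (pCons c f)
  then have "x \<otimes> ev x f \<in> B (0 + 0)" by (intro B_mult) auto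
  then show ?case using pCons.prems B_carrier by (simp add: ev_pCons B_add int_embed_mem)
qed simp

lemma B_all_zero: "(\<And>k::nat. x \<in> B (int k)) \<Longrightarrow> x = \<zero>"
proof (rule ccontr)
  assume *: "\<And>k::nat. x \<in> B (int k)" and "x \<noteq> \<zero>"
  then have "int k \<le> val K x" for k using *[of k] by (simp add: vball_def)
  from this[of "nat (val K x + 1)"] show False by (simp split: if_splits)
qed

lemma inv_mem: "x \<in> carrier K \<Longrightarrow> x \<noteq> \<zero> \<Longrightarrow> inv x \<in> carrier K \<and> inv x \<noteq> \<zero> \<and> x \<otimes> inv x = \<one>"
proof -
  assume x: "x \<in> carrier K" "x \<noteq> \<zero>"
  then have "x \<in> Units K" by (simp add: field_Units)
  then have *: "inv x \<in> carrier K" "x \<otimes> inv x = \<one>" by simp_all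
  moreover have "inv x \<noteq> \<zero>" using * x by force
  ultimately show ?thesis by simp
qed

lemma val_inv: "x \<in> carrier K \<Longrightarrow> x \<noteq> \<zero> \<Longrightarrow> val K (inv x) = - val K x"
  using inv_mem[of x] val_mult[of x "inv x"] val_one by simp

lemma inv_in_B: "x \<in> carrier K \<Longrightarrow> x \<noteq> \<zero> \<Longrightarrow> inv x \<in> B (- val K x)"
  using inv_mem[of x] val_inv[of x] by (simp add: B_iff)

lemma val_self: "x \<in> carrier K \<Longrightarrow> x \<in> B (val K x)"
  by (auto simp: vball_def)

lemma nonzero_mult: "x \<in> carrier K \<Longrightarrow> y \<in> carrier K \<Longrightarrow> x \<noteq> \<zero> \<Longrightarrow> y \<noteq> \<zero> \<Longrightarrow> x \<otimes> y \<noteq> \<zero>"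
  using integral_iff by blast

lemma nonzero_pow: "x \<in> carrier K \<Longrightarrow> x \<noteq> \<zero> \<Longrightarrow> x [^] (n::nat) \<noteq> \<zero> \<and> val K (x [^] n) = int n * val K x"
proof (induction n)
  case (Suc n)
  then have "x [^] n \<otimes> x \<noteq> \<zero>" using nonzero_mult[of "x [^] n" x] by simp
  then show ?case using Suc val_mult[of "x [^] n" x] by (simp add: algebra_simps)
qed (simp add: val_one)

lemma val_eqI: "x \<in> B k \<Longrightarrow> x \<notin> B (k + 1) \<Longrightarrow> x \<noteq> \<zero> \<and> val K x = k"
  by (auto simp: vball_def)

lemma val_close:
  assumes "x \<in> carrier K" "x \<noteq> \<zero>" "y \<in> carrier K" "x \<ominus> y \<in> B (val K x + 1)"
  shows "y \<noteq> \<zero> \<and> val K y = val K x"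
proof (rule val_eqI)
  have d: "y \<ominus> x \<in> B (val K x + 1)" using B_diff_commute[OF assms(4,1,3)] .
  then have "y \<ominus> x \<in> B (val K x)" using B_antimono[of "val K x" "val K x + 1"] by simp
  then show "y \<in> B (val K x)" using B_diff_mem[OF _ val_self] assms by blast
  show "y \<notin> B (val K x + 1)"
  proof
    assume "y \<in> B (val K x + 1)"
    then have "x \<in> B (val K x + 1)" using B_diff_mem[OF assms(4)] assms by blast
    then show False using assms by (simp add: vball_def)
  qed
qed

lemma val_sum_distinct:
  assumes "x \<in> carrier K" "x \<noteq> \<zero>" "y \<in> carrier K" "y \<noteq> \<zero>" "val K x < val K y"
  shows "x \<oplus> y \<noteq> \<zero> \<and> val K (x \<oplus> y) = val K x"
proof (rule val_close)
  have "x \<ominus> (x \<oplus> y) = \<ominus> y" using assms(1,3) by algebra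
  moreover have "\<ominus> y \<in> B (val K x + 1)" using assms by (intro B_uminus) (simp add: vball_def)
  ultimately show "x \<ominus> (x \<oplus> y) \<in> B (val K x + 1)" by simp
qed (use assms in auto)

lemma val_exists: "\<exists>x\<in>carrier K. x \<noteq> \<zero> \<and> val K x = k"
proof -
  have "k \<in> val K ` (carrier K - {\<zero>})" using val_surj by simp
  then show ?thesis by blast
qed

text \<open>With y of valuation 1, every x in the next ball is the single product of x / y and y;
  the other inclusion is additivity of the valuation together with closure of balls under
  sums.\<close>

lemma max_ideal_pow: "max_ideal K [^]\<^bsub>ideals_set (valuation_ring K)\<^esub> (n::nat) = B (int n)"
proof (induction n)
  case 0
  then show ?case by (simp add: ideals_set_def valuation_ring_def)
next
  case (Suc n)
  have "max_ideal K [^]\<^bsub>ideals_set (valuation_ring K)\<^esub> Suc n = ideal_prod (valuation_ring K) (B (int n)) (B 1)"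
    using Suc by (simp add: ideals_set_def max_ideal_def)
  also have "\<dots> = B (int (Suc n))"
  proof (intro equalityI subsetI)
    fix x assume "x \<in> ideal_prod (valuation_ring K) (B (int n)) (B 1)"
    then show "x \<in> B (int (Suc n))"
    proof induction
      case (prod i j)
      then show ?case using B_mult[of i "int n" j 1] by (simp add: valuation_ring_def add.commute)
    next
      case (sum s1 s2)
      then show ?case by (simp add: valuation_ring_def B_add)
    qed
  next
    fix x assume x: "x \<in> B (int (Suc n))"
    obtain y where y: "y \<in> carrier K" "y \<noteq> \<zero>" "val K y = 1" using val_exists by blast
    have "x \<otimes> inv y \<in> B (int (Suc n) + - 1)" using x inv_in_B[of y] y by (intro B_mult) auto
    moreover have "y \<in> B 1" using y by (simp add: vball_def)
    ultimately have "(x \<otimes> inv y) \<otimes>\<^bsub>valuation_ring K\<^esub> y \<in> ideal_prod (valuation_ring K) (B (int n)) (B 1)"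
      by (intro ideal_prod.prod) simp_all
    moreover have "(x \<otimes> inv y) \<otimes> y = x"
      using inv_mem[OF y(1,2)] y(1) B_carrier[OF x] by (metis m_assoc m_comm r_one)
    ultimately show "x \<in> ideal_prod (valuation_ring K) (B (int n)) (B 1)" by (simp add: valuation_ring_def)
  qed
  finally show ?case .
qed

lemma principal_units_iff: "u \<in> principal_units K i \<longleftrightarrow> u \<in> carrier K \<and> u \<ominus> \<one> \<in> B (int i)"
proof
  assume "u \<in> principal_units K i"
  then obtain x where x: "x \<in> B (int i)" "u = \<one> \<oplus> x" by (auto simp: principal_units_def max_ideal_pow)
  then have xc: "x \<in> carrier K" by (simp add: B_carrier)
  have "u \<ominus> \<one> = x" using xc unfolding x(2) by algebra
  then show "u \<in> carrier K \<and> u \<ominus> \<one> \<in> B (int i)" using x xc by simp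
next
  assume u: "u \<in> carrier K \<and> u \<ominus> \<one> \<in> B (int i)"
  have "u = \<one> \<oplus> (u \<ominus> \<one>)" using u by algebra
  then show "u \<in> principal_units K i" using u by (auto simp: principal_units_def max_ideal_pow)
qed

end

locale totally_ramified_field = local_field K
  for K :: "('a, 'm) valued_field_scheme" (structure) +
  fixes p :: nat and \<iota> :: "padic \<Rightarrow> 'a" and \<zeta> :: 'a
  assumes prime_p: "Factorial_Ring.prime p"
    and ext: "valued_extension (Qp p) K \<iota>"
    and root: "primitive_root_of_unity K p \<zeta>"
    and ram: "totally_ramified K (generate_field K (insert \<zeta> (\<iota> ` carrier (Qp p))))"
begin

sublocale P: padic p
  by unfold_locales (rule prime_p)

definition L where "L = generate_field K (insert \<zeta> (\<iota> ` carrier (Qp p)))"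

interpretation Q: cring "Qp p" by (rule P.cring_Qp)

lemma \<iota>_hom: "ring_hom_cring (Qp p) K \<iota>"
  using ext is_cring P.cring_Qp
  by (simp add: valued_extension_def ring_hom_cring_def ring_hom_cring_axioms_def)

interpretation \<iota>: ring_hom_cring "Qp p" K \<iota> by (rule \<iota>_hom)

lemma \<iota>_of_nat: "\<iota> (P.q (of_nat n)) = int_embed (int n)"
proof (induction n)
  case 0
  then show ?case by (simp add: P.q_zero)
next
  case (Suc n)
  then show ?case
    using \<iota>.hom_add[of "P.q 1" "P.q (of_nat n)"] \<iota>.hom_one P.q_closed
    unfolding P.q_add by (simp add: int_embed_add P.q_one)
qed

lemma \<iota>_mem: "x \<in> vball (Qp p) (int k) \<Longrightarrow> \<iota> x \<in> B (int k)"
proof (cases "x = \<zero>\<^bsub>Qp p\<^esub>")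
  case False
  assume x: "x \<in> vball (Qp p) (int k)"
  obtain e :: nat where e: "0 < e" "\<And>y. y \<in> carrier (Qp p) - {\<zero>\<^bsub>Qp p\<^esub>} \<Longrightarrow> val K (\<iota> y) = int e * val (Qp p) y"
    using ext by (auto simp: valued_extension_def)
  have *: "x \<in> carrier (Qp p)" "int k \<le> val (Qp p) x" using x False by (auto simp: vball_def)
  have "int k = 1 * int k" by simp
  also have "\<dots> \<le> int e * val (Qp p) x" using e(1) * by (intro mult_mono) auto
  also have "\<dots> = val K (\<iota> x)" using e(2)[of x] False *(1) by simp
  finally show ?thesis using *(1) by (simp add: vball_def)
qed simp

text \<open>The absolute ramification index of K.\<close>

definition e :: int where "e = val K (int_embed (int p))"

lemma p_nonzero: "int_embed (int p) \<noteq> \<zero>" and e_pos: "1 \<le> e"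
proof -
  have p0: "(of_nat p :: rat) \<noteq> 0" using P.p_ge_2 by simp
  have val: "padic_val p (of_nat p) = 1"
    using P.padic_val_of_int[of "int p"] P.p_ge_2 P.not_unit_p by (simp add: multiplicity_self)
  obtain e0 :: nat where e0: "0 < e0" "\<And>y. y \<in> carrier (Qp p) - {\<zero>\<^bsub>Qp p\<^esub>} \<Longrightarrow> val K (\<iota> y) = int e0 * val (Qp p) y"
    using ext by (auto simp: valued_extension_def)
  have "val K (\<iota> (P.q (of_nat p))) = int e0 * 1"
    using e0(2)[of "P.q (of_nat p)"] P.q_nonzero[OF p0] P.q_val[OF p0] val by simp
  then have "e = int e0" by (simp add: e_def \<iota>_of_nat)
  then show "1 \<le> e" using e0 by simp
  define y where "y = P.q (1 / of_nat p)"
  have y: "y \<in> carrier (Qp p)" by (simp add: y_def)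
  have "P.q (of_nat p) \<otimes>\<^bsub>Qp p\<^esub> y = \<one>\<^bsub>Qp p\<^esub>" using p0 by (simp add: y_def P.q_mult P.q_one)
  then have "\<iota> (P.q (of_nat p)) \<otimes> \<iota> y = \<one>" using \<iota>.hom_mult[of "P.q (of_nat p)" y] y by simp
  then show "int_embed (int p) \<noteq> \<zero>" using y by (auto simp: \<iota>_of_nat)
qed

lemma p_mem: "int_embed (int p) \<in> B e"
  unfolding e_def by (rule val_self) simp

lemma dvd_mem: "int p dvd n \<Longrightarrow> int_embed n \<in> B e"
proof -
  assume "int p dvd n"
  then obtain m where "n = int p * m" by blast
  then show ?thesis using B_mult[OF p_mem int_embed_mem, of m] by (simp add: int_embed_mult)
qed

lemma int_embed_unit: "\<not> int p dvd n \<Longrightarrow> int_embed n \<notin> B 1"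
proof
  assume n: "\<not> int p dvd n" "int_embed n \<in> B 1"
  then have "coprime (int p) n" using prime_p by (simp add: prime_imp_coprime)
  then obtain u v where uv: "u * int p + v * n = 1" using bezout_int[of "int p" n] by auto
  have "int_embed (u * int p) \<in> B 1" using dvd_mem[of "u * int p"] e_pos B_antimono by auto
  moreover have "int_embed (v * n) \<in> B 1" using B_mult[OF int_embed_mem n(2), of v] by (simp add: int_embed_mult)
  ultimately have "int_embed (u * int p + v * n) \<in> B 1" unfolding int_embed_add by (rule B_add)
  then have "\<one> \<in> B 1" using uv by simp
  then show False using val_one by (simp add: vball_def)
qed

section \<open>The element \<zeta> - 1 and its valuation\<close>

definition \<pi> :: 'a where "\<pi> = \<zeta> \<ominus> \<one>"

lemma \<zeta>_carrier: "\<zeta> \<in> carrier K" and \<zeta>_pow: "\<zeta> [^] p = \<one>" and \<zeta>_ne_1: "\<zeta> \<noteq> \<one>"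
  using root P.p_ge_2 by (auto simp: primitive_root_of_unity_def dest: spec[of _ 1])

lemma \<pi>_carrier [simp]: "\<pi> \<in> carrier K"
  by (simp add: \<pi>_def \<zeta>_carrier)

lemma \<pi>_nonzero: "\<pi> \<noteq> \<zero>"
  using \<zeta>_ne_1 \<zeta>_carrier by (simp add: \<pi>_def)

lemma \<zeta>_eq: "\<zeta> = \<one> \<oplus> \<pi>"
  unfolding \<pi>_def using \<zeta>_carrier by algebra

definition a :: nat where "a = nat (val K \<pi>)"

lemma \<pi>_pow_eq: "\<exists>w. \<pi> [^] p = \<ominus> (int_embed (int p) \<otimes> \<pi> \<otimes> (\<one> \<oplus> \<pi> \<otimes> ev \<pi> w))"
proof -
  obtain w where "(\<one> \<oplus> \<pi>) [^] p = \<one> \<oplus> \<pi> [^] p \<oplus> int_embed (int p) \<otimes> \<pi> \<otimes> (\<one> \<oplus> \<pi> \<otimes> ev \<pi> w)"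
    using one_plus_pow[OF prime_p] \<pi>_carrier by blast
  then have "\<one> \<oplus> \<pi> [^] p \<oplus> int_embed (int p) \<otimes> \<pi> \<otimes> (\<one> \<oplus> \<pi> \<otimes> ev \<pi> w) = \<one>"
    using \<zeta>_pow \<zeta>_eq by simp
  moreover define r where "r = int_embed (int p) \<otimes> \<pi> \<otimes> (\<one> \<oplus> \<pi> \<otimes> ev \<pi> w)"
  moreover have "r \<in> carrier K" "\<pi> [^] p \<in> carrier K" by (simp_all add: r_def)
  ultimately have "\<pi> [^] p \<oplus> r = \<zero>" by (metis a_assoc a_closed add.r_cancel_one one_closed a_comm)
  then have "\<pi> [^] p = \<ominus> r" using \<open>r \<in> carrier K\<close> by (intro sum_zero_eq_neg) auto
  then show ?thesis unfolding r_def by blast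
qed

text \<open>\<zeta> is a unit, so \<pi> is integral; then \<open>\<pi>_pow_eq\<close> makes \<pi>^p
  divisible by p, which gives positive valuation. Now the bracket in that equation is a unit, and
  comparing valuations yields p * a = e + a.\<close>

lemma \<pi>_val: "val K \<pi> = int a" and a_pos: "0 < a" and e_eq: "e = int ((p - 1) * a)"
proof -
  obtain w where w: "\<pi> [^] p = \<ominus> (int_embed (int p) \<otimes> \<pi> \<otimes> (\<one> \<oplus> \<pi> \<otimes> ev \<pi> w))" using \<pi>_pow_eq by blast
  have "0 \<le> val K \<pi>"
  proof -
    have "\<zeta> \<noteq> \<zero>" using \<zeta>_pow P.p_ge_2 by (metis nat_pow_zero one_not_zero not_numeral_le_zero)
    then have "int p * val K \<zeta> = 0" using nonzero_pow[OF \<zeta>_carrier, of p] \<zeta>_pow val_one by simp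
    then have "\<zeta> \<in> B 0" using \<zeta>_carrier P.p_ge_2 by (simp add: vball_def)
    then have "\<pi> \<in> B 0" unfolding \<pi>_def by (intro B_diff B_one)
    then show ?thesis using \<pi>_nonzero by (simp add: vball_def)
  qed
  then have \<pi>0: "\<pi> \<in> B 0" by (simp add: vball_def)
  have w0: "ev \<pi> w \<in> B 0" using \<pi>0 by (rule ev_mem)
  have "\<one> \<oplus> \<pi> \<otimes> ev \<pi> w \<in> B 0" using B_mult[OF \<pi>0 w0] by (simp add: B_add B_one)
  then have "int_embed (int p) \<otimes> \<pi> \<otimes> (\<one> \<oplus> \<pi> \<otimes> ev \<pi> w) \<in> B (e + 0 + 0)"
    using \<pi>0 p_mem by (intro B_mult)
  then have "\<pi> [^] p \<in> B 1" unfolding w using e_pos B_antimono[of 1 e] by (auto intro: B_uminus)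
  moreover have "\<pi> [^] p \<noteq> \<zero>" "val K (\<pi> [^] p) = int p * val K \<pi>"
    using nonzero_pow[OF \<pi>_carrier \<pi>_nonzero, of p] by auto
  ultimately have "1 \<le> int p * val K \<pi>" by (simp add: vball_def)
  then have "val K \<pi> \<noteq> 0" by auto
  then have pos: "1 \<le> val K \<pi>" using \<open>0 \<le> val K \<pi>\<close> by simp
  then show val: "val K \<pi> = int a" and "0 < a" by (simp_all add: a_def)
  have "\<pi> \<otimes> ev \<pi> w \<in> B (1 + 0)" using pos w0 by (intro B_mult) (simp_all add: vball_def)
  then have "\<one> \<ominus> (\<one> \<oplus> \<pi> \<otimes> ev \<pi> w) \<in> B 1"
  proof -
    have "\<one> \<ominus> (\<one> \<oplus> \<pi> \<otimes> ev \<pi> w) = \<ominus> (\<pi> \<otimes> ev \<pi> w)"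
      using ev_closed[OF \<pi>_carrier, of w] \<pi>_carrier by algebra
    then show ?thesis using \<open>\<pi> \<otimes> ev \<pi> w \<in> B (1 + 0)\<close> by (simp add: B_uminus)
  qed
  then have u: "\<one> \<oplus> \<pi> \<otimes> ev \<pi> w \<noteq> \<zero>" "val K (\<one> \<oplus> \<pi> \<otimes> ev \<pi> w) = 0"
    using val_close[of \<one> "\<one> \<oplus> \<pi> \<otimes> ev \<pi> w"] val_one by auto
  have "val K (int_embed (int p) \<otimes> \<pi> \<otimes> (\<one> \<oplus> \<pi> \<otimes> ev \<pi> w)) = e + int a + 0"
    using u p_nonzero \<pi>_nonzero val nonzero_mult[of "int_embed (int p)" \<pi>]
      val_mult[of "int_embed (int p)" \<pi>] val_mult[of "int_embed (int p) \<otimes> \<pi>" "\<one> \<oplus> \<pi> \<otimes> ev \<pi> w"]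
    by (simp add: e_def)
  moreover have "val K (\<ominus> x) = val K x" if "x \<in> carrier K" "x \<noteq> \<zero>" for x
    using val_mult[of "\<ominus> \<one>" x] that val_minus_one add.inv_eq_1_iff[of \<one>] by (simp add: l_minus)
  moreover have "int_embed (int p) \<otimes> \<pi> \<otimes> (\<one> \<oplus> \<pi> \<otimes> ev \<pi> w) \<noteq> \<zero>"
    using u p_nonzero \<pi>_nonzero by (intro nonzero_mult) auto
  ultimately have "int p * int a = e + int a"
    using \<open>val K (\<pi> [^] p) = int p * val K \<pi>\<close> val unfolding w by simp
  then show "e = int ((p - 1) * a)" using P.p_ge_2 by (simp add: of_nat_diff algebra_simps)
qed

lemma \<pi>_mem: "\<pi> \<in> B (int a)" "\<pi> \<in> B 1" "\<pi> \<in> B 0"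
  using \<pi>_val a_pos by (simp_all add: vball_def)

end

section \<open>The residue field\<close>

context totally_ramified_field
begin

interpretation Q: cring "Qp p" by (rule P.cring_Qp)
interpretation \<iota>: ring_hom_cring "Qp p" K \<iota> by (rule \<iota>_hom)

text \<open>The ring Z[\<pi>, 1/\<pi>]. Its closure \<open>S\<close> stands in for Qp(\<zeta>):
  elements of \<open>laurent\<close> have explicit leading terms, and no degree over Qp has to be
  computed.\<close>

definition laurent :: "'a set" where
  "laurent = {ev \<pi> f \<otimes> inv \<pi> [^] (j::nat) | f j. True}"

lemma inv_\<pi>: "inv \<pi> \<in> carrier K" "inv \<pi> \<noteq> \<zero>" "\<pi> \<otimes> inv \<pi> = \<one>" "val K (inv \<pi>) = - int a"
  using inv_mem[of \<pi>] val_inv[of \<pi>] \<pi>_nonzero \<pi>_val by auto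

lemma \<pi>_cancel: "\<pi> [^] (j::nat) \<otimes> inv \<pi> [^] j = \<one>"
  using inv_\<pi> by (simp flip: nat_pow_distrib)

lemma laurent_carrier: "x \<in> laurent \<Longrightarrow> x \<in> carrier K"
  using inv_\<pi> by (auto simp: laurent_def)

lemma laurent_I: "ev \<pi> f \<otimes> inv \<pi> [^] (j::nat) \<in> laurent"
  by (auto simp: laurent_def)

lemma laurent_ev: "ev \<pi> f \<in> laurent"
  using laurent_I[of f 0] by simp

lemma laurent_add: "x \<in> laurent \<Longrightarrow> y \<in> laurent \<Longrightarrow> x \<oplus> y \<in> laurent"
proof -
  assume "x \<in> laurent" "y \<in> laurent"
  then obtain f j g l where xy: "x = ev \<pi> f \<otimes> inv \<pi> [^] (j::nat)" "y = ev \<pi> g \<otimes> inv \<pi> [^] (l::nat)"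
    by (auto simp: laurent_def)
  define F G A B C D where "F = ev \<pi> f" and "G = ev \<pi> g" and "A = inv \<pi> [^] j" and "B = inv \<pi> [^] l"
    and "C = \<pi> [^] l" and "D = \<pi> [^] j"
  have c: "F \<in> carrier K" "G \<in> carrier K" "A \<in> carrier K" "B \<in> carrier K" "C \<in> carrier K" "D \<in> carrier K"
    using inv_\<pi> by (simp_all add: F_def G_def A_def B_def C_def D_def)
  have 1: "C \<otimes> B = \<one>" "D \<otimes> A = \<one>" using \<pi>_cancel by (simp_all add: A_def B_def C_def D_def)
  have "ev \<pi> (f * [:0, 1:] ^ l + g * [:0, 1:] ^ j) \<otimes> inv \<pi> [^] (j + l) = (F \<otimes> C \<oplus> G \<otimes> D) \<otimes> (A \<otimes> B)"
    using inv_\<pi> by (simp add: ev_add ev_mult ev_power F_def G_def A_def B_def C_def D_def nat_pow_mult)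
  also have "\<dots> = F \<otimes> A \<otimes> (C \<otimes> B) \<oplus> G \<otimes> B \<otimes> (D \<otimes> A)" using c by algebra
  also have "\<dots> = F \<otimes> A \<oplus> G \<otimes> B" unfolding 1 using c by simp
  also have "\<dots> = x \<oplus> y" by (simp add: xy F_def G_def A_def B_def)
  finally show ?thesis using laurent_I by metis
qed

lemma laurent_mult: "x \<in> laurent \<Longrightarrow> y \<in> laurent \<Longrightarrow> x \<otimes> y \<in> laurent"
proof -
  assume "x \<in> laurent" "y \<in> laurent"
  then obtain f j g l where xy: "x = ev \<pi> f \<otimes> inv \<pi> [^] (j::nat)" "y = ev \<pi> g \<otimes> inv \<pi> [^] (l::nat)"
    by (auto simp: laurent_def)
  have "x \<otimes> y = ev \<pi> (f * g) \<otimes> inv \<pi> [^] (j + l)"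
    using inv_\<pi> unfolding xy by (simp add: ev_mult m_ac flip: nat_pow_mult)
  then show ?thesis using laurent_I by metis
qed

lemma laurent_int: "int_embed n \<in> laurent"
  using laurent_ev[of "[:n:]"] by simp

lemma laurent_\<pi>: "\<pi> [^] (j::nat) \<otimes> inv \<pi> [^] (l::nat) \<in> laurent"
  using laurent_I[of "[:0, 1:] ^ j" l] by (simp add: ev_power)

definition S :: "'a set" where
  "S = {x \<in> carrier K. \<forall>k. \<exists>z\<in>laurent. x \<ominus> z \<in> B k}"

lemma S_carrier: "x \<in> S \<Longrightarrow> x \<in> carrier K"
  by (simp add: S_def)

lemma S_laurent: "z \<in> laurent \<Longrightarrow> z \<in> S"
  using laurent_carrier[of z] by (auto simp: S_def a_minus_def r_neg intro!: bexI[of _ z])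

lemma S_limit: "x \<in> carrier K \<Longrightarrow> (\<And>k. \<exists>z\<in>S. x \<ominus> z \<in> B k) \<Longrightarrow> x \<in> S"
proof -
  assume x: "x \<in> carrier K" and lim: "\<And>k. \<exists>z\<in>S. x \<ominus> z \<in> B k"
  have "\<exists>z\<in>laurent. x \<ominus> z \<in> B k" for k
  proof -
    obtain z where z: "z \<in> S" "x \<ominus> z \<in> B k" using lim by blast
    then obtain w where w: "w \<in> laurent" "z \<ominus> w \<in> B k" by (auto simp: S_def)
    then show ?thesis using B_diff_trans[OF z(2) w(2) x S_carrier[OF z(1)] laurent_carrier[OF w(1)]] by blast
  qed
  then show ?thesis using x by (simp add: S_def)
qed

lemma S_add: "x \<in> S \<Longrightarrow> y \<in> S \<Longrightarrow> x \<oplus> y \<in> S"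
proof (rule S_limit)
  assume *: "x \<in> S" "y \<in> S"
  then have c: "x \<in> carrier K" "y \<in> carrier K" by (auto simp: S_def)
  then show "x \<oplus> y \<in> carrier K" by simp
  fix k
  obtain z w where zw: "z \<in> laurent" "x \<ominus> z \<in> B k" "w \<in> laurent" "y \<ominus> w \<in> B k"
    using * by (auto simp: S_def) blast
  have "z \<in> carrier K" "w \<in> carrier K" using zw laurent_carrier by auto
  then have "(x \<oplus> y) \<ominus> (z \<oplus> w) = (x \<ominus> z) \<oplus> (y \<ominus> w)" using c by algebra
  then show "\<exists>z\<in>S. (x \<oplus> y) \<ominus> z \<in> B k"
    using zw laurent_add S_laurent B_add[OF zw(2,4)] by (intro bexI[of _ "z \<oplus> w"]) auto
qed

lemma S_mult: "x \<in> S \<Longrightarrow> y \<in> S \<Longrightarrow> x \<otimes> y \<in> S"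
proof (rule S_limit)
  assume *: "x \<in> S" "y \<in> S"
  then have c: "x \<in> carrier K" "y \<in> carrier K" by (auto simp: S_def)
  then show "x \<otimes> y \<in> carrier K" by simp
  fix k
  \<comment> \<open>The first bound controls x * (y - w). The second keeps w in the ball of y, from
    which the bound for (x - z) * w follows.\<close>
  obtain w where w: "w \<in> laurent" "y \<ominus> w \<in> B (max (k - val K x) (val K y))" using * by (auto simp: S_def)
  obtain z where z: "z \<in> laurent" "x \<ominus> z \<in> B (k - val K y)" using * by (auto simp: S_def)
  have zw: "z \<in> carrier K" "w \<in> carrier K" using z w laurent_carrier by auto
  have yw: "y \<ominus> w \<in> B (k - val K x)" "y \<ominus> w \<in> B (val K y)" using B_antimono[OF _ w(2)] by auto
  have "w \<in> B (val K y)"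
    using B_diff_mem[OF B_diff_commute[OF yw(2)] val_self] c zw by blast
  then have 1: "(x \<ominus> z) \<otimes> w \<in> B (k - val K y + val K y)" by (rule B_mult[OF z(2)])
  have 2: "x \<otimes> (y \<ominus> w) \<in> B (val K x + (k - val K x))" using val_self[OF c(1)] yw(1) by (rule B_mult)
  have "(x \<otimes> y) \<ominus> (z \<otimes> w) = x \<otimes> (y \<ominus> w) \<oplus> (x \<ominus> z) \<otimes> w" using c zw by algebra
  then have "(x \<otimes> y) \<ominus> (z \<otimes> w) \<in> B k" using B_add[of "x \<otimes> (y \<ominus> w)" k "(x \<ominus> z) \<otimes> w"] 1 2 by simp
  then show "\<exists>z\<in>S. (x \<otimes> y) \<ominus> z \<in> B k" using laurent_mult[OF z(1) w(1)] S_laurent by blast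
qed

lemma S_uminus: "x \<in> S \<Longrightarrow> \<ominus> x \<in> S"
  using S_mult[OF S_laurent[OF laurent_int[of "-1"]], of x] S_carrier[of x]
  by (simp add: int_embed_uminus l_minus)

text \<open>Cancel one factor \<pi> in \<open>\<pi>_pow_eq\<close> and solve for p: every remaining
  term, including the power p - 1 of \<pi>, still contains \<pi> because p is at least 2.\<close>

lemma p_eq_\<pi>: "\<exists>h. int_embed (int p) = \<pi> \<otimes> ev \<pi> h"
proof -
  obtain w where w: "\<pi> [^] p = \<ominus> (int_embed (int p) \<otimes> \<pi> \<otimes> (\<one> \<oplus> \<pi> \<otimes> ev \<pi> w))" using \<pi>_pow_eq by blast
  define P W R where "P = int_embed (int p)" and "W = ev \<pi> w" and "R = \<pi> [^] (p - 2)"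
  have c: "P \<in> carrier K" "W \<in> carrier K" "R \<in> carrier K" by (simp_all add: P_def W_def R_def)
  have "\<pi> [^] p = \<pi> [^] (Suc (Suc (p - 2)))" using P.p_ge_2 by (intro arg_cong[where f="\<lambda>n. \<pi> [^] n"]) simp
  also have "\<dots> = R \<otimes> \<pi> \<otimes> \<pi>" by (simp add: R_def)
  finally have eq: "R \<otimes> \<pi> \<otimes> \<pi> = \<ominus> (P \<otimes> \<pi> \<otimes> (\<one> \<oplus> \<pi> \<otimes> W))" using w by (simp add: P_def W_def)
  have "\<pi> \<otimes> (P \<oplus> \<pi> \<otimes> (R \<oplus> P \<otimes> W)) = R \<otimes> \<pi> \<otimes> \<pi> \<oplus> P \<otimes> \<pi> \<otimes> (\<one> \<oplus> \<pi> \<otimes> W)" using c \<pi>_carrier by algebra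
  also have "\<dots> = \<zero>" unfolding eq using c by (simp add: l_neg)
  finally have "P \<oplus> \<pi> \<otimes> (R \<oplus> P \<otimes> W) = \<zero>" using \<pi>_nonzero c integral_iff[of \<pi> "P \<oplus> \<pi> \<otimes> (R \<oplus> P \<otimes> W)"] by simp
  then have "P = \<ominus> (\<pi> \<otimes> (R \<oplus> P \<otimes> W))" using c by (intro sum_zero_eq_neg) auto
  also have "\<dots> = \<pi> \<otimes> (\<ominus> \<one> \<otimes> R \<oplus> \<ominus> P \<otimes> W)" using c \<pi>_carrier by algebra
  also have "\<dots> = \<pi> \<otimes> ev \<pi> (smult (-1) ([:0, 1:] ^ (p - 2)) + smult (- int p) w)"
    unfolding ev_add[OF \<pi>_carrier] ev_smult[OF \<pi>_carrier] ev_power[OF \<pi>_carrier] ev_var[OF \<pi>_carrier]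
    by (simp add: int_embed_uminus P_def W_def R_def)
  finally show ?thesis unfolding P_def by blast
qed

text \<open>A constant coefficient prime to p is the leading term. Otherwise
  \<open>p_eq_\<pi>\<close> rewrites it as a multiple of \<pi>, and \<pi> splits off from the whole
  value; this ends because N bounds the valuation from above.\<close>

lemma leading_term_ev:
  "ev \<pi> f \<notin> B (int N) \<Longrightarrow> \<exists>n j. \<not> int p dvd n \<and> ev \<pi> f \<ominus> int_embed n \<otimes> \<pi> [^] j \<in> B (int (j * a) + 1)"
proof (induction N arbitrary: f)
  case 0
  then show ?case using ev_mem[OF \<pi>_mem(3)] by simp
next
  case (Suc N)
  obtain c g where f: "f = pCons c g" by (rule pCons_cases)
  have ev_f: "ev \<pi> f = int_embed c \<oplus> \<pi> \<otimes> ev \<pi> g" by (simp add: f ev_pCons)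
  show ?case
  proof (cases "int p dvd c")
    case False
    have "ev \<pi> f \<ominus> int_embed c \<otimes> \<pi> [^] (0::nat) = \<pi> \<otimes> ev \<pi> g"
      unfolding ev_f using int_embed_closed[of c] ev_closed[OF \<pi>_carrier, of g] \<pi>_carrier
      by (simp only: nat_pow_0) algebra
    moreover have "\<pi> \<otimes> ev \<pi> g \<in> B (1 + 0)" using \<pi>_mem ev_mem by (intro B_mult) auto
    ultimately show ?thesis using False by (intro exI[of _ c] exI[of _ 0]) simp
  next
    case True
    then obtain c' where c': "c = c' * int p" by (metis dvd_def mult.commute)
    obtain h where h: "int_embed (int p) = \<pi> \<otimes> ev \<pi> h" using p_eq_\<pi> by blast
    define f' where "f' = smult c' h + g"
    have "int_embed c' \<otimes> (\<pi> \<otimes> ev \<pi> h) \<oplus> \<pi> \<otimes> ev \<pi> g = \<pi> \<otimes> (int_embed c' \<otimes> ev \<pi> h \<oplus> ev \<pi> g)"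
      using int_embed_closed[of c'] ev_closed[OF \<pi>_carrier, of g] ev_closed[OF \<pi>_carrier, of h] \<pi>_carrier by algebra
    then have ev_f': "ev \<pi> f = \<pi> \<otimes> ev \<pi> f'"
      unfolding ev_f by (simp add: c' h int_embed_mult f'_def ev_add ev_smult)
    have "ev \<pi> f' \<notin> B (int N)"
    proof
      assume "ev \<pi> f' \<in> B (int N)"
      then have "ev \<pi> f \<in> B (1 + int N)" unfolding ev_f' by (rule B_mult[OF \<pi>_mem(2)])
      then show False using Suc.prems by simp
    qed
    then obtain n j where nj: "\<not> int p dvd n" "ev \<pi> f' \<ominus> int_embed n \<otimes> \<pi> [^] (j::nat) \<in> B (int (j * a) + 1)"
      using Suc.IH by blast
    define R where "R = \<pi> [^] j"
    have "\<pi> \<otimes> (ev \<pi> f' \<ominus> int_embed n \<otimes> R) \<in> B (int a + (int (j * a) + 1))"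
      using nj(2) unfolding R_def by (rule B_mult[OF \<pi>_mem(1)])
    moreover have "\<pi> \<otimes> (ev \<pi> f' \<ominus> int_embed n \<otimes> R) = ev \<pi> f \<ominus> int_embed n \<otimes> (R \<otimes> \<pi>)"
    proof -
      have "R \<in> carrier K" by (simp add: R_def)
      then show ?thesis
        unfolding ev_f' using int_embed_closed[of n] ev_closed[OF \<pi>_carrier, of f'] \<pi>_carrier by algebra
    qed
    ultimately show ?thesis
      using nj(1) by (intro exI[of _ n] exI[of _ "Suc j"]) (simp add: R_def algebra_simps)
  qed
qed

lemma val_int_embed: "\<not> int p dvd n \<Longrightarrow> int_embed n \<noteq> \<zero> \<and> val K (int_embed n) = 0"
  using int_embed_unit[of n] int_embed_mem[of n] by (intro val_eqI) auto

lemma val_monomial: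
  "\<not> int p dvd n \<Longrightarrow> int_embed n \<otimes> \<pi> [^] (j::nat) \<otimes> inv \<pi> [^] (l::nat) \<noteq> \<zero> \<and>
    val K (int_embed n \<otimes> \<pi> [^] j \<otimes> inv \<pi> [^] l) = int (j * a) - int (l * a)"
proof -
  assume n: "\<not> int p dvd n"
  have 1: "\<pi> [^] j \<noteq> \<zero>" "val K (\<pi> [^] j) = int (j * a)" "inv \<pi> [^] l \<noteq> \<zero>" "val K (inv \<pi> [^] l) = - int (l * a)"
    using nonzero_pow[OF \<pi>_carrier \<pi>_nonzero, of j] nonzero_pow[OF inv_\<pi>(1,2), of l] \<pi>_val inv_\<pi>(4) by auto
  then have 2: "int_embed n \<otimes> \<pi> [^] j \<noteq> \<zero>" "val K (int_embed n \<otimes> \<pi> [^] j) = int (j * a)"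
    using val_int_embed[OF n] val_mult[of "int_embed n" "\<pi> [^] j"] nonzero_mult by auto
  then show ?thesis using 1 val_mult[of "int_embed n \<otimes> \<pi> [^] j" "inv \<pi> [^] l"] nonzero_mult inv_\<pi>(1) by auto
qed

text \<open>An approximation in \<open>laurent\<close> to precision \<open>val K x + 1\<close> has
  the same leading term. So nonzero elements of \<open>S\<close> have valuations divisible by
  \<open>a\<close> and leading coefficients in the prime field.\<close>

lemma leading_term_S:
  assumes "x \<in> S" "x \<noteq> \<zero>"
  shows "\<exists>n j l. \<not> int p dvd n \<and> val K x = int (j * a) - int (l * a) \<and>
    x \<ominus> int_embed n \<otimes> \<pi> [^] (j::nat) \<otimes> inv \<pi> [^] (l::nat) \<in> B (val K x + 1)"
proof -
  have xc: "x \<in> carrier K" using assms by (simp add: S_def)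
  obtain z where z: "z \<in> laurent" "x \<ominus> z \<in> B (val K x + 1)" using assms by (auto simp: S_def)
  have zc: "z \<in> carrier K" using z laurent_carrier by blast
  have zv: "z \<noteq> \<zero>" "val K z = val K x" using val_close[OF xc assms(2) zc z(2)] by auto
  obtain f l where fl: "z = ev \<pi> f \<otimes> inv \<pi> [^] (l::nat)" using z(1) by (auto simp: laurent_def)
  have ev_nz: "ev \<pi> f \<noteq> \<zero>" using zv(1) fl inv_\<pi>(1) by auto
  have "ev \<pi> f \<notin> B (int (nat (val K (ev \<pi> f) + 1)))" using ev_nz by (simp add: vball_def)
  then obtain n j where nj: "\<not> int p dvd n" "ev \<pi> f \<ominus> int_embed n \<otimes> \<pi> [^] (j::nat) \<in> B (int (j * a) + 1)"
    using leading_term_ev by blast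
  define w where "w = inv \<pi> [^] l"
  have wB: "w \<in> B (- int (l * a))" and wc: "w \<in> carrier K"
    using nonzero_pow[OF inv_\<pi>(1,2), of l] inv_\<pi> by (auto simp: w_def vball_def)
  define m where "m = int_embed n \<otimes> \<pi> [^] j"
  have mc: "m \<in> carrier K" by (simp add: m_def)
  have "(ev \<pi> f \<ominus> m) \<otimes> w \<in> B (int (j * a) + 1 + - int (l * a))" using nj(2) wB unfolding m_def by (rule B_mult)
  moreover have "(ev \<pi> f \<ominus> m) \<otimes> w = z \<ominus> m \<otimes> w"
    unfolding fl w_def[symmetric] using mc wc ev_closed[OF \<pi>_carrier, of f] by algebra
  ultimately have zm: "z \<ominus> m \<otimes> w \<in> B (int (j * a) - int (l * a) + 1)" by (simp add: algebra_simps)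
  have mw: "m \<otimes> w \<noteq> \<zero>" "val K (m \<otimes> w) = int (j * a) - int (l * a)"
    using val_monomial[OF nj(1), of j l] by (simp_all add: m_def w_def)
  have "val K z = int (j * a) - int (l * a)"
    using val_close[of "m \<otimes> w" z] mw mc wc zc B_diff_commute[OF zm] by auto
  then have v: "val K x = int (j * a) - int (l * a)" using zv by simp
  have "x \<ominus> m \<otimes> w \<in> B (val K x + 1)"
    using B_diff_trans[OF z(2) _ xc zc, of "m \<otimes> w"] zm mc wc v by simp
  then show ?thesis using nj(1) v unfolding m_def w_def by blast
qed

lemma S_residue:
  assumes "x \<in> S" "x \<in> B 0"
  shows "\<exists>n. x \<ominus> int_embed n \<in> B 1"
proof (cases "x = \<zero> \<or> val K x \<noteq> 0")
  case True
  then have "x \<in> B 1" using assms(2) by (auto simp: vball_def)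
  then show ?thesis using S_carrier[OF assms(1)] by (intro exI[of _ 0]) (simp add: a_minus_def)
next
  case False
  then obtain n j l where *: "val K x = int (j * a) - int (l * a)"
    "x \<ominus> int_embed n \<otimes> \<pi> [^] (j::nat) \<otimes> inv \<pi> [^] (l::nat) \<in> B (val K x + 1)"
    using leading_term_S[OF assms(1)] by blast
  then have "int (j * a) = int (l * a)" using False by simp
  then have "j = l" using a_pos by simp
  then have "int_embed n \<otimes> \<pi> [^] (j::nat) \<otimes> inv \<pi> [^] (l::nat) = int_embed n"
    using \<pi>_cancel inv_\<pi> by (simp add: m_assoc)
  then show ?thesis using * False by auto
qed

text \<open>Approximations to the geometric series for 1 / (1 - y), obtained by iterating the map
  that sends g to 1 + y * g.\<close>

lemma S_geometric:
  assumes "y \<in> S" "y \<in> B 1"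
  shows "\<exists>g\<in>S. (\<one> \<ominus> y) \<otimes> g \<ominus> \<one> \<in> B (int N)"
proof (induction N)
  case 0
  have "\<one> \<in> S" using S_laurent[OF laurent_int[of 1]] by simp
  moreover have "(\<one> \<ominus> y) \<otimes> \<one> \<ominus> \<one> = \<ominus> y" using S_carrier[OF assms(1)] by algebra
  moreover have "\<ominus> y \<in> B 0" using B_uminus[OF assms(2)] B_antimono[of 0 1] by simp
  ultimately show ?case by (metis of_nat_0)
next
  case (Suc N)
  then obtain g where g: "g \<in> S" "(\<one> \<ominus> y) \<otimes> g \<ominus> \<one> \<in> B (int N)" by blast
  have "y \<otimes> ((\<one> \<ominus> y) \<otimes> g \<ominus> \<one>) \<in> B (1 + int N)" using assms(2) g(2) by (rule B_mult)
  moreover have "y \<otimes> ((\<one> \<ominus> y) \<otimes> g \<ominus> \<one>) = (\<one> \<ominus> y) \<otimes> (\<one> \<oplus> y \<otimes> g) \<ominus> \<one>"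
    using S_carrier[OF assms(1)] S_carrier[OF g(1)] by algebra
  moreover have "\<one> \<oplus> y \<otimes> g \<in> S"
    using S_add[OF _ S_mult[OF assms(1) g(1)]] S_laurent[OF laurent_int[of 1]] by simp
  ultimately show ?case by (metis of_nat_Suc)
qed

text \<open>Inverting the leading monomial, with its integer coefficient inverted modulo p, gives M'
  such that x * M' = 1 - y with y in the maximal ideal; the geometric series then corrects M' to an
  inverse of x.\<close>

lemma S_inv:
  assumes "x \<in> S" "x \<noteq> \<zero>"
  shows "inv x \<in> S"
proof -
  have xc: "x \<in> carrier K" using assms by (simp add: S_def)
  obtain n j l where nj: "\<not> int p dvd n" "val K x = int (j * a) - int (l * a)"
    "x \<ominus> int_embed n \<otimes> \<pi> [^] (j::nat) \<otimes> inv \<pi> [^] (l::nat) \<in> B (val K x + 1)"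
    using leading_term_S[OF assms] by blast
  have "coprime (int p) n" using prime_p nj(1) by (simp add: prime_imp_coprime)
  then obtain c d where cd: "c * int p + d * n = 1" using bezout_int[of "int p" n] by auto
  then have nd: "\<not> int p dvd d"
  proof -
    have "\<not> int p dvd 1" using P.p_ge_2 by auto
    then show ?thesis using cd by (metis dvd_add dvd_mult2 dvd_triv_right)
  qed
  define M where "M = int_embed n \<otimes> \<pi> [^] j \<otimes> inv \<pi> [^] l"
  define M' where "M' = int_embed d \<otimes> \<pi> [^] l \<otimes> inv \<pi> [^] j"
  have Mc: "M \<in> carrier K" "M' \<in> carrier K" using inv_\<pi> by (simp_all add: M_def M'_def)
  have M'S: "M' \<in> S"
    unfolding M'_def using laurent_mult[OF laurent_int[of d] laurent_\<pi>[of l j]] inv_\<pi>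
    by (intro S_laurent) (simp add: m_assoc)
  have M'v: "M' \<in> B (- val K x)"
    using val_monomial[OF nd, of l j] Mc(2) nj(2) by (simp add: M'_def vball_def)
  have "M \<otimes> M' = int_embed n \<otimes> int_embed d \<otimes> (\<pi> [^] j \<otimes> inv \<pi> [^] j) \<otimes> (\<pi> [^] l \<otimes> inv \<pi> [^] l)"
    unfolding M_def M'_def using inv_\<pi> by (simp add: m_ac)
  also have "\<dots> = int_embed (n * d)" by (simp add: \<pi>_cancel int_embed_mult)
  finally have MM: "M \<otimes> M' = int_embed (n * d)" .
  have "n * d = 1 - c * int p" using cd by (simp add: algebra_simps)
  then have "\<one> \<ominus> M \<otimes> M' = int_embed (c * int p)"
  proof -
    have "int_embed (n * d) = \<one> \<ominus> int_embed (c * int p)"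
      unfolding \<open>n * d = 1 - c * int p\<close> using int_embed_add[of 1 "- (c * int p)"]
      by (simp add: int_embed_uminus a_minus_def)
    moreover have "\<one> \<ominus> (\<one> \<ominus> int_embed (c * int p)) = int_embed (c * int p)"
      using int_embed_closed[of "c * int p"] by algebra
    ultimately show ?thesis unfolding MM by simp
  qed
  then have 1: "\<one> \<ominus> M \<otimes> M' \<in> B 1" using dvd_mem[of "c * int p"] e_pos B_antimono by auto
  define y where "y = \<one> \<ominus> x \<otimes> M'"
  have yS: "y \<in> S"
    unfolding y_def a_minus_def using S_laurent[OF laurent_int[of 1]] S_mult[OF assms(1) M'S]
    by (intro S_add S_uminus) auto
  have "(x \<ominus> M) \<otimes> M' \<in> B (val K x + 1 + - val K x)" using nj(3) M'v unfolding M_def by (rule B_mult)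
  moreover have "y = (\<one> \<ominus> M \<otimes> M') \<ominus> (x \<ominus> M) \<otimes> M'" unfolding y_def using xc Mc by algebra
  ultimately have yB: "y \<in> B 1" using B_diff[OF 1] by simp
  show ?thesis
  proof (rule S_limit)
    show ic: "inv x \<in> carrier K" using inv_mem[OF xc assms(2)] by blast
    fix k
    \<comment> \<open>Multiplication by 1 / x lowers the precision by the valuation of x, which N
      adds in advance.\<close>
    define N where "N = nat (k + val K x)"
    obtain g where g: "g \<in> S" "(\<one> \<ominus> y) \<otimes> g \<ominus> \<one> \<in> B (int N)" using S_geometric[OF yS yB] by blast
    have gc: "g \<in> carrier K" using g(1) by (rule S_carrier)
    have "inv x \<otimes> ((\<one> \<ominus> y) \<otimes> g \<ominus> \<one>) \<in> B (- val K x + int N)"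
      using inv_in_B[OF xc assms(2)] g(2) by (rule B_mult)
    then have "inv x \<otimes> ((\<one> \<ominus> y) \<otimes> g \<ominus> \<one>) \<in> B k" by (rule B_antimono[rotated]) (simp add: N_def)
    moreover have "inv x \<otimes> ((\<one> \<ominus> y) \<otimes> g \<ominus> \<one>) = M' \<otimes> g \<ominus> inv x"
    proof -
      have "\<one> \<ominus> y = x \<otimes> M'" unfolding y_def using xc Mc by algebra
      moreover have "inv x \<otimes> (x \<otimes> M' \<otimes> g \<ominus> \<one>) = (x \<otimes> inv x) \<otimes> M' \<otimes> g \<ominus> inv x" using xc ic Mc gc by algebra
      ultimately show ?thesis using inv_mem[OF xc assms(2)] Mc by simp
    qed
    ultimately have "M' \<otimes> g \<ominus> inv x \<in> B k" by simp
    then have "inv x \<ominus> M' \<otimes> g \<in> B k" using Mc gc ic by (intro B_diff_commute[of "M' \<otimes> g"]) auto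
    then show "\<exists>z\<in>S. inv x \<ominus> z \<in> B k" using S_mult[OF M'S g(1)] by blast
  qed
qed

lemma S_subfield: "subfield S K"
proof (rule subfieldI'[OF subringI])
  show "\<one> \<in> S" using S_laurent[OF laurent_int[of 1]] by simp
qed (use S_carrier S_uminus S_mult S_add S_inv in auto)

text \<open>Elements of Qp are limits of fractions c / p^n, whose images lie in \<open>S\<close>;
  the embedding is continuous because it multiplies valuations by a positive factor.\<close>

lemma \<iota>_in_S: "x \<in> carrier (Qp p) \<Longrightarrow> \<iota> x \<in> S"
proof (rule S_limit)
  assume x: "x \<in> carrier (Qp p)"
  then show "\<iota> x \<in> carrier K" by simp
  fix k
  obtain c :: int and n where cn: "x \<ominus>\<^bsub>Qp p\<^esub> P.q (of_int c / of_nat p ^ n) \<in> vball (Qp p) (int (nat k))"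
    using P.approx_q_fraction[OF x] by blast
  define r where "r = P.q (of_int c / of_nat p ^ n)"
  have rc: "r \<in> carrier (Qp p)" by (simp add: r_def)
  have "\<iota> (x \<ominus>\<^bsub>Qp p\<^esub> r) \<in> B (int (nat k))" using cn unfolding r_def by (rule \<iota>_mem)
  then have "\<iota> x \<ominus> \<iota> r \<in> B (int (nat k))" using x rc by (simp add: a_minus_def)
  then have close: "\<iota> x \<ominus> \<iota> r \<in> B k" by (rule B_antimono[rotated]) simp
  have intS: "int_embed i \<in> S" for i using S_laurent laurent_int by blast
  have pn: "int_embed (int (p ^ n)) \<noteq> \<zero>"
  proof -
    have "int_embed (int (p ^ n)) = int_embed (int p) [^] n"
      by (induction n) (simp_all add: int_embed_mult m_comm)
    then show ?thesis using nonzero_pow[OF int_embed_closed p_nonzero] by simp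
  qed
  have \<iota>_int: "\<iota> (P.q (of_int i)) = int_embed i" for i
  proof (cases i rule: int_cases)
    case (nonneg n)
    then show ?thesis using \<iota>_of_nat by simp
  next
    case (neg n)
    have "\<iota> (P.q (of_int i)) = \<iota> (\<ominus>\<^bsub>Qp p\<^esub> P.q (of_nat (Suc n)))" by (simp add: neg P.q_uminus)
    also have "\<dots> = \<ominus> int_embed (int (Suc n))" using \<iota>_of_nat[of "Suc n"] by (simp del: of_nat_Suc)
    finally show ?thesis by (simp add: neg int_embed_uminus del: of_nat_Suc)
  qed
  have "P.q (of_nat (p ^ n)) \<otimes>\<^bsub>Qp p\<^esub> r = P.q (of_int c)"
    using P.p_ge_2 by (simp add: r_def P.q_mult)
  then have "int_embed (int (p ^ n)) \<otimes> \<iota> r = int_embed c"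
    using \<iota>.hom_mult[of "P.q (of_nat (p ^ n))" r] rc \<iota>_of_nat[of "p ^ n"] \<iota>_int[of c] by simp
  then have "\<iota> r = inv (int_embed (int (p ^ n))) \<otimes> int_embed c"
    using inv_mem[OF int_embed_closed pn] rc by (metis \<iota>.hom_closed int_embed_closed l_one m_assoc m_comm)
  then have "\<iota> r \<in> S" using S_mult[OF S_inv[OF intS pn] intS] by simp
  then show "\<exists>z\<in>S. \<iota> x \<ominus> z \<in> B k" using close by blast
qed

lemma L_subset_S: "L \<subseteq> S"
  unfolding L_def
proof (rule generate_field_min_subfield1[OF _ S_subfield])
  have "\<one> \<oplus> \<pi> \<in> S"
    using S_add S_laurent[OF laurent_int[of 1]] S_laurent[OF laurent_\<pi>[of 1 0]] by simp
  then have "\<zeta> \<in> S" by (rule subst[OF \<zeta>_eq[symmetric], of "\<lambda>z. z \<in> S"])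
  then show "insert \<zeta> (\<iota> ` carrier (Qp p)) \<subseteq> S" using \<iota>_in_S by auto
  then show "insert \<zeta> (\<iota> ` carrier (Qp p)) \<subseteq> carrier K" using S_carrier by auto
qed

lemma L_residue: "x \<in> L \<Longrightarrow> x \<in> B 0 \<Longrightarrow> \<exists>n. x \<ominus> int_embed n \<in> B 1"
  using L_subset_S S_residue by blast

end

context totally_ramified_field
begin

section \<open>The value group of \<open>L\<close> and the residue field of K\<close>

lemma L_subfield: "subfield L K"
  using ram by (simp add: totally_ramified_def L_def)

lemma L_carrier: "x \<in> L \<Longrightarrow> x \<in> carrier K"
  using subfieldE(3)[OF L_subfield] by blast

lemma L_mult: "x \<in> L \<Longrightarrow> y \<in> L \<Longrightarrow> x \<otimes> y \<in> L"
  and L_one: "\<one> \<in> L" and L_uminus: "x \<in> L \<Longrightarrow> \<ominus> x \<in> L"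
  using subringE[OF subfieldE(1)[OF L_subfield]] by auto

lemma L_inv: "x \<in> L \<Longrightarrow> x \<noteq> \<zero> \<Longrightarrow> inv x \<in> L"
  using subfield_m_inv(1)[OF L_subfield, of x] by blast

definition H :: "int set" where "H = val K ` (L - {\<zero>})"

lemma H_I: "x \<in> L \<Longrightarrow> x \<noteq> \<zero> \<Longrightarrow> val K x \<in> H"
  by (simp add: H_def)

lemma H_add: "h \<in> H \<Longrightarrow> h' \<in> H \<Longrightarrow> h + h' \<in> H"
proof -
  assume "h \<in> H" "h' \<in> H"
  then obtain x y where xy: "x \<in> L" "x \<noteq> \<zero>" "h = val K x" "y \<in> L" "y \<noteq> \<zero>" "h' = val K y"
    by (auto simp: H_def)
  then have "x \<otimes> y \<in> L" "x \<otimes> y \<noteq> \<zero>" "val K (x \<otimes> y) = h + h'"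
    using L_mult nonzero_mult[of x y] val_mult[of x y] L_carrier by auto
  then show ?thesis using H_I[of "x \<otimes> y"] by simp
qed

lemma H_uminus: "h \<in> H \<Longrightarrow> - h \<in> H"
proof -
  assume "h \<in> H"
  then obtain x where x: "x \<in> L" "x \<noteq> \<zero>" "h = val K x" by (auto simp: H_def)
  then have "inv x \<in> L" "inv x \<noteq> \<zero>" "val K (inv x) = - h"
    using L_inv inv_mem[of x] val_inv[of x] L_carrier by auto
  then show ?thesis using H_I[of "inv x"] by simp
qed

lemma H_zero: "0 \<in> H"
  using H_I[OF L_one one_not_zero] val_one by simp

definition coset :: "int \<Rightarrow> int set" where "coset i = (\<lambda>h. h + i) ` H"

lemma coset_self: "i \<in> coset i"
  unfolding coset_def using H_zero by (intro image_eqI[of _ _ 0]) auto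

lemma coset_0: "coset 0 = H"
  by (simp add: coset_def)

lemma coset_eq: "k \<in> coset i \<Longrightarrow> coset k = coset i"
proof -
  assume "k \<in> coset i"
  then obtain h where h: "h \<in> H" "k = h + i" by (auto simp: coset_def)
  have "x \<in> coset k" if x: "x \<in> coset i" for x
  proof -
    obtain h' where h': "h' \<in> H" "x = h' + i" using x by (auto simp: coset_def)
    then have "x = (h' + - h) + k" using h by simp
    moreover have "h' + - h \<in> H" using H_add[OF h'(1) H_uminus[OF h(1)]] .
    ultimately show ?thesis unfolding coset_def by (rule image_eqI)
  qed
  moreover have "x \<in> coset i" if x: "x \<in> coset k" for x
  proof -
    obtain h' where h': "h' \<in> H" "x = h' + k" using x by (auto simp: coset_def)
    then have "x = (h' + h) + i" using h by simp
    moreover have "h' + h \<in> H" using H_add[OF h'(1) h(1)] .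
    ultimately show ?thesis unfolding coset_def by (rule image_eqI)
  qed
  ultimately show ?thesis by blast
qed

lemma coset_translate: "h \<in> H \<Longrightarrow> k \<in> coset i \<Longrightarrow> h + k \<in> coset i"
proof -
  assume "h \<in> H" "k \<in> coset i"
  then obtain h' where "h' \<in> H" "h + k = (h + h') + i" "h + h' \<in> H" using H_add by (auto simp: coset_def)
  then show ?thesis by (auto simp: coset_def)
qed

lemma ramification_index_eq: "ramification_index K L = card (range coset)"
proof -
  have "rcosets\<^bsub>integer_group\<^esub> H = range coset"
    by (auto simp: RCOSETS_def r_coset_def integer_group_def coset_def image_iff)
  then show ?thesis by (simp add: ramification_index_def H_def)
qed

lemma dimension_eq: "dimension (card (range coset)) L (carrier K)"
  using ram ramification_index_eq by (auto simp: totally_ramified_def L_def)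

lemma finite_cosets: "finite (range coset)"
proof (rule card_ge_0_finite, rule ccontr)
  assume "\<not> 0 < card (range coset)"
  then have "dimension 0 L (carrier K)" using dimension_eq by simp
  then have "carrier K = {\<zero>}" by (rule dimension_zero[OF L_subfield])
  then show False using one_closed one_not_zero by blast
qed

text \<open>An element \<open>y\<close> with a residue outside the prime field would give one more independent element
  than the ramification index allows.\<close>

lemma residue_pair_val:
  assumes y: "y \<in> B 0" "\<And>n. y \<ominus> int_embed n \<notin> B 1" and l: "l \<in> L" "l' \<in> L"
    and nz: "l \<otimes> y \<oplus> l' \<noteq> \<zero>"
  shows "val K (l \<otimes> y \<oplus> l') \<in> H"
proof (cases "l = \<zero> \<or> l' = \<zero>")
  case True
  have yc: "y \<in> carrier K" using y(1) by (rule B_carrier)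
  have "y \<notin> B 1" using y(2)[of 0] yc by (simp add: a_minus_def)
  then have yv: "y \<noteq> \<zero>" "val K y = 0" using val_eqI[OF y(1)] by auto
  show ?thesis
  proof (cases "l = \<zero>")
    case True
    then show ?thesis using nz l L_carrier[OF l(2)] yc by (auto simp: H_def)
  next
    case False
    then have l0: "l' = \<zero>" using True by blast
    then have "val K (l \<otimes> y \<oplus> l') = val K l" using val_mult[of l y] False yv yc L_carrier[OF l(1)] by simp
    then show ?thesis using False l(1) by (auto simp: H_def)
  qed
next
  case False
  have yc: "y \<in> carrier K" using y(1) by (rule B_carrier)
  have lc: "l \<in> carrier K" "l' \<in> carrier K" using l L_carrier by auto
  have "y \<notin> B 1" using y(2)[of 0] yc by (simp add: a_minus_def)
  then have yv: "y \<noteq> \<zero>" "val K y = 0" using val_eqI[OF y(1)] by auto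
  have ly: "l \<otimes> y \<noteq> \<zero>" "val K (l \<otimes> y) = val K l"
    using False yv yc lc nonzero_mult[of l y] val_mult[of l y] by auto
  have lH: "val K l \<in> H" "val K l' \<in> H" using False l by (auto simp: H_def)
  consider "val K l < val K l'" | "val K l' < val K l" | "val K l = val K l'" by linarith
  then show ?thesis
  proof cases
    case 1
    then show ?thesis using val_sum_distinct[of "l \<otimes> y" l'] ly lc yc False lH by auto
  next
    case 2
    then have "val K (l' \<oplus> l \<otimes> y) = val K l'" using val_sum_distinct[of l' "l \<otimes> y"] ly lc yc False by auto
    then show ?thesis using lH lc yc by (simp add: a_comm)
  next
    case 3
    define q where "q = inv l \<otimes> l'"
    have il: "inv l \<in> carrier K" "l \<otimes> inv l = \<one>" using inv_mem[of l] False lc by auto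
    have qL: "q \<in> L" using l False L_inv L_mult by (simp add: q_def)
    have "q \<in> B (- val K l + val K l')"
      unfolding q_def using inv_in_B[of l] val_self[of l'] False lc by (intro B_mult) auto
    then have "\<ominus> q \<in> B 0" using 3 B_uminus by simp
    then obtain n where n: "\<ominus> q \<ominus> int_embed n \<in> B 1" using L_residue[OF L_uminus[OF qL]] by blast
    have qc: "q \<in> carrier K" using qL L_carrier by blast
    have "y \<oplus> q \<notin> B 1"
    proof
      assume "y \<oplus> q \<in> B 1"
      then have "(y \<oplus> q) \<oplus> (\<ominus> q \<ominus> int_embed n) \<in> B 1" using n by (rule B_add)
      moreover have "(y \<oplus> q) \<oplus> (\<ominus> q \<ominus> int_embed n) = y \<ominus> int_embed n"
        using yc qc int_embed_closed[of n] by algebra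
      ultimately show False using y(2) by simp
    qed
    moreover have "y \<oplus> q \<in> B 0" using y(1) \<open>\<ominus> q \<in> B 0\<close> B_uminus[of "\<ominus> q"] qc by (intro B_add) auto
    ultimately have yq: "y \<oplus> q \<noteq> \<zero>" "val K (y \<oplus> q) = 0" using val_eqI[of "y \<oplus> q" 0] by auto
    have "l \<otimes> (y \<oplus> q) = l \<otimes> y \<oplus> (l \<otimes> inv l) \<otimes> l'" unfolding q_def using lc yc il(1) by algebra
    then have "l \<otimes> y \<oplus> l' = l \<otimes> (y \<oplus> q)" using il lc by simp
    then have "val K (l \<otimes> y \<oplus> l') = val K l" using val_mult[of l "y \<oplus> q"] yq yc qc lc False by simp
    then show ?thesis using lH by simp
  qed
qed

text \<open>Vectors are added one coset at a time. Valuations in the span so far lie in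
  \<open>H\<close> or in cosets already used, so an element with valuation in a new coset is
  independent of it. With y and 1 for \<open>H\<close> and one element for every other coset, there
  are more vectors than the dimension.\<close>

lemma K_residue:
  assumes "y \<in> B 0"
  shows "\<exists>n. y \<ominus> int_embed n \<in> B 1"
proof (rule ccontr)
  assume no: "\<not> ?thesis"
  have yc: "y \<in> carrier K" using assms by (rule B_carrier)
  have yL: "y \<notin> L" using no L_residue assms by blast
  have "\<exists>x. x \<in> carrier K \<and> x \<noteq> \<zero> \<and> val K x \<in> c" if "c \<in> range coset" for c
    using that coset_self val_exists by (metis imageE)
  then obtain \<xi> where \<xi>: "\<And>c. c \<in> range coset \<Longrightarrow> \<xi> c \<in> carrier K \<and> \<xi> c \<noteq> \<zero> \<and> val K (\<xi> c) \<in> c"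
    by metis
  have S1: "z \<in> Span L [\<one>] \<longleftrightarrow> z \<in> L" for z
    using L_carrier by (auto simp: line_extension_mem_iff)
  have S2: "z \<in> Span L [y, \<one>] \<longleftrightarrow> (\<exists>l\<in>L. \<exists>l'\<in>L. z = l \<otimes> y \<oplus> l')" for z
  proof -
    have "Span L [y, \<one>] = line_extension L y (Span L [\<one>])" by simp
    then show ?thesis using S1 by (simp only: line_extension_mem_iff) blast
  qed
  have "independent L (map \<xi> cs @ [y, \<one>]) \<and>
      (\<forall>z\<in>Span L (map \<xi> cs @ [y, \<one>]). z \<noteq> \<zero> \<longrightarrow> val K z \<in> H \<union> \<Union>(set cs))"
    if "distinct cs" "set cs \<subseteq> range coset - {H}" for cs
    using that
  proof (induction cs)
    case Nil
    have "independent L [\<one>]" by (rule li_Cons) auto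
    then have "independent L [y, \<one>]" using S1 yL yc by (intro li_Cons) auto
    moreover have "val K z \<in> H" if "z \<in> Span L [y, \<one>]" "z \<noteq> \<zero>" for z
      using that no residue_pair_val[OF assms] unfolding S2 by auto
    ultimately show ?case by auto
  next
    case (Cons c cs)
    define Us where "Us = map \<xi> cs @ [y, \<one>]"
    have IH: "independent L Us" "\<And>z. z \<in> Span L Us \<Longrightarrow> z \<noteq> \<zero> \<Longrightarrow> val K z \<in> H \<union> \<Union>(set cs)"
      using Cons by (auto simp: Us_def)
    obtain i where c: "c = coset i" "c \<noteq> H" "c \<notin> set cs" using Cons.prems by auto
    have \<xi>c: "\<xi> c \<in> carrier K" "\<xi> c \<noteq> \<zero>" "val K (\<xi> c) \<in> c" using \<xi> c by auto
    have disj: "k \<notin> H \<union> \<Union>(set cs)" if "k \<in> c" for k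
    proof
      assume "k \<in> H \<union> \<Union>(set cs)"
      then obtain c' where c': "c' \<in> insert H (set cs)" "k \<in> c'" by auto
      moreover have "\<exists>j. c' = coset j" using c' Cons.prems coset_0 by auto
      ultimately have "c' = c" using coset_eq that c(1) by metis
      then show False using c' c by auto
    qed
    have Us: "set Us \<subseteq> carrier K" using \<xi> Cons.prems yc by (auto simp: Us_def)
    have "\<xi> c \<notin> Span L Us" using IH(2) disj \<xi>c by blast
    then have "independent L (\<xi> c # Us)" using \<xi>c IH(1) by (intro li_Cons)
    moreover have "val K z \<in> H \<union> \<Union>(set (c # cs))" if z: "z \<in> Span L (\<xi> c # Us)" "z \<noteq> \<zero>" for z
    proof -
      obtain l w where lw: "l \<in> L" "w \<in> Span L Us" "z = l \<otimes> \<xi> c \<oplus> w"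
        using z(1) by (auto simp: line_extension_mem_iff)
      have lc: "l \<in> carrier K" using lw L_carrier by blast
      have wc: "w \<in> carrier K" using Span_in_carrier[OF subfieldE(3)[OF L_subfield] Us] lw(2) by blast
      show ?thesis
      proof (cases "l = \<zero>")
        case True
        then have "z = w" using lw \<xi>c wc by simp
        then show ?thesis using IH(2) lw z by auto
      next
        case False
        have v: "l \<otimes> \<xi> c \<noteq> \<zero>" "val K (l \<otimes> \<xi> c) = val K l + val K (\<xi> c)"
          using nonzero_mult[of l "\<xi> c"] val_mult[of l "\<xi> c"] False lc \<xi>c by auto
        have "val K l \<in> H" using False lw by (auto simp: H_def)
        then have vc: "val K (l \<otimes> \<xi> c) \<in> c" using v coset_translate \<xi>c(3) c(1) by auto
        show ?thesis
        proof (cases "w = \<zero>")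
          case True
          then show ?thesis using lw vc lc \<xi>c by auto
        next
          case False
          have vw: "val K w \<in> H \<union> \<Union>(set cs)" using IH(2) lw False by blast
          then have "val K w \<noteq> val K (l \<otimes> \<xi> c)" using disj vc by metis
          then consider "val K w < val K (l \<otimes> \<xi> c)" | "val K (l \<otimes> \<xi> c) < val K w" by linarith
          then show ?thesis
          proof cases
            case 1
            then have "val K z = val K w"
              using val_sum_distinct[of w "l \<otimes> \<xi> c"] lw(3) wc lc \<xi>c v False by (simp add: a_comm)
            then show ?thesis using vw by auto
          next
            case 2
            then have "val K z = val K (l \<otimes> \<xi> c)"
              using val_sum_distinct[of "l \<otimes> \<xi> c" w] lw(3) wc lc \<xi>c v False by simp
            then show ?thesis using vc by auto
          qed
        qed
      qed
    qed
    ultimately show ?case by (auto simp: Us_def)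
  qed
  moreover obtain cs where cs: "distinct cs" "set cs = range coset - {H}"
    using finite_cosets finite_distinct_list[of "range coset - {H}"] by auto
  ultimately have "independent L (map \<xi> cs @ [y, \<one>])" by blast
  moreover have "set (map \<xi> cs @ [y, \<one>]) \<subseteq> carrier K" using \<xi> cs(2) yc by auto
  ultimately have "length (map \<xi> cs @ [y, \<one>]) \<le> card (range coset)"
    using independent_length_le_dimension[OF L_subfield dimension_eq] by blast
  moreover have "length cs = card (range coset - {H})" using distinct_card[OF cs(1)] cs(2) by simp
  moreover have "card (range coset - {H}) = card (range coset) - 1"
    using coset_0 finite_cosets by (metis card_Diff_singleton rangeI)
  moreover have "length (map \<xi> cs @ [y, \<one>]) = length cs + 2" by simp
  ultimately show False by linarith
qed

end

section \<open>The filtered group of principal units\<close>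

text \<open>Composing a character with the inverse isomorphism leaves the images of all filtration
  steps unchanged.\<close>

lemma J_iso_subset:
  assumes "filtered_group G U p a" "filtered_group H V p a'"
    and \<phi>: "\<phi> \<in> iso G H" "\<And>k. \<phi> ` U k = V k"
  shows "filtered_group.J G U P \<subseteq> filtered_group.J H V P"
proof
  interpret G: filtered_group G U p a by fact
  interpret H: filtered_group H V p a' by fact
  fix A assume "A \<in> G.J P"
  then obtain \<chi> m where \<chi>: "\<chi> \<in> hom G P" "\<And>x. x \<in> U m \<Longrightarrow> \<chi> x = \<one>\<^bsub>P\<^esub>" "A = G.jump_set \<chi>"
    by (auto simp: G.J_def G.chars_def)
  define \<psi> where "\<psi> = inv_into (carrier G) \<phi>"
  have bij: "bij_betw \<phi> (carrier G) (carrier H)" using \<phi>(1) by (simp add: iso_def)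
  have \<psi>\<phi>: "\<psi> (\<phi> x) = x" if "x \<in> carrier G" for x
    using that bij by (simp add: \<psi>_def bij_betw_inv_into_left)
  have "\<psi> \<in> iso H G" unfolding \<psi>_def by (rule G.iso_set_sym[OF \<phi>(1)])
  then have "\<chi> \<circ> \<psi> \<in> hom H P" using \<chi>(1) by (auto simp: iso_def intro: hom_compose)
  moreover have "(\<chi> \<circ> \<psi>) x = \<one>\<^bsub>P\<^esub>" if x: "x \<in> V m" for x
  proof -
    obtain y where y: "y \<in> U m" "x = \<phi> y" using x \<phi>(2)[of m] by blast
    show ?thesis using \<psi>\<phi>[OF G.U_carrier[OF y(1)]] \<chi>(2)[OF y(1)] y(2) by simp
  qed
  ultimately have "\<chi> \<circ> \<psi> \<in> H.chars P" by (auto simp: H.chars_def)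
  moreover have img: "(\<chi> \<circ> \<psi>) ` V k = \<chi> ` U k" for k
    unfolding \<phi>(2)[of k, symmetric] image_comp using \<psi>\<phi> G.U_carrier by (intro image_cong) auto
  then have "H.jump_set (\<chi> \<circ> \<psi>) = A" by (simp add: \<chi>(3) H.jump_set_def G.jump_set_def)
  ultimately show "A \<in> H.J P" by (auto simp: H.J_def)
qed

definition unit_group :: "('a, 'm) valued_field_scheme \<Rightarrow> 'a monoid" where
  "unit_group K = \<lparr>carrier = principal_units K 1, monoid.mult = monoid.mult K, monoid.one = monoid.one K\<rparr>"

text \<open>Index 0 is redirected to 1, because \<open>principal_units K 0\<close> is the whole
  valuation ring and not a group of units.\<close>

definition unit_filtration :: "('a, 'm) valued_field_scheme \<Rightarrow> nat \<Rightarrow> 'a set" where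
  "unit_filtration K i = principal_units K (max 1 i)"

lemma iso_units_module:
  "iso (add_monoid (units_module p K1)) (add_monoid (units_module p K2)) = iso (unit_group K1) (unit_group K2)"
  by (simp add: units_module_def unit_group_def iso_def hom_def)

lemma hom_units_module: "hom (units_module p K) P = hom (unit_group K) P"
  by (simp add: units_module_def unit_group_def hom_def)

lemma unit_group_simps [simp]:
  "carrier (unit_group K) = principal_units K 1" "x \<otimes>\<^bsub>unit_group K\<^esub> y = x \<otimes>\<^bsub>K\<^esub> y"
  "\<one>\<^bsub>unit_group K\<^esub> = \<one>\<^bsub>K\<^esub>" "x [^]\<^bsub>unit_group K\<^esub> (n::nat) = x [^]\<^bsub>K\<^esub> n"
  by (simp_all add: unit_group_def nat_pow_def)

context local_field
begin

section \<open>Arithmetic of principal units in a local field\<close>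

lemma unit_props:
  assumes "u \<in> principal_units K i" "1 \<le> i"
  shows "u \<in> carrier K" "u \<noteq> \<zero>" "val K u = 0" "u \<in> B 0" "inv u \<in> carrier K" "inv u \<in> B 0" "u \<otimes> inv u = \<one>"
proof -
  have u: "u \<in> carrier K" "u \<ominus> \<one> \<in> B (int i)" using assms by (simp_all add: principal_units_iff)
  have "u \<ominus> \<one> \<in> B 1" using B_antimono[OF _ u(2), of 1] assms(2) by simp
  then have "\<one> \<ominus> u \<in> B 1" using u(1) by (intro B_diff_commute[of u]) auto
  then have v: "u \<noteq> \<zero> \<and> val K u = 0" using val_close[of \<one> u] u(1) val_one by simp
  then show "u \<in> carrier K" "u \<noteq> \<zero>" "val K u = 0" using u by auto
  show "u \<in> B 0" using u v by (simp add: vball_def)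
  show "inv u \<in> carrier K" "inv u \<in> B 0" "u \<otimes> inv u = \<one>" using inv_mem[of u] inv_in_B[of u] u v by auto
qed

lemma units_antimono: "i \<le> j \<Longrightarrow> principal_units K j \<subseteq> principal_units K i"
  using B_antimono[of "int i" "int j"] by (auto simp: principal_units_iff)

lemma one_unit: "\<one> \<in> principal_units K i"
  by (simp add: principal_units_iff a_minus_def r_neg)

lemma units_mult:
  assumes "u \<in> principal_units K i" "v \<in> principal_units K i" "1 \<le> i"
  shows "u \<otimes> v \<in> principal_units K i"
proof -
  have c: "u \<in> carrier K" "v \<in> carrier K" using assms by (auto simp: principal_units_iff)
  have "u \<otimes> (v \<ominus> \<one>) \<in> B (0 + int i)" using assms unit_props(4)[OF assms(1,3)] by (intro B_mult) (auto simp: principal_units_iff)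
  moreover have "u \<ominus> \<one> \<in> B (int i)" using assms by (simp add: principal_units_iff)
  moreover have "u \<otimes> v \<ominus> \<one> = u \<otimes> (v \<ominus> \<one>) \<oplus> (u \<ominus> \<one>)" using c by algebra
  ultimately show ?thesis using c by (simp add: principal_units_iff B_add)
qed

lemma units_inv:
  assumes "u \<in> principal_units K i" "1 \<le> i"
  shows "inv u \<in> principal_units K i"
proof -
  note u = unit_props[OF assms]
  have "inv u \<otimes> (u \<ominus> \<one>) \<in> B (0 + int i)" using assms u by (intro B_mult) (auto simp: principal_units_iff)
  moreover have "inv u \<otimes> (u \<ominus> \<one>) = u \<otimes> inv u \<ominus> inv u" using u by algebra
  ultimately have "\<one> \<ominus> inv u \<in> B (int i)" using u by simp
  then have "inv u \<ominus> \<one> \<in> B (int i)" using u by (intro B_diff_commute[of \<one>]) auto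
  then show ?thesis using u by (simp add: principal_units_iff)
qed

lemma comm_group_units: "comm_group (unit_group K)"
proof (rule comm_groupI)
  fix x y z assume x: "x \<in> carrier (unit_group K)"
  then have xc: "x \<in> carrier K" by (simp add: principal_units_iff)
  show "\<exists>y\<in>carrier (unit_group K). y \<otimes>\<^bsub>unit_group K\<^esub> x = \<one>\<^bsub>unit_group K\<^esub>"
    using units_inv[of x 1] unit_props[of x 1] x by (auto simp: m_comm intro!: bexI[of _ "inv x"])
  show "\<one>\<^bsub>unit_group K\<^esub> \<otimes>\<^bsub>unit_group K\<^esub> x = x" using xc by simp
  assume y: "y \<in> carrier (unit_group K)"
  then have yc: "y \<in> carrier K" by (simp add: principal_units_iff)
  show "x \<otimes>\<^bsub>unit_group K\<^esub> y \<in> carrier (unit_group K)" using x y units_mult[of x 1 y] by simp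
  show "x \<otimes>\<^bsub>unit_group K\<^esub> y = y \<otimes>\<^bsub>unit_group K\<^esub> x" using xc yc by (simp add: m_comm)
  assume "z \<in> carrier (unit_group K)"
  then show "x \<otimes>\<^bsub>unit_group K\<^esub> y \<otimes>\<^bsub>unit_group K\<^esub> z = x \<otimes>\<^bsub>unit_group K\<^esub> (y \<otimes>\<^bsub>unit_group K\<^esub> z)"
    using xc yc by (simp add: m_assoc principal_units_iff)
qed (simp add: one_unit)

interpretation UG: comm_group "unit_group K"
  by (rule comm_group_units)

lemma inv_unit_group: "u \<in> principal_units K 1 \<Longrightarrow> inv\<^bsub>unit_group K\<^esub> u = inv u"
  using units_inv[of u 1] unit_props[of u 1] by (intro UG.inv_equality) (auto simp: m_comm)

lemma unit_filtration_subset: "unit_filtration K i \<subseteq> principal_units K 1"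
  unfolding unit_filtration_def by (rule units_antimono) simp

lemma unit_filtration_iff: "u \<in> unit_filtration K i \<longleftrightarrow> u \<in> carrier K \<and> u \<ominus> \<one> \<in> B (max 1 (int i))"
  by (simp add: unit_filtration_def principal_units_iff of_nat_max)

text \<open>u / v - 1 and u - v differ by the factor v of valuation 0, so congruence in the unit
  group is congruence in K.\<close>

lemma unit_quotient_iff:
  assumes "u \<in> principal_units K 1" "v \<in> principal_units K 1"
  shows "u \<otimes>\<^bsub>unit_group K\<^esub> inv\<^bsub>unit_group K\<^esub> v \<in> unit_filtration K i \<longleftrightarrow> u \<ominus> v \<in> B (max 1 (int i))"
proof -
  have u: "u \<in> carrier K" using assms by (simp add: principal_units_iff)
  note v = unit_props[OF assms(2) order_refl]
  have e1: "(u \<ominus> v) \<otimes> inv v = u \<otimes> inv v \<ominus> \<one>"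
  proof -
    have "(u \<ominus> v) \<otimes> inv v = u \<otimes> inv v \<ominus> v \<otimes> inv v" using u v by algebra
    then show ?thesis using v by simp
  qed
  have e2: "u \<ominus> v = (u \<otimes> inv v \<ominus> \<one>) \<otimes> v"
  proof -
    have "(u \<otimes> inv v \<ominus> \<one>) \<otimes> v = u \<otimes> (v \<otimes> inv v) \<ominus> v" using u v by algebra
    then show ?thesis using u v by simp
  qed
  have "u \<otimes> inv v \<ominus> \<one> \<in> B k \<longleftrightarrow> u \<ominus> v \<in> B k" for k
    using B_mult[of "u \<ominus> v" k "inv v" 0] B_mult[of "u \<otimes> inv v \<ominus> \<one>" k v 0] v e1 e2 by auto
  then show ?thesis using u v by (simp add: unit_filtration_iff inv_unit_group[OF assms(2)])
qed

lemma unit_filtration_subgroup: "subgroup (unit_filtration K i) (unit_group K)"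
proof (rule UG.subgroupI)
  show "unit_filtration K i \<noteq> {}" using one_unit by (auto simp: unit_filtration_def)
  show "inv\<^bsub>unit_group K\<^esub> u \<in> unit_filtration K i" if "u \<in> unit_filtration K i" for u
    using that units_inv[of u "max 1 i"] inv_unit_group[of u] unit_filtration_subset[of i]
    by (auto simp: unit_filtration_def)
  show "u \<otimes>\<^bsub>unit_group K\<^esub> v \<in> unit_filtration K i" if "u \<in> unit_filtration K i" "v \<in> unit_filtration K i" for u v
    using that units_mult[of u "max 1 i" v] by (auto simp: unit_filtration_def)
qed (use unit_filtration_subset in simp)

lemma unit_filtration_complete:
  assumes f: "\<And>n. f n \<in> principal_units K 1"
    and step: "\<And>n. f (Suc n) \<ominus> f n \<in> B (max 1 (int n))"
  shows "\<exists>y\<in>principal_units K 1. \<forall>n. y \<ominus> f n \<in> B (max 1 (int n))"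
proof -
  have fc: "f n \<in> carrier K" for n using f by (simp add: principal_units_iff)
  have diff: "f m \<ominus> f n \<in> B (max 1 (int n))" if "n \<le> m" for m n
    using that
  proof (induction m rule: dec_induct)
    case base
    then show ?case using fc by (simp add: a_minus_def r_neg)
  next
    case (step m)
    have "f (Suc m) \<ominus> f m \<in> B (max 1 (int n))"
      using B_antimono[OF _ assms(2)[of m], of "max 1 (int n)"] step by simp
    then show ?case using B_diff_trans[OF _ step.IH] fc by blast
  qed
  have "vcauchy K f"
    unfolding vcauchy_def
  proof (intro conjI allI)
    show "range f \<subseteq> carrier K" using fc by auto
    fix k
    have "f m \<ominus> f n \<in> B k" if mn: "m \<ge> nat k" "n \<ge> nat k" for m n
    proof -
      have "f m \<ominus> f (nat k) \<in> B k" "f n \<ominus> f (nat k) \<in> B k"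
        using B_antimono[OF _ diff[OF mn(1)], of k] B_antimono[OF _ diff[OF mn(2)], of k] by auto
      then show ?thesis using B_diff_trans[OF _ B_diff_commute] fc by blast
    qed
    then show "\<exists>N. \<forall>m\<ge>N. \<forall>n\<ge>N. f m \<ominus> f n \<in> B k" by blast
  qed
  then obtain y where y: "y \<in> carrier K" "vlim K f y" using complete by blast
  have lim: "y \<ominus> f n \<in> B (max 1 (int n))" for n
  proof -
    obtain N where N: "\<And>m. m \<ge> N \<Longrightarrow> f m \<ominus> y \<in> B (max 1 (int n))" using y(2) unfolding vlim_def by meson
    define m where "m = max N n"
    have "y \<ominus> f m \<in> B (max 1 (int n))" using N[of m] fc y(1) by (intro B_diff_commute[of "f m"]) (auto simp: m_def)
    then show ?thesis using B_diff_trans[OF _ diff[of n m]] fc y(1) by (simp add: m_def)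
  qed
  have "f 0 \<ominus> \<one> \<in> B 1" using f[of 0] by (simp add: principal_units_iff)
  then have "y \<ominus> \<one> \<in> B 1" using B_diff_trans[OF _ _ y(1) fc[of 0] one_closed] lim[of 0] by simp
  then have "y \<in> principal_units K 1" using y(1) by (simp add: principal_units_iff)
  then show ?thesis using lim by blast
qed

text \<open>The error terms contain x^2, whose valuation is at least 2 * i and thus at least i +
  1.\<close>

lemma pow_linear:
  assumes x: "x \<in> B (int i)" "1 \<le> i"
  shows "(\<one> \<oplus> x) [^] (n::nat) \<ominus> (\<one> \<oplus> int_embed (int n) \<otimes> x) \<in> B (int i + 1)"
proof (induction n)
  case 0
  show ?case using B_carrier[OF x(1)] by (simp add: a_minus_def r_neg)
next
  case (Suc n)
  have xc: "x \<in> carrier K" using x by (simp add: B_carrier)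
  define P N where "P = (\<one> \<oplus> x) [^] n" and "N = int_embed (int n)"
  have c: "P \<in> carrier K" "N \<in> carrier K" using xc by (simp_all add: P_def N_def)
  have x0: "x \<in> B 0" using B_antimono[OF _ x(1), of 0] by simp
  have "(P \<ominus> (\<one> \<oplus> N \<otimes> x)) \<otimes> (\<one> \<oplus> x) \<in> B (int i + 1 + 0)"
    using Suc B_add[OF B_one x0] unfolding P_def N_def by (rule B_mult)
  moreover have "N \<otimes> (x \<otimes> x) \<in> B (0 + (int i + int i))" using x int_embed_mem unfolding N_def by (intro B_mult)
  then have "N \<otimes> (x \<otimes> x) \<in> B (int i + 1)" by (rule B_antimono[rotated]) (use x(2) in simp)
  moreover have "P \<otimes> (\<one> \<oplus> x) \<ominus> (\<one> \<oplus> (\<one> \<oplus> N) \<otimes> x) = (P \<ominus> (\<one> \<oplus> N \<otimes> x)) \<otimes> (\<one> \<oplus> x) \<oplus> N \<otimes> (x \<otimes> x)"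
    using c xc by algebra
  ultimately have "P \<otimes> (\<one> \<oplus> x) \<ominus> (\<one> \<oplus> (\<one> \<oplus> N) \<otimes> x) \<in> B (int i + 1)"
    using B_add[of "(P \<ominus> (\<one> \<oplus> N \<otimes> x)) \<otimes> (\<one> \<oplus> x)" "int i + 1" "N \<otimes> (x \<otimes> x)"] by simp
  then show ?case using xc by (simp add: P_def N_def int_embed_add)
qed

lemma vlim_unique:
  assumes "vlim K f x" "vlim K f y" "x \<in> carrier K" "y \<in> carrier K" "\<And>n. f n \<in> carrier K"
  shows "x = y"
proof -
  have "x \<ominus> y \<in> B (int k)" for k
  proof -
    obtain M N where "\<And>n. n \<ge> M \<Longrightarrow> f n \<ominus> x \<in> B (int k)" "\<And>n. n \<ge> N \<Longrightarrow> f n \<ominus> y \<in> B (int k)"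
      using assms(1,2) unfolding vlim_def by meson
    then have "f (max M N) \<ominus> x \<in> B (int k)" "f (max M N) \<ominus> y \<in> B (int k)" by simp_all
    then show ?thesis using B_diff_trans[OF B_diff_commute] assms by blast
  qed
  then have "x \<ominus> y = \<zero>" by (rule B_all_zero)
  then show ?thesis using assms by simp
qed

end

context totally_ramified_field
begin

interpretation UG: comm_group "unit_group K" by (rule comm_group_units)

interpretation js: jump_shift p a
  by unfold_locales (rule prime_p, rule a_pos)

text \<open>By \<open>K_residue\<close> the residue of z / x is that of an integer. Reducing it
  modulo p makes it a natural number n, and \<open>pow_linear\<close> turns the multiple n * x into
  the n-th power of 1 + x.\<close>

lemma unit_residue:
  assumes x: "x \<in> carrier K" "x \<noteq> \<zero>" "val K x = int i" and i: "1 \<le> i" and z: "z \<in> B (int i)"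
  shows "\<exists>n::nat. (\<one> \<oplus> z) \<ominus> (\<one> \<oplus> x) [^] n \<in> B (int i + 1)"
proof -
  have zc: "z \<in> carrier K" using z by (rule B_carrier)
  have xB: "x \<in> B (int i)" using x by (simp add: vball_def)
  note ix = inv_mem[OF x(1,2)]
  then have ic: "inv x \<in> carrier K" by blast
  have "z \<otimes> inv x \<in> B (int i + - int i)" using z inv_in_B[OF x(1,2)] x(3) by (intro B_mult) auto
  then obtain m where m: "z \<otimes> inv x \<ominus> int_embed m \<in> B 1" using K_residue[of "z \<otimes> inv x"] by auto
  define n where "n = nat (m mod int p)"
  have n: "int n = m mod int p" using P.p_ge_2 by (simp add: n_def)
  have "int p dvd m - int n" unfolding n by simp
  then have "int_embed (m - int n) \<in> B 1" using dvd_mem e_pos B_antimono by blast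
  moreover have "int_embed (m - int n) = int_embed m \<ominus> int_embed (int n)"
    using int_embed_add[of m "- int n"] by (simp add: int_embed_uminus a_minus_def)
  ultimately have "int_embed m \<ominus> int_embed (int n) \<in> B 1" by simp
  then have "z \<otimes> inv x \<ominus> int_embed (int n) \<in> B 1" using B_diff_trans[OF m] zc ix by simp
  then have "(z \<otimes> inv x \<ominus> int_embed (int n)) \<otimes> x \<in> B (1 + int i)" using xB by (rule B_mult)
  moreover have "(z \<otimes> inv x \<ominus> int_embed (int n)) \<otimes> x = (\<one> \<oplus> z) \<ominus> (\<one> \<oplus> int_embed (int n) \<otimes> x)"
  proof -
    have "(z \<otimes> inv x \<ominus> int_embed (int n)) \<otimes> x = z \<otimes> (x \<otimes> inv x) \<ominus> int_embed (int n) \<otimes> x"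
      using zc x(1) ic int_embed_closed[of "int n"] by algebra
    also have "\<dots> = z \<ominus> int_embed (int n) \<otimes> x" using ix zc by simp
    also have "\<dots> = (\<one> \<oplus> z) \<ominus> (\<one> \<oplus> int_embed (int n) \<otimes> x)"
      using zc x(1) int_embed_closed[of "int n"] by algebra
    finally show ?thesis .
  qed
  ultimately have "(\<one> \<oplus> z) \<ominus> (\<one> \<oplus> int_embed (int n) \<otimes> x) \<in> B (int i + 1)" by (simp add: add.commute)
  moreover have "(\<one> \<oplus> int_embed (int n) \<otimes> x) \<ominus> (\<one> \<oplus> x) [^] n \<in> B (int i + 1)"
    using pow_linear[OF xB i, of n] x(1) by (intro B_diff_commute[of "(\<one> \<oplus> x) [^] n"]) auto
  ultimately show ?thesis using B_diff_trans zc x(1) by (intro exI[of _ n]) (auto intro: B_diff_trans)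
qed

lemma unit_pow:
  assumes x: "x \<in> B (int i)" and i: "1 \<le> i"
  obtains y w where "(\<one> \<oplus> x) [^] p \<ominus> \<one> = x [^] p \<oplus> y" "x [^] p \<in> B (int (p * i))"
    "y = int_embed (int p) \<otimes> x \<otimes> (\<one> \<oplus> x \<otimes> w)" "w \<in> B 0" "y \<in> B (int (i + (p - 1) * a))"
proof -
  have xc: "x \<in> carrier K" using x by (rule B_carrier)
  have x0: "x \<in> B 0" using B_antimono[OF _ x, of 0] by simp
  obtain w where w: "(\<one> \<oplus> x) [^] p = \<one> \<oplus> x [^] p \<oplus> int_embed (int p) \<otimes> x \<otimes> (\<one> \<oplus> x \<otimes> ev x w)"
    using one_plus_pow[OF prime_p] xc by blast
  define y where "y = int_embed (int p) \<otimes> x \<otimes> (\<one> \<oplus> x \<otimes> ev x w)"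
  have w0: "ev x w \<in> B 0" using x0 by (rule ev_mem)
  have "\<one> \<oplus> x \<otimes> ev x w \<in> B 0" using B_mult[OF x0 w0] by (simp add: B_add B_one)
  then have "y \<in> B (e + int i + 0)" unfolding y_def using p_mem x by (intro B_mult)
  then have yB: "y \<in> B (int (i + (p - 1) * a))" by (simp add: e_eq add.commute)
  have "\<one> \<oplus> x [^] p \<oplus> y \<ominus> \<one> = x [^] p \<oplus> y"
  proof -
    have "x [^] p \<in> carrier K" "y \<in> carrier K" using xc by (simp_all add: y_def)
    then show ?thesis by algebra
  qed
  then show ?thesis using that[of y "ev x w"] w w0 yB B_pow[OF x, of p] by (simp add: y_def)
qed

lemma unit_decompose:
  assumes "u \<in> principal_units K i"
  obtains x where "x \<in> B (int i)" "u = \<one> \<oplus> x"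
proof -
  have u: "u \<in> carrier K" "u \<ominus> \<one> \<in> B (int i)" using assms by (simp_all add: principal_units_iff)
  have "u = \<one> \<oplus> (u \<ominus> \<one>)" using u(1) by algebra
  then show ?thesis using that u(2) by blast
qed

lemma one_plus_unit_iff: "x \<in> carrier K \<Longrightarrow> \<one> \<oplus> x \<in> principal_units K i \<longleftrightarrow> x \<in> B (int i)"
proof -
  assume x: "x \<in> carrier K"
  have "\<one> \<oplus> x \<ominus> \<one> = x" using x by algebra
  then show ?thesis using x by (simp add: principal_units_iff)
qed

lemma unit_pow_rho:
  assumes u: "u \<in> principal_units K i" and i: "1 \<le> i"
  shows "u [^] p \<in> principal_units K (js.\<rho> i)"
proof -
  obtain x where x: "x \<in> B (int i)" "u = \<one> \<oplus> x" using unit_decompose[OF u] by blast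
  have xc: "x \<in> carrier K" using x(1) by (rule B_carrier)
  obtain y w where y: "(\<one> \<oplus> x) [^] p \<ominus> \<one> = x [^] p \<oplus> y" "x [^] p \<in> B (int (p * i))"
    "y \<in> B (int (i + (p - 1) * a))"
    using unit_pow[OF x(1) i] by metis
  have "js.\<rho> i \<le> p * i \<and> js.\<rho> i \<le> i + (p - 1) * a"
  proof (cases "i \<le> a")
    case True
    then have "(p - 1) * i \<le> (p - 1) * a" by simp
    moreover have "p * i = i + (p - 1) * i" using P.p_ge_2 by (cases p) auto
    ultimately show ?thesis using True by (simp add: js.\<rho>_def)
  next
    case False
    then have "(p - 1) * a \<le> (p - 1) * i" by simp
    moreover have "p * i = i + (p - 1) * i" using P.p_ge_2 by (cases p) auto
    ultimately show ?thesis using False by (simp add: js.\<rho>_def)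
  qed
  then have "int (js.\<rho> i) \<le> int (p * i)" "int (js.\<rho> i) \<le> int (i + (p - 1) * a)" by (simp_all only: of_nat_le_iff)
  then have "x [^] p \<in> B (int (js.\<rho> i))" "y \<in> B (int (js.\<rho> i))"
    using B_antimono[OF _ y(2)] B_antimono[OF _ y(3)] by blast+
  then have "u [^] p \<ominus> \<one> \<in> B (int (js.\<rho> i))" unfolding x(2) y(1) by (rule B_add)
  then show ?thesis using x xc by (simp add: principal_units_iff)
qed

text \<open>For i different from \<open>a\<close> the terms x^p and y in the expansion of (1 + x)^p
  - 1 have different valuations, and the smaller one decides: x^p for i below \<open>a\<close>, y
  for i above.\<close>

lemma unit_pow_rho_exact:
  assumes u: "u \<in> principal_units K i" "u \<notin> principal_units K (Suc i)" and i: "1 \<le> i" "i \<noteq> a"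
  shows "u [^] p \<notin> principal_units K (Suc (js.\<rho> i))"
proof
  assume "u [^] p \<in> principal_units K (Suc (js.\<rho> i))"
  then have up: "u [^] p \<ominus> \<one> \<in> B (int (js.\<rho> i) + 1)" by (simp add: principal_units_iff add.commute)
  obtain x where x: "x \<in> B (int i)" "u = \<one> \<oplus> x" using unit_decompose[OF u(1)] by blast
  have xc: "x \<in> carrier K" using x(1) by (rule B_carrier)
  have "x \<notin> B (int (Suc i))" using u(2) x(2) one_plus_unit_iff[OF xc, of "Suc i"] by blast
  then have xv: "x \<noteq> \<zero>" "val K x = int i" using val_eqI[OF x(1)] by (auto simp: add.commute)
  obtain y w where y: "(\<one> \<oplus> x) [^] p \<ominus> \<one> = x [^] p \<oplus> y" "x [^] p \<in> B (int (p * i))"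
    "y = int_embed (int p) \<otimes> x \<otimes> (\<one> \<oplus> x \<otimes> w)" "w \<in> B 0" "y \<in> B (int (i + (p - 1) * a))"
    using unit_pow[OF x(1) i(1)] by metis
  have sum: "x [^] p \<oplus> y \<in> B (int (js.\<rho> i) + 1)" using up unfolding x(2) y(1) .
  have wc: "w \<in> carrier K" using y(4) by (rule B_carrier)
  have yc: "y \<in> carrier K" using y(5) by (rule B_carrier)
  have xp: "x [^] p \<noteq> \<zero>" "val K (x [^] p) = int (p * i)" using nonzero_pow[OF xc xv(1), of p] xv by auto
  have pi: "p * i = i + (p - 1) * i" using P.p_ge_2 by (cases p) auto
  consider "i < a" | "a < i" using i(2) by linarith
  then show False
  proof cases
    case 1
    then have \<rho>: "js.\<rho> i = p * i" by (simp add: js.\<rho>_def)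
    have "(p - 1) * i < (p - 1) * a" using 1 P.p_ge_2 by simp
    then have "int (js.\<rho> i) + 1 \<le> int (i + (p - 1) * a)" unfolding \<rho> pi by linarith
    then have "y \<in> B (int (js.\<rho> i) + 1)" using y(5) by (rule B_antimono)
    then have "(x [^] p \<oplus> y) \<ominus> y \<in> B (int (js.\<rho> i) + 1)" using sum by (intro B_diff)
    moreover have "(x [^] p \<oplus> y) \<ominus> y = x [^] p"
    proof -
      have "x [^] p \<in> carrier K" using xc by simp
      then show ?thesis using yc by algebra
    qed
    ultimately show False using xp \<rho> by (simp add: vball_def)
  next
    case 2
    then have \<rho>: "js.\<rho> i = i + (p - 1) * a" by (simp add: js.\<rho>_def)
    have "(p - 1) * a < (p - 1) * i" using 2 P.p_ge_2 by simp
    then have "int (js.\<rho> i) + 1 \<le> int (p * i)" unfolding \<rho> pi by linarith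
    then have "x [^] p \<in> B (int (js.\<rho> i) + 1)" using y(2) by (rule B_antimono)
    then have "(x [^] p \<oplus> y) \<ominus> x [^] p \<in> B (int (js.\<rho> i) + 1)" using sum by (intro B_diff)
    moreover have "(x [^] p \<oplus> y) \<ominus> x [^] p = y"
    proof -
      have "x [^] p \<in> carrier K" using xc by simp
      then show ?thesis using yc by algebra
    qed
    ultimately have yB: "y \<in> B (int (js.\<rho> i) + 1)" by simp
    have "x \<otimes> w \<in> B (int i + 0)" using x(1) y(4) by (rule B_mult)
    then have "x \<otimes> w \<in> B 1" by (rule B_antimono[rotated]) (use i(1) in simp)
    then have "\<ominus> (x \<otimes> w) \<in> B 1" by (rule B_uminus)
    moreover have "\<one> \<ominus> (\<one> \<oplus> x \<otimes> w) = \<ominus> (x \<otimes> w)" using xc wc by algebra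
    ultimately have v: "\<one> \<oplus> x \<otimes> w \<noteq> \<zero>" "val K (\<one> \<oplus> x \<otimes> w) = 0"
      using val_close[of \<one> "\<one> \<oplus> x \<otimes> w"] xc wc val_one by auto
    have px: "int_embed (int p) \<otimes> x \<noteq> \<zero>" "val K (int_embed (int p) \<otimes> x) = e + int i"
      using nonzero_mult[of "int_embed (int p)" x] val_mult[of "int_embed (int p)" x] p_nonzero xv xc
      by (auto simp: e_def)
    then have "y \<noteq> \<zero>" "val K y = e + int i"
      using nonzero_mult[of "int_embed (int p) \<otimes> x" "\<one> \<oplus> x \<otimes> w"]
        val_mult[of "int_embed (int p) \<otimes> x" "\<one> \<oplus> x \<otimes> w"] v xc wc
      by (auto simp: y(3))
    then show False using yB \<rho> by (simp add: vball_def e_eq)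
  qed
qed

text \<open>\<zeta> generates level \<open>a\<close> modulo the next one, so u = w * \<zeta>^n with
  w of level a + 1. Then u^p = w^p, and \<open>\<rho>\<close> moves level a + 1 beyond p *
  a.\<close>

lemma unit_pow_a:
  assumes u: "u \<in> principal_units K a"
  shows "u [^] p \<in> principal_units K (Suc (js.\<rho> a))"
proof -
  have a1: "1 \<le> a" using a_pos by simp
  obtain z where z: "z \<in> B (int a)" "u = \<one> \<oplus> z" using unit_decompose[OF u] by blast
  obtain n :: nat where "(\<one> \<oplus> z) \<ominus> (\<one> \<oplus> \<pi>) [^] n \<in> B (int a + 1)"
    using unit_residue[OF \<pi>_carrier \<pi>_nonzero \<pi>_val a1 z(1)] by blast
  then have n: "u \<ominus> \<zeta> [^] n \<in> B (int a + 1)" using z(2) \<zeta>_eq by simp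
  define v where "v = \<zeta> [^] n"
  have "\<zeta> \<in> principal_units K 1"
    using \<pi>_mem(2) \<zeta>_carrier by (simp add: principal_units_iff \<pi>_def)
  then have vU: "v \<in> principal_units K 1"
    using UG.nat_pow_closed[of \<zeta> n] by (simp add: v_def)
  have uU: "u \<in> principal_units K 1" using u units_antimono[OF a1] by blast
  define w where "w = u \<otimes>\<^bsub>unit_group K\<^esub> inv\<^bsub>unit_group K\<^esub> v"
  have "w \<in> unit_filtration K (Suc a)"
    unfolding w_def using unit_quotient_iff[OF uU vU, of "Suc a"] n by (simp add: v_def add.commute)
  then have w: "w \<in> principal_units K (Suc a)" by (simp add: unit_filtration_def)
  have C: "u \<in> carrier (unit_group K)" "v \<in> carrier (unit_group K)" using uU vU by simp_all
  have wU: "w \<in> carrier (unit_group K)" unfolding w_def using C by (intro UG.m_closed UG.inv_closed)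
  have "v [^]\<^bsub>unit_group K\<^esub> p = \<one>"
  proof -
    have "v [^] p = (\<zeta> [^] p) [^] n" using \<zeta>_carrier by (simp add: v_def nat_pow_pow mult.commute)
    then show ?thesis using \<zeta>_pow by simp
  qed
  moreover have "u = w \<otimes>\<^bsub>unit_group K\<^esub> v" using C unfolding w_def by (simp add: UG.m_assoc del: unit_group_simps)
  ultimately have "u [^]\<^bsub>unit_group K\<^esub> p = w [^]\<^bsub>unit_group K\<^esub> p"
    using wU C UG.nat_pow_distrib[of w v p] by (simp del: unit_group_simps) (simp add: principal_units_iff)
  then have "u [^] p = w [^] p" by simp
  moreover have "w [^] p \<in> principal_units K (js.\<rho> (Suc a))" using unit_pow_rho[OF w] by simp
  moreover have "Suc (js.\<rho> a) \<le> js.\<rho> (Suc a)" using strict_monoD[OF js.rho_strict_mono, of a "Suc a"] by simp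
  ultimately show ?thesis using units_antimono by auto
qed

lemma filtered_units: "filtered_group (unit_group K) (unit_filtration K) p a"
proof unfold_locales
  fix i :: nat
  show "unit_filtration K 0 = carrier (unit_group K)" "unit_filtration K (Suc 0) = carrier (unit_group K)"
    by (simp_all add: unit_filtration_def)
  show "unit_filtration K (Suc i) \<subseteq> unit_filtration K i"
    unfolding unit_filtration_def by (rule units_antimono) simp
  show "\<exists>x. x \<in> unit_filtration K i - unit_filtration K (Suc i)" if i: "1 \<le> i"
  proof -
    obtain x where x: "x \<in> carrier K" "x \<noteq> \<zero>" "val K x = int i" using val_exists by blast
    have "\<one> \<oplus> x \<in> unit_filtration K i - unit_filtration K (Suc i)"
      using x i one_plus_unit_iff[OF x(1)] by (simp add: unit_filtration_def max_absorb2 vball_def)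
    then show ?thesis by blast
  qed
  show "\<exists>n::int. y \<otimes>\<^bsub>unit_group K\<^esub> inv\<^bsub>unit_group K\<^esub> (x [^]\<^bsub>unit_group K\<^esub> n) \<in> unit_filtration K (Suc i)"
    if i: "1 \<le> i" and x: "x \<in> unit_filtration K i - unit_filtration K (Suc i)" and y: "y \<in> unit_filtration K i" for x y
  proof -
    have xU: "x \<in> principal_units K i" "x \<notin> principal_units K (Suc i)" and yU: "y \<in> principal_units K i"
      using x y i by (auto simp: unit_filtration_def max_absorb2)
    obtain x' where x': "x' \<in> B (int i)" "x = \<one> \<oplus> x'" using unit_decompose[OF xU(1)] by blast
    have xc: "x' \<in> carrier K" using x'(1) by (rule B_carrier)
    have "x' \<notin> B (int (Suc i))" using xU(2) x'(2) one_plus_unit_iff[OF xc, of "Suc i"] by blast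
    then have xv: "x' \<noteq> \<zero>" "val K x' = int i" using val_eqI[OF x'(1)] by (auto simp: add.commute)
    obtain y' where y': "y' \<in> B (int i)" "y = \<one> \<oplus> y'" using unit_decompose[OF yU] by blast
    obtain n :: nat where n: "y \<ominus> x [^] n \<in> B (int i + 1)"
      using unit_residue[OF xc xv i y'(1)] x'(2) y'(2) by blast
    have U1: "x \<in> principal_units K 1" "y \<in> principal_units K 1" using xU yU units_antimono[OF i] by auto
    then have "x [^] n \<in> principal_units K 1" using UG.nat_pow_closed[of x n] by simp
    then have "y \<otimes>\<^bsub>unit_group K\<^esub> inv\<^bsub>unit_group K\<^esub> (x [^] n) \<in> unit_filtration K (Suc i)"
      using unit_quotient_iff[OF U1(2), of "x [^] n" "Suc i"] n by (simp add: add.commute)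
    then have "y \<otimes>\<^bsub>unit_group K\<^esub> inv\<^bsub>unit_group K\<^esub> (x [^]\<^bsub>unit_group K\<^esub> int n) \<in> unit_filtration K (Suc i)"
      by (simp add: int_pow_int)
    then show ?thesis by blast
  qed
  show "x [^]\<^bsub>unit_group K\<^esub> p \<in> unit_filtration K (js.\<rho> i)" if "1 \<le> i" "x \<in> unit_filtration K i" for x
    using that unit_pow_rho[of x i] js.rho_gt[of i] by (simp add: unit_filtration_def max_absorb2)
  show "x [^]\<^bsub>unit_group K\<^esub> p \<notin> unit_filtration K (Suc (js.\<rho> i))"
    if "1 \<le> i" "i \<noteq> a" "x \<in> unit_filtration K i - unit_filtration K (Suc i)" for x
    using that unit_pow_rho_exact[of x i] by (simp add: unit_filtration_def max_absorb2)
  show "x [^]\<^bsub>unit_group K\<^esub> p \<in> unit_filtration K (Suc (js.\<rho> a))" if "x \<in> unit_filtration K a" for x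
    using that unit_pow_a[of x] a_pos by (simp add: unit_filtration_def max_absorb2)
  show "x = \<one>\<^bsub>unit_group K\<^esub>" if x: "\<And>i. x \<in> unit_filtration K i" for x
  proof -
    have xc: "x \<in> carrier K" using x unit_filtration_iff by blast
    have "x \<ominus> \<one> \<in> B (int k)" for k
      using x[of k] B_antimono[of "int k" "max 1 (int k)"] by (auto simp: unit_filtration_iff)
    then have "x \<ominus> \<one> = \<zero>" by (rule B_all_zero)
    then show ?thesis using xc by simp
  qed
  show "\<exists>y\<in>carrier (unit_group K). \<forall>n. y \<otimes>\<^bsub>unit_group K\<^esub> inv\<^bsub>unit_group K\<^esub> (f n) \<in> unit_filtration K n"
    if f: "\<And>n. f n \<in> carrier (unit_group K)"
      "\<And>n. f (Suc n) \<otimes>\<^bsub>unit_group K\<^esub> inv\<^bsub>unit_group K\<^esub> (f n) \<in> unit_filtration K n" for f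
  proof -
    have fU: "f n \<in> principal_units K 1" for n using f(1)[of n] by simp
    have "f (Suc n) \<ominus> f n \<in> B (max 1 (int n))" for n using f(2)[of n] unit_quotient_iff[OF fU fU] by blast
    then obtain y where y: "y \<in> principal_units K 1" "\<And>n. y \<ominus> f n \<in> B (max 1 (int n))"
      using unit_filtration_complete[of f] fU by blast
    then show ?thesis using unit_quotient_iff[OF y(1) fU] by auto
  qed
qed (simp_all add: subgroup.subset[OF unit_filtration_subgroup] subgroup.m_closed[OF unit_filtration_subgroup]
    subgroup.one_closed[OF unit_filtration_subgroup] subgroup.m_inv_closed[OF unit_filtration_subgroup]
    del: unit_group_simps)

end

section \<open>Characters, p-adic powers and the main theorem\<close>

context totally_ramified_field
begin

interpretation F: filtered_group "unit_group K" "unit_filtration K" p a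
  by (rule filtered_units)

text \<open>Each p-th power raises the level by at least one, so a power with exponent divisible by
  p^k lies in level k.\<close>

lemma unit_pow_close:
  assumes u: "u \<in> principal_units K 1" and mn: "int p ^ k dvd int m - int n"
  shows "u [^] m \<ominus> u [^] n \<in> B (int k)"
proof -
  have uC: "u \<in> carrier (unit_group K)" using u by simp
  then have uF: "u \<in> unit_filtration K 1" by (simp add: unit_filtration_def)
  obtain d where d: "int m - int n = int (p ^ k) * d" using mn by auto
  have "u [^]\<^bsub>unit_group K\<^esub> (p ^ k) \<in> unit_filtration K ((F.\<rho> ^^ k) 1)"
    by (rule F.U_pow_pow[OF order_refl uF])
  then have "u [^]\<^bsub>unit_group K\<^esub> (p ^ k) \<in> unit_filtration K k"
    using F.rho_pow_ge[of 1 k] F.U_antimono[of k "(F.\<rho> ^^ k) 1"] by auto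
  then have "(u [^]\<^bsub>unit_group K\<^esub> int (p ^ k)) [^]\<^bsub>unit_group K\<^esub> d \<in> unit_filtration K k"
    unfolding int_pow_int by (rule F.U_int_pow)
  then have "u [^]\<^bsub>unit_group K\<^esub> (int m - int n) \<in> unit_filtration K k"
    unfolding d using F.int_pow_pow[OF uC] by simp
  then have "u [^]\<^bsub>unit_group K\<^esub> m \<otimes>\<^bsub>unit_group K\<^esub> inv\<^bsub>unit_group K\<^esub> (u [^]\<^bsub>unit_group K\<^esub> n) \<in> unit_filtration K k"
    using F.int_pow_diff[OF uC, of "int m" "int n"] by (simp only: int_pow_int)
  moreover have "u [^] m \<in> principal_units K 1" "u [^] n \<in> principal_units K 1"
    using F.nat_pow_closed[OF uC] by simp_all
  ultimately have "u [^] m \<ominus> u [^] n \<in> B (max 1 (int k))"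
    using unit_quotient_iff[of "u [^] m" "u [^] n" k] by simp
  then show ?thesis by (rule B_antimono[rotated]) simp
qed

text \<open>Justifies the definite description in \<open>zp_power\<close>: existence by
  completeness, uniqueness from one approximating sequence, and independence of the sequence because
  the exponents become congruent modulo every p^k.\<close>

lemma zp_power_limit:
  assumes \<alpha>: "\<alpha> \<in> carrier (Zp p)" and u: "u \<in> principal_units K 1"
  shows "zp_power p K \<alpha> u \<in> principal_units K 1 \<and>
    (\<forall>s :: nat \<Rightarrow> nat. vlim (Qp p) (\<lambda>n. [s n] \<cdot>\<^bsub>Qp p\<^esub> \<one>\<^bsub>Qp p\<^esub>) \<alpha> \<longrightarrow> vlim K (\<lambda>n. u [^] s n) (zp_power p K \<alpha> u))"
proof -
  have \<alpha>c: "\<alpha> \<in> carrier (Qp p)" using \<alpha> by (simp add: P.Zp_carrier vball_def)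
  have uc: "u \<in> carrier K" using u by (simp add: principal_units_iff)
  obtain f :: "nat \<Rightarrow> nat" where f: "vlim (Qp p) (\<lambda>n. [f n] \<cdot>\<^bsub>Qp p\<^esub> \<one>\<^bsub>Qp p\<^esub>) \<alpha>" using P.nat_dense[OF \<alpha>] by blast
  have close: "\<exists>N. \<forall>m\<ge>N. \<forall>n\<ge>N. u [^] g m \<ominus> u [^] f n \<in> B k"
    if g: "vlim (Qp p) (\<lambda>n. [g n] \<cdot>\<^bsub>Qp p\<^esub> \<one>\<^bsub>Qp p\<^esub>) \<alpha>" for g :: "nat \<Rightarrow> nat" and k
  proof -
    obtain N where "\<And>m n. m \<ge> N \<Longrightarrow> n \<ge> N \<Longrightarrow> int p ^ nat k dvd int (g m) - int (f n)"
      using P.vlim_nat_cong[OF g f \<alpha>c] by meson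
    then have "u [^] g m \<ominus> u [^] f n \<in> B (int (nat k))" if "m \<ge> N" "n \<ge> N" for m n
      using unit_pow_close[OF u] that by blast
    then have "u [^] g m \<ominus> u [^] f n \<in> B k" if "m \<ge> N" "n \<ge> N" for m n
      using B_antimono[of k "int (nat k)"] that by simp
    then show ?thesis by blast
  qed
  have "vcauchy K (\<lambda>n. u [^] f n)" using close[OF f] uc by (auto simp: vcauchy_def)
  then obtain y where y: "y \<in> carrier K" "vlim K (\<lambda>n. u [^] f n) y" using complete by blast
  have lim: "vlim K (\<lambda>n. u [^] g n) y" if g: "vlim (Qp p) (\<lambda>n. [g n] \<cdot>\<^bsub>Qp p\<^esub> \<one>\<^bsub>Qp p\<^esub>) \<alpha>" for g :: "nat \<Rightarrow> nat"
    unfolding vlim_def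
  proof
    fix k
    obtain M where M: "\<And>n. n \<ge> M \<Longrightarrow> u [^] f n \<ominus> y \<in> B k" using y(2) unfolding vlim_def by meson
    obtain N where N: "\<And>m n. m \<ge> N \<Longrightarrow> n \<ge> N \<Longrightarrow> u [^] g m \<ominus> u [^] f n \<in> B k" using close[OF g] by meson
    have "u [^] g n \<ominus> y \<in> B k" if n: "n \<ge> max M N" for n
      using B_diff_trans[OF N[of n n] M[of n]] n uc y(1) by simp
    then show "\<exists>N. \<forall>n\<ge>N. u [^] g n \<ominus> y \<in> B k" by blast
  qed
  have eq: "zp_power p K \<alpha> u = y"
    unfolding zp_power_def
  proof (rule the_equality)
    fix z assume "z \<in> carrier K \<and> (\<forall>s :: nat \<Rightarrow> nat. vlim (Qp p) (\<lambda>n. [s n] \<cdot>\<^bsub>Qp p\<^esub> \<one>\<^bsub>Qp p\<^esub>) \<alpha> \<longrightarrow> vlim K (\<lambda>n. u [^] s n) z)"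
    then have "z \<in> carrier K" "vlim K (\<lambda>n. u [^] f n) z" using f by blast+
    then show "z = y" using y uc by (intro vlim_unique[of "\<lambda>n. u [^] f n"]) simp_all
  qed (use y lim in blast)
  have "y \<in> principal_units K 1"
  proof -
    obtain M where M: "\<And>n. n \<ge> M \<Longrightarrow> u [^] f n \<ominus> y \<in> B 1" using y(2) unfolding vlim_def by meson
    have "u [^] f M \<in> principal_units K 1" using F.nat_pow_closed[of u] u by simp
    then have "u [^] f M \<ominus> \<one> \<in> B 1" by (simp add: principal_units_iff)
    moreover have "y \<ominus> u [^] f M \<in> B 1" using B_diff_commute[OF M[OF order_refl]] uc y(1) by simp
    ultimately have "y \<ominus> \<one> \<in> B 1" using B_diff_trans y(1) uc by blast
    then show ?thesis using y(1) by (simp add: principal_units_iff)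
  qed
  then show ?thesis using lim unfolding eq by blast
qed

lemma topspace_vtopology: "topspace (vtopology K) = carrier K"
proof
  show "topspace (vtopology K) \<subseteq> carrier K" using openin_vtopology[of K "topspace (vtopology K)"] by simp
  have "openin (vtopology K) (carrier K)" unfolding openin_vtopology by auto
  then show "carrier K \<subseteq> topspace (vtopology K)" by (rule openin_subset)
qed

text \<open>Continuity makes the kernel open, so it contains all principal units in a ball around 1;
  conversely, a homomorphism trivial on a filtration step is constant on the balls of the
  corresponding radius.\<close>

lemma character_iff: "character p K \<chi> \<longleftrightarrow> \<chi> \<in> F.chars (Qp_mod_Zp p)"
proof
  interpret PG: prufer_group "Qp_mod_Zp p" p P.unit_fraction by (rule P.prufer_Qp_mod_Zp)
  {
    assume "character p K \<chi>"
    then have hom: "\<chi> \<in> hom (unit_group K) (Qp_mod_Zp p)"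
      and cont: "continuous_map (subtopology (vtopology K) (principal_units K 1))
        (discrete_topology (carrier (Qp_mod_Zp p))) \<chi>"
      by (simp_all only: character_def hom_units_module)
    interpret h: group_hom "unit_group K" "Qp_mod_Zp p" \<chi>
      using hom by (simp add: group_hom_def group_hom_axioms_def F.is_group PG.is_group)
    have top: "topspace (subtopology (vtopology K) (principal_units K 1)) = principal_units K 1"
      using topspace_vtopology principal_units_iff by (auto simp: topspace_subtopology)
    have "openin (discrete_topology (carrier (Qp_mod_Zp p))) {\<one>\<^bsub>Qp_mod_Zp p\<^esub>}" by simp
    then have "openin (subtopology (vtopology K) (principal_units K 1)) {x \<in> principal_units K 1. \<chi> x \<in> {\<one>\<^bsub>Qp_mod_Zp p\<^esub>}}"
      using cont unfolding continuous_map_def top by blast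
    then obtain A where A: "openin (vtopology K) A" "{x \<in> principal_units K 1. \<chi> x = \<one>\<^bsub>Qp_mod_Zp p\<^esub>} = A \<inter> principal_units K 1"
      unfolding openin_subtopology by auto
    have "\<one> \<in> A" using A(2) one_unit[of 1] h.hom_one by auto
    then obtain k where k: "\<And>y. y \<in> carrier K \<Longrightarrow> y \<ominus> \<one> \<in> B k \<Longrightarrow> y \<in> A"
      using A(1) unfolding openin_vtopology by meson
    have "\<chi> x = \<one>\<^bsub>Qp_mod_Zp p\<^esub>" if x: "x \<in> unit_filtration K (nat k)" for x
    proof -
      have "x \<in> carrier K" "x \<ominus> \<one> \<in> B (max 1 (int (nat k)))" using x by (auto simp: unit_filtration_iff)
      then have "x \<in> A" using k B_antimono[of k "max 1 (int (nat k))"] by simp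
      moreover have "x \<in> principal_units K 1" using x unit_filtration_subset by blast
      ultimately show ?thesis using A(2) by blast
    qed
    then show "\<chi> \<in> F.chars (Qp_mod_Zp p)" using hom by (auto simp: F.chars_def)
  }
  {
    assume "\<chi> \<in> F.chars (Qp_mod_Zp p)"
    then obtain m where hom: "\<chi> \<in> hom (unit_group K) (Qp_mod_Zp p)"
      and m: "\<And>x. x \<in> unit_filtration K m \<Longrightarrow> \<chi> x = \<one>\<^bsub>Qp_mod_Zp p\<^esub>"
      by (auto simp: F.chars_def)
    interpret h: group_hom "unit_group K" "Qp_mod_Zp p" \<chi>
      using hom by (simp add: group_hom_def group_hom_axioms_def F.is_group PG.is_group)
    have top: "topspace (subtopology (vtopology K) (principal_units K 1)) = principal_units K 1"
      using topspace_vtopology principal_units_iff by (auto simp: topspace_subtopology)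
    have "openin (subtopology (vtopology K) (principal_units K 1)) {x \<in> principal_units K 1. \<chi> x \<in> A}" for A
    proof -
      define D where "D = {x \<in> principal_units K 1. \<chi> x \<in> A}"
      have "y \<in> D" if x: "x \<in> D" and y: "y \<in> carrier K" "y \<ominus> x \<in> B (max 1 (int m))" for x y
      proof -
        have xU: "x \<in> principal_units K 1" "\<chi> x \<in> A" using x by (auto simp: D_def)
        then have xc: "x \<in> carrier K" "x \<ominus> \<one> \<in> B 1" by (auto simp: principal_units_iff)
        have "y \<ominus> x \<in> B 1" using B_antimono[OF _ y(2), of 1] by simp
        then have "y \<ominus> \<one> \<in> B 1" using B_diff_trans xc y(1) by blast
        then have yU: "y \<in> principal_units K 1" using y(1) by (simp add: principal_units_iff)
        have "y \<otimes>\<^bsub>unit_group K\<^esub> inv\<^bsub>unit_group K\<^esub> x \<in> unit_filtration K m"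
          using unit_quotient_iff[OF yU xU(1)] y(2) by blast
        then have "\<chi> (y \<otimes>\<^bsub>unit_group K\<^esub> inv\<^bsub>unit_group K\<^esub> x) = \<one>\<^bsub>Qp_mod_Zp p\<^esub>" by (rule m)
        moreover have C: "x \<in> carrier (unit_group K)" "y \<in> carrier (unit_group K)" using xU yU by simp_all
        ultimately have "\<chi> y \<otimes>\<^bsub>Qp_mod_Zp p\<^esub> inv\<^bsub>Qp_mod_Zp p\<^esub> \<chi> x = \<one>\<^bsub>Qp_mod_Zp p\<^esub>"
          by (simp del: unit_group_simps)
        then have "\<chi> y = \<chi> x" using C h.hom_closed PG.inv_equality PG.inv_inv PG.inv_closed by metis
        then show ?thesis using yU xU by (simp add: D_def)
      qed
      moreover have "D \<subseteq> carrier K" by (auto simp: D_def principal_units_iff)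
      ultimately have "openin (vtopology K) D" unfolding openin_vtopology by blast
      moreover have "D = D \<inter> principal_units K 1" by (auto simp: D_def)
      ultimately show ?thesis unfolding D_def openin_subtopology by blast
    qed
    moreover have "\<chi> x \<in> carrier (Qp_mod_Zp p)" if "x \<in> principal_units K 1" for x
      using h.hom_closed that by simp
    ultimately show "character p K \<chi>"
      unfolding character_def hom_units_module continuous_map_def top using hom by auto
  }
qed

lemma jump_sets_eq: "jump_sets p K = F.J (Qp_mod_Zp p)"
proof -
  have "jumps K \<chi> = F.jump_set \<chi>" for \<chi> :: "'a \<Rightarrow> padic set"
    by (simp add: jumps_def F.jump_set_def unit_filtration_def max_absorb2 cong: conj_cong)
  then show ?thesis using character_iff by (auto simp: jump_sets_def F.J_def)
qed

end

text \<open>An isomorphism that respects the filtration is continuous, so it commutes with the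
  limits of natural powers that define p-adic powers.\<close>

lemma unit_iso_zp_power:
  assumes "totally_ramified_field K1 p \<iota>1 \<zeta>1" "totally_ramified_field K2 p \<iota>2 \<zeta>2"
    and iso: "\<phi> \<in> iso (unit_group K1) (unit_group K2)"
    and filt: "\<And>k. \<phi> ` unit_filtration K1 k = unit_filtration K2 k"
    and \<alpha>: "\<alpha> \<in> carrier (Zp p)" and u: "u \<in> principal_units K1 1"
  shows "\<phi> (zp_power p K1 \<alpha> u) = zp_power p K2 \<alpha> (\<phi> u)"
proof -
  interpret K1: totally_ramified_field K1 p \<iota>1 \<zeta>1 by fact
  interpret K2: totally_ramified_field K2 p \<iota>2 \<zeta>2 by fact
  interpret F1: comm_group "unit_group K1" by (rule K1.comm_group_units)
  interpret F2: comm_group "unit_group K2" by (rule K2.comm_group_units)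
  interpret h: group_hom "unit_group K1" "unit_group K2" \<phi>
    using iso by (simp add: group_hom_def group_hom_axioms_def iso_def F1.is_group F2.is_group)
  have \<phi>U: "\<phi> x \<in> principal_units K2 1" if "x \<in> principal_units K1 1" for x using h.hom_closed that by simp
  obtain f :: "nat \<Rightarrow> nat" where f: "vlim (Qp p) (\<lambda>n. [f n] \<cdot>\<^bsub>Qp p\<^esub> \<one>\<^bsub>Qp p\<^esub>) \<alpha>"
    using K1.P.nat_dense[OF \<alpha>] by blast
  define y where "y = zp_power p K1 \<alpha> u"
  have y: "y \<in> principal_units K1 1" "vlim K1 (\<lambda>n. u [^]\<^bsub>K1\<^esub> f n) y"
    using K1.zp_power_limit[OF \<alpha> u] f by (auto simp: y_def)
  have lim: "vlim K2 (\<lambda>n. \<phi> u [^]\<^bsub>K2\<^esub> f n) (\<phi> y)"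
    unfolding vlim_def
  proof
    fix k
    obtain N where N: "\<And>n. n \<ge> N \<Longrightarrow> u [^]\<^bsub>K1\<^esub> f n \<ominus>\<^bsub>K1\<^esub> y \<in> vball K1 (max 1 (int (nat k)))"
      using y(2) unfolding vlim_def by meson
    have "\<phi> u [^]\<^bsub>K2\<^esub> f n \<ominus>\<^bsub>K2\<^esub> \<phi> y \<in> vball K2 k" if n: "n \<ge> N" for n
    proof -
      have uf: "u [^]\<^bsub>K1\<^esub> f n \<in> principal_units K1 1" using F1.nat_pow_closed[of u "f n"] u by simp
      have "u [^]\<^bsub>K1\<^esub> f n \<otimes>\<^bsub>unit_group K1\<^esub> inv\<^bsub>unit_group K1\<^esub> y \<in> unit_filtration K1 (nat k)"
        using K1.unit_quotient_iff[OF uf y(1)] N[OF n] by blast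
      then have "\<phi> (u [^]\<^bsub>unit_group K1\<^esub> f n \<otimes>\<^bsub>unit_group K1\<^esub> inv\<^bsub>unit_group K1\<^esub> y) \<in> unit_filtration K2 (nat k)"
        using filt by auto
      moreover have C: "u \<in> carrier (unit_group K1)" "y \<in> carrier (unit_group K1)" using u y by simp_all
      ultimately have "\<phi> u [^]\<^bsub>unit_group K2\<^esub> f n \<otimes>\<^bsub>unit_group K2\<^esub> inv\<^bsub>unit_group K2\<^esub> \<phi> y \<in> unit_filtration K2 (nat k)"
        by (simp del: unit_group_simps add: h.hom_nat_pow)
      moreover have "\<phi> u [^]\<^bsub>K2\<^esub> f n \<in> principal_units K2 1" using F2.nat_pow_closed[of "\<phi> u" "f n"] \<phi>U[OF u] by simp
      ultimately have "\<phi> u [^]\<^bsub>K2\<^esub> f n \<ominus>\<^bsub>K2\<^esub> \<phi> y \<in> vball K2 (max 1 (int (nat k)))"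
        using K2.unit_quotient_iff[of "\<phi> u [^]\<^bsub>K2\<^esub> f n" "\<phi> y" "nat k"] \<phi>U[OF y(1)] by simp
      then show ?thesis by (rule K2.B_antimono[rotated]) simp
    qed
    then show "\<exists>N. \<forall>n\<ge>N. \<phi> u [^]\<^bsub>K2\<^esub> f n \<ominus>\<^bsub>K2\<^esub> \<phi> y \<in> vball K2 k" by blast
  qed
  have z: "zp_power p K2 \<alpha> (\<phi> u) \<in> principal_units K2 1" "vlim K2 (\<lambda>n. \<phi> u [^]\<^bsub>K2\<^esub> f n) (zp_power p K2 \<alpha> (\<phi> u))"
    using K2.zp_power_limit[OF \<alpha> \<phi>U[OF u]] f by auto
  have c: "\<phi> u \<in> carrier K2" "\<phi> y \<in> carrier K2" "zp_power p K2 \<alpha> (\<phi> u) \<in> carrier K2"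
    using \<phi>U[OF u] \<phi>U[OF y(1)] z(1) by (simp_all add: K2.principal_units_iff)
  show ?thesis
    unfolding y_def[symmetric] using lim z(2) c by (intro K2.vlim_unique[of "\<lambda>n. \<phi> u [^]\<^bsub>K2\<^esub> f n"]) simp_all
qed

theorem theorem1p18:
  fixes p :: nat and K1 :: "'a valued_field" and K2 :: "'b valued_field"
  assumes "Factorial_Ring.prime p"
    and "totally_ramified_over_Qp_zeta p K1"
    and "totally_ramified_over_Qp_zeta p K2"
  shows "jump_sets p K1 = jump_sets p K2 \<longleftrightarrow>
    (\<exists>\<phi>. filtered_module_iso (Zp p) (units_module p K1) (principal_units K1)
      (units_module p K2) (principal_units K2) \<phi>)"
proof -
  obtain \<iota>1 \<zeta>1 \<iota>2 \<zeta>2 where K: "totally_ramified_field K1 p \<iota>1 \<zeta>1" "totally_ramified_field K2 p \<iota>2 \<zeta>2"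
    using assms unfolding totally_ramified_over_Qp_zeta_def totally_ramified_field_def totally_ramified_field_axioms_def
    by blast
  interpret K1: totally_ramified_field K1 p \<iota>1 \<zeta>1 by (rule K(1))
  interpret K2: totally_ramified_field K2 p \<iota>2 \<zeta>2 by (rule K(2))
  note F = K1.filtered_units K2.filtered_units
  show ?thesis
  proof
    assume "jump_sets p K1 = jump_sets p K2"
    then obtain \<phi> where \<phi>: "\<phi> \<in> iso (unit_group K1) (unit_group K2)" "\<And>k. \<phi> ` unit_filtration K1 k = unit_filtration K2 k"
      using filtered_groups_iso[OF F K1.P.prufer_Qp_mod_Zp] unfolding K1.jump_sets_eq K2.jump_sets_eq by blast
    have "\<phi> ` principal_units K1 i = principal_units K2 i" if "1 \<le> i" for i
      using \<phi>(2)[of i] that by (simp add: unit_filtration_def max_absorb2)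
    moreover have "\<phi> (\<alpha> \<odot>\<^bsub>units_module p K1\<^esub> x) = \<alpha> \<odot>\<^bsub>units_module p K2\<^esub> \<phi> x"
      if "\<alpha> \<in> carrier (Zp p)" "x \<in> carrier (units_module p K1)" for \<alpha> x
      using unit_iso_zp_power[OF K \<phi> that(1)] that(2) by (simp add: units_module_def)
    ultimately show "\<exists>\<phi>. filtered_module_iso (Zp p) (units_module p K1) (principal_units K1)
        (units_module p K2) (principal_units K2) \<phi>"
      using \<phi>(1) unfolding filtered_module_iso_def iso_units_module by blast
  next
    assume "\<exists>\<phi>. filtered_module_iso (Zp p) (units_module p K1) (principal_units K1)
      (units_module p K2) (principal_units K2) \<phi>"
    then obtain \<phi> where iso: "\<phi> \<in> iso (unit_group K1) (unit_group K2)"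
      and filt: "\<And>i. 1 \<le> i \<Longrightarrow> \<phi> ` principal_units K1 i = principal_units K2 i"
      unfolding filtered_module_iso_def iso_units_module by blast
    have \<phi>: "\<phi> ` unit_filtration K1 k = unit_filtration K2 k" for k
      unfolding unit_filtration_def by (rule filt) simp
    \<comment> \<open>The inverse is a filtered isomorphism as well, so the inclusion between the
      families of jump sets holds in both directions.\<close>
    define \<psi> where "\<psi> = inv_into (principal_units K1 1) \<phi>"
    have \<psi>_iso: "\<psi> \<in> iso (unit_group K2) (unit_group K1)"
      using group.iso_set_sym[OF _ iso] K1.comm_group_units by (simp add: \<psi>_def comm_group_def)
    have \<psi>: "\<psi> ` unit_filtration K2 k = unit_filtration K1 k" for k
    proof -
      have "inj_on \<phi> (principal_units K1 1)" using iso by (simp add: iso_def bij_betw_def)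
      then show ?thesis
        unfolding \<phi>[of k, symmetric] \<psi>_def by (rule inv_into_image_cancel) (rule K1.unit_filtration_subset)
    qed
    show "jump_sets p K1 = jump_sets p K2"
      unfolding K1.jump_sets_eq K2.jump_sets_eq
      using J_iso_subset[OF F iso \<phi>] J_iso_subset[OF F(2,1) \<psi>_iso \<psi>] by blast
  qed
qed

end
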